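(* The following assignments define a double pseudofunctor $\mathrm{Ho}\colon \mathsf{Model}\to\mathsf{Cat}$ from the double category of model categories to the double category of categories. A model category $\mathcal C$ goes to its homotopy category $\mathrm{Ho}(\mathcal C)$. A vertical arrow (left Quillen functor) $f$ goes to its left derived functor $\mathbf L f$. A horizontal arrow (right Quillen functor) $g$ goes to its right derived functor $\mathbf R g$. A square $\alpha\colon kf\to gh$, with $f\colon\mathcal A\to\mathcal C$ and $g\colon\mathcal B\to\mathcal D$ right Quillen and $h\colon\mathcal A\to\mathcal B$ and $k\colon\mathcal C\to\mathcal D$ left Quillen, goes to the derived transformation $\mathrm{Ho}(\alpha)\colon \mathbf L k\circ\mathbf R f\to\mathbf R g\circ\mathbf L h$ represented in $\mathrm{Ho}(\mathcal D)$ by the zigzag $$kQfR \xleftarrow{\ \sim\ } kQfQR \to kfQR \xrightarrow{\alpha} ghQR \to gRhQR \xleftarrow{\ \sim\ } gRhQ .$$ The constraint cells are those of the ordinary pseudofunctors $\mathbf L$ and $\mathbf R$.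
   Context: **Double categories.** A double category $\mathsf K$ has objects; two categories with these objects, whose arrows are called vertical and horizontal 1-cells; and squares (2-cells) $\alpha$. Each square has a boundary: top horizontal $f\colon a\to c$, left vertical $h\colon a\to b$, right vertical $k\colon c\to d$, bottom horizontal $g\colon b\to d$. Squares compose horizontally, $\alpha\ast_h\beta$ ($\alpha$ on the left, $\beta$ on the right), and vertically, $\beta\ast_v\alpha$ ($\alpha$ on top, $\beta$ below). Both compositions are associative and unital and satisfy interchange. The vertical and horizontal identities of $a$ are $1_a$ and $1^a$. A vertical $u\colon a\to b$ has an identity square $1^u$ (left and right $u$, top $1^a$, bottom $1^b$), and a horizontal $f$ has an identity square $1_f$ (top and bottom $f$, left and right identities). These satisfy $1^{1_a}=1_{1^a}$, $1^g\ast_v 1^f=1^{gf}$ and $1_f\ast_h1_g=1_{gf}$. A square is h-globular if its left and right sides are identities, and v-globular if its top and bottom sides are identities. **Double pseudofunctors.** A double pseudofunctor $F\colon\mathsf K\to\mathsf L$ consists of functions on objects, vertical 1-cells, horizontal 1-cells and squares preserving boundaries, together with: - for each object $a$, an invertible h-globular square $F_a$ (top $F(1^a)$, bottom $1^{Fa}$) and an invertible v-globular square $F^a$ (left $1_{Fa}$, right $F(1_a)$); - for vertical $a\xrightarrow{f}b\xrightarrow{g}c$, an invertible v-globular $F^{gf}$ (left $Fg\circ Ff$, right $F(gf)$); - for horizontal $a\xrightarrow{h}b\xrightarrow{k}c$, an invertible h-globular $F_{kh}$ (top $F(kh)$, bottom $Fk\circ Fh$). These satisfy the usual pseudofunctor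 coherence axioms in both directions. - Vertical: $(1^{Fh}\ast_v F^{gf})\ast_h F^{h(gf)}=(F^{hg}\ast_v1^{Ff})\ast_hF^{(hg)f}$, $(F^b\ast_v1^{Ff})\ast_hF^{1_bf}=1^{Ff}$, $(1^{Ff}\ast_vF^a)\ast_hF^{f1_a}=1^{Ff}$. - Horizontal: $(F_{gf}\ast_h1_{Fh})\ast_vF_{h(gf)}=(1_{Ff}\ast_hF_{hg})\ast_vF_{(hg)f}$, $(F_a\ast_h1_{Ff})\ast_vF_{f1^a}=1_{Ff}$, $(1_{Ff}\ast_hF_b)\ast_vF_{1^bf}=1_{Ff}$. They also satisfy the double naturality axioms. - If $\alpha$ has top $f$, bottom $h$ and $\beta$ has top $g$, bottom $k$, and they are horizontally composable, then $(F\alpha\ast_hF\beta)\ast_vF_{gf}=F_{kh}\ast_vF(\alpha\ast_h\beta)$. - For vertical $f\colon a\to b$, $F_b\ast_vF(1^f)\ast_vF_a^{-1}=1^{Ff}$. - Transposed versions: if $\alpha$ (left $u$, right $w$) lies above $\beta$ (left $v$, right $x$), then $F^{vu}\ast_hF(\beta\ast_v\alpha)=(F\beta\ast_vF\alpha)\ast_hF^{xw}$; and for horizontal $f\colon a\to b$, $F^a\ast_hF(1_f)\ast_h(F^b)^{-1}=1_{Ff}$. **The double categories involved.** $\mathsf{Cat}$ has (possibly large) categories as objects and functors as both vertical and horizontal arrows. A square with top $f$, left $h$, right $k$, bottom $g$ is a natural transformation $kf\to gh$. $\mathsf{Model}$ has as objects model categories (with functorial factorizations), as vertical arrows left Quillen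 functors (having a right adjoint and preserving cofibrations and acyclic cofibrations), as horizontal arrows right Quillen functors, and as squares arbitrary natural transformations $kf\to gh$. **Derived functors and constraints.** $Q$ and $R$ are the functorial cofibrant and fibrant replacements given by the factorizations, with $\pi\colon Q\to\mathrm{Id}$ a natural acyclic fibration and $\rho\colon\mathrm{Id}\to R$ a natural acyclic cofibration; in particular $Q$ preserves fibrant objects and $R$ preserves cofibrant objects. $\mathbf Lf$ is induced by $f\circ Q$ and $\mathbf Rg$ by $g\circ R$. All unlabelled maps in the zigzag are induced by $\pi$ and $\rho$. The constraints are: $\mathbf L g\,\mathbf L f\cong\mathbf L(gf)$ represented by $g\pi fQ\colon gQfQ\to gfQ$; $\mathbf L(\mathrm{Id})\cong\mathrm{Id}$ represented by $\pi$; and dually $\mathbf R(gf)\cong\mathbf Rg\,\mathbf Rf$ represented by $g\rho fR\colon gfR\to gRfR$ and $\mathrm{Id}\cong\mathbf R(\mathrm{Id})$ represented by $\rho$ (or their inverses, as the directions above require). *)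

theory Defs
  imports
    "HOL-Library.FuncSet"
    "HOL-Library.Equipollence"
    "HOL-Library.Infinite_Typeclass"
begin

section \<open>Categories, functors and natural transformations\<close>

record ('o, 'm) category_data =
  Obj :: "'o set"
  Arr :: "'m set"
  Dom :: "'m \<Rightarrow> 'o"
  Cod :: "'m \<Rightarrow> 'o"
  Ident :: "'o \<Rightarrow> 'm"
  Comp :: "'m \<Rightarrow> 'm \<Rightarrow> 'm"  (infixl "\<odot>\<index>" 70)  \<comment> \<open>\<open>g \<odot> f\<close> is \<open>g\<close> after \<open>f\<close>\<close>

definition hom :: "('o, 'm, 'z) category_data_scheme \<Rightarrow> 'o \<Rightarrow> 'o \<Rightarrow> 'm set" where
  "hom C x y = {f \<in> Arr C. Dom C f = x \<and> Cod C f = y}"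

locale category =
  fixes C :: "('o, 'm, 'z) category_data_scheme" (structure)
  assumes Dom_Obj: "f \<in> Arr C \<Longrightarrow> Dom C f \<in> Obj C"
    and Cod_Obj: "f \<in> Arr C \<Longrightarrow> Cod C f \<in> Obj C"
    and Ident_hom: "x \<in> Obj C \<Longrightarrow> Ident C x \<in> hom C x x"
    and Comp_hom: "f \<in> hom C x y \<Longrightarrow> g \<in> hom C y z \<Longrightarrow> g \<odot> f \<in> hom C x z"
    and Comp_Ident: "f \<in> hom C x y \<Longrightarrow> f \<odot> Ident C x = f"
    and Ident_Comp: "f \<in> hom C x y \<Longrightarrow> Ident C y \<odot> f = f"
    and Comp_assoc:
      "f \<in> hom C w x \<Longrightarrow> g \<in> hom C x y \<Longrightarrow> h \<in> hom C y z \<Longrightarrow> h \<odot> (g \<odot> f) = (h \<odot> g) \<odot> f"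

definition op_cat :: "('o, 'm, 'z) category_data_scheme \<Rightarrow> ('o, 'm, 'z) category_data_scheme" where
  "op_cat C = C\<lparr>Dom := Cod C, Cod := Dom C, Comp := (\<lambda>g f. Comp C f g)\<rparr>"

definition inverse_arrows :: "('o, 'm, 'z) category_data_scheme \<Rightarrow> 'm \<Rightarrow> 'm \<Rightarrow> bool" where
  "inverse_arrows C f g \<longleftrightarrow>
     f \<in> Arr C \<and> g \<in> hom C (Cod C f) (Dom C f) \<and>
     g \<odot>\<^bsub>C\<^esub> f = Ident C (Dom C f) \<and> f \<odot>\<^bsub>C\<^esub> g = Ident C (Cod C f)"

definition invertible_arrow :: "('o, 'm, 'z) category_data_scheme \<Rightarrow> 'm \<Rightarrow> bool" where
  "invertible_arrow C f \<longleftrightarrow> (\<exists>g. inverse_arrows C f g)"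

definition inverse_arrow :: "('o, 'm, 'z) category_data_scheme \<Rightarrow> 'm \<Rightarrow> 'm" where
  "inverse_arrow C f = (THE g. inverse_arrows C f g)"

definition is_functor ::
  "('o1, 'm1, 'z1) category_data_scheme \<Rightarrow> ('o2, 'm2, 'z2) category_data_scheme \<Rightarrow>
   ('o1 \<Rightarrow> 'o2) \<Rightarrow> ('m1 \<Rightarrow> 'm2) \<Rightarrow> bool" where
  "is_functor C D Fo Fa \<longleftrightarrow>
     category C \<and> category D \<and>
     (\<forall>x \<in> Obj C. Fo x \<in> Obj D) \<and>
     (\<forall>f \<in> Arr C. Fa f \<in> hom D (Fo (Dom C f)) (Fo (Cod C f))) \<and>
     (\<forall>x \<in> Obj C. Fa (Ident C x) = Ident D (Fo x)) \<and>
     (\<forall>f \<in> Arr C. \<forall>g \<in> Arr C. Dom C g = Cod C f \<longrightarrow> Fa (g \<odot>\<^bsub>C\<^esub> f) = Fa g \<odot>\<^bsub>D\<^esub> Fa f)"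

text \<open>That \<open>Fo, Fa\<close> and \<open>Go, Ga\<close> are functors is not part of this predicate; it is always assumed separately.\<close>

definition is_natural ::
  "('o1, 'm1, 'z1) category_data_scheme \<Rightarrow> ('o2, 'm2, 'z2) category_data_scheme \<Rightarrow>
   ('o1 \<Rightarrow> 'o2) \<Rightarrow> ('m1 \<Rightarrow> 'm2) \<Rightarrow> ('o1 \<Rightarrow> 'o2) \<Rightarrow> ('m1 \<Rightarrow> 'm2) \<Rightarrow> ('o1 \<Rightarrow> 'm2) \<Rightarrow> bool" where
  "is_natural C D Fo Fa Go Ga t \<longleftrightarrow>
     (\<forall>x \<in> Obj C. t x \<in> hom D (Fo x) (Go x)) \<and>
     (\<forall>f \<in> Arr C. t (Cod C f) \<odot>\<^bsub>D\<^esub> Fa f = Ga f \<odot>\<^bsub>D\<^esub> t (Dom C f))"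

definition is_adjunction ::
  "('o1, 'm1, 'z1) category_data_scheme \<Rightarrow> ('o2, 'm2, 'z2) category_data_scheme \<Rightarrow>
   ('o1 \<Rightarrow> 'o2) \<Rightarrow> ('m1 \<Rightarrow> 'm2) \<Rightarrow> ('o2 \<Rightarrow> 'o1) \<Rightarrow> ('m2 \<Rightarrow> 'm1) \<Rightarrow>
   ('o1 \<Rightarrow> 'm1) \<Rightarrow> ('o2 \<Rightarrow> 'm2) \<Rightarrow> bool" where
  "is_adjunction C D Fo Fa Go Ga \<eta> \<epsilon> \<longleftrightarrow>
     is_functor C D Fo Fa \<and> is_functor D C Go Ga \<and>
     is_natural C C (\<lambda>x. x) (\<lambda>f. f) (\<lambda>x. Go (Fo x)) (\<lambda>f. Ga (Fa f)) \<eta> \<and>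
     is_natural D D (\<lambda>y. Fo (Go y)) (\<lambda>g. Fa (Ga g)) (\<lambda>y. y) (\<lambda>g. g) \<epsilon> \<and>
     (\<forall>x \<in> Obj C. \<epsilon> (Fo x) \<odot>\<^bsub>D\<^esub> Fa (\<eta> x) = Ident D (Fo x)) \<and>
     (\<forall>y \<in> Obj D. Ga (\<epsilon> y) \<odot>\<^bsub>C\<^esub> \<eta> (Go y) = Ident C (Go y))"

definition is_initial :: "('o, 'm, 'z) category_data_scheme \<Rightarrow> 'o \<Rightarrow> bool" where
  "is_initial C x \<longleftrightarrow> x \<in> Obj C \<and> (\<forall>y \<in> Obj C. \<exists>!f. f \<in> hom C x y)"

definition is_terminal :: "('o, 'm, 'z) category_data_scheme \<Rightarrow> 'o \<Rightarrow> bool" where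
  "is_terminal C x \<longleftrightarrow> x \<in> Obj C \<and> (\<forall>y \<in> Obj C. \<exists>!f. f \<in> hom C y x)"

definition is_cone ::
  "('i, 'j, 'w) category_data_scheme \<Rightarrow> ('o, 'm, 'z) category_data_scheme \<Rightarrow>
   ('i \<Rightarrow> 'o) \<Rightarrow> ('j \<Rightarrow> 'm) \<Rightarrow> 'o \<Rightarrow> ('i \<Rightarrow> 'm) \<Rightarrow> bool" where
  "is_cone I C Do Da x p \<longleftrightarrow>
     x \<in> Obj C \<and> (\<forall>i \<in> Obj I. p i \<in> hom C x (Do i)) \<and>
     (\<forall>u \<in> Arr I. Da u \<odot>\<^bsub>C\<^esub> p (Dom I u) = p (Cod I u))"

definition is_limit ::
  "('i, 'j, 'w) category_data_scheme \<Rightarrow> ('o, 'm, 'z) category_data_scheme \<Rightarrow>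
   ('i \<Rightarrow> 'o) \<Rightarrow> ('j \<Rightarrow> 'm) \<Rightarrow> 'o \<Rightarrow> ('i \<Rightarrow> 'm) \<Rightarrow> bool" where
  "is_limit I C Do Da x p \<longleftrightarrow>
     is_cone I C Do Da x p \<and>
     (\<forall>y q. is_cone I C Do Da y q \<longrightarrow>
        (\<exists>!f. f \<in> hom C y x \<and> (\<forall>i \<in> Obj I. p i \<odot>\<^bsub>C\<^esub> f = q i)))"

text \<open>
  The type \<open>'s\<close> plays the role of the universe that fixes the meaning of ``small'': a category is
  small if it has fewer than \<open>|'s|\<close> arrows. If \<open>|'s|\<close> is an inaccessible cardinal, this is
  smallness with respect to the corresponding Grothendieck universe; for \<open>'s = nat\<close> it is
  finiteness, which gives Quillen's original finite limits and colimits. As \<open>'s\<close> is infinite,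
  finite categories are always small.
\<close>

definition has_small_limits ::
  "'s::infinite itself \<Rightarrow> ('o, 'm, 'z) category_data_scheme \<Rightarrow> bool" where
  "has_small_limits \<kappa> C \<longleftrightarrow>
     (\<forall>(I :: ('s, 's) category_data) Do Da.
        is_functor I C Do Da \<and> Arr I \<prec> (UNIV :: 's set) \<longrightarrow> (\<exists>x p. is_limit I C Do Da x p))"

definition has_small_colimits ::
  "'s::infinite itself \<Rightarrow> ('o, 'm, 'z) category_data_scheme \<Rightarrow> bool" where
  "has_small_colimits \<kappa> C \<longleftrightarrow> has_small_limits \<kappa> (op_cat C)"


section \<open>Double categories\<close>

text \<open>
  \<open>SqV K\<close> is the category of squares under vertical composition: its objects are the horizontal
  1-cells, its domain and codomain maps are the top and bottom boundary, and its identities are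
  the squares $1_f$. \<open>SqH K\<close> is the category of the same squares under horizontal composition:
  its objects are the vertical 1-cells, its domain and codomain maps are the left and right
  boundary, and its identities are the squares $1^u$.
\<close>

record ('o, 'v, 'h, 'q) double_data =
  Ver :: "('o, 'v) category_data"
  Hor :: "('o, 'h) category_data"
  SqV :: "('h, 'q) category_data"
  SqH :: "('v, 'q) category_data"

abbreviation Sq :: "('o, 'v, 'h, 'q) double_data \<Rightarrow> 'q set" where
  "Sq K \<equiv> Arr (SqV K)"

abbreviation Top :: "('o, 'v, 'h, 'q) double_data \<Rightarrow> 'q \<Rightarrow> 'h" where
  "Top K \<equiv> Dom (SqV K)"

abbreviation Bot :: "('o, 'v, 'h, 'q) double_data \<Rightarrow> 'q \<Rightarrow> 'h" where
  "Bot K \<equiv> Cod (SqV K)"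

abbreviation Lft :: "('o, 'v, 'h, 'q) double_data \<Rightarrow> 'q \<Rightarrow> 'v" where
  "Lft K \<equiv> Dom (SqH K)"

abbreviation Rgt :: "('o, 'v, 'h, 'q) double_data \<Rightarrow> 'q \<Rightarrow> 'v" where
  "Rgt K \<equiv> Cod (SqH K)"

text \<open>\<open>vcomp K \<beta> \<alpha>\<close> is $\beta\ast_v\alpha$, with \<open>\<alpha>\<close> on top; \<open>hcomp K \<alpha> \<beta>\<close> is $\alpha\ast_h\beta$, with \<open>\<alpha>\<close> on
  the left.\<close>

abbreviation vcomp :: "('o, 'v, 'h, 'q) double_data \<Rightarrow> 'q \<Rightarrow> 'q \<Rightarrow> 'q" where
  "vcomp K \<beta> \<alpha> \<equiv> Comp (SqV K) \<beta> \<alpha>"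

abbreviation hcomp :: "('o, 'v, 'h, 'q) double_data \<Rightarrow> 'q \<Rightarrow> 'q \<Rightarrow> 'q" where
  "hcomp K \<alpha> \<beta> \<equiv> Comp (SqH K) \<beta> \<alpha>"

text \<open>\<open>vid\<close> and \<open>hid\<close> are $1_a$ and $1^a$; \<open>sqid_v\<close> is $1^u$ for vertical \<open>u\<close>, and \<open>sqid_h\<close> is $1_f$ for
  horizontal \<open>f\<close>.\<close>

abbreviation vid :: "('o, 'v, 'h, 'q) double_data \<Rightarrow> 'o \<Rightarrow> 'v" where
  "vid K \<equiv> Ident (Ver K)"

abbreviation hid :: "('o, 'v, 'h, 'q) double_data \<Rightarrow> 'o \<Rightarrow> 'h" where
  "hid K \<equiv> Ident (Hor K)"

abbreviation sqid_v :: "('o, 'v, 'h, 'q) double_data \<Rightarrow> 'v \<Rightarrow> 'q" where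
  "sqid_v K \<equiv> Ident (SqH K)"

abbreviation sqid_h :: "('o, 'v, 'h, 'q) double_data \<Rightarrow> 'h \<Rightarrow> 'q" where
  "sqid_h K \<equiv> Ident (SqV K)"

locale double_category =
  fixes K :: "('o, 'v, 'h, 'q) double_data"
  assumes category_Ver: "category (Ver K)"
    and category_Hor: "category (Hor K)"
    and category_SqV: "category (SqV K)"
    and category_SqH: "category (SqH K)"
    and Obj_Hor: "Obj (Hor K) = Obj (Ver K)"
    and Obj_SqV: "Obj (SqV K) = Arr (Hor K)"
    and Obj_SqH: "Obj (SqH K) = Arr (Ver K)"
    and Arr_SqH: "Arr (SqH K) = Arr (SqV K)"
    and corner_top_left: "\<alpha> \<in> Sq K \<Longrightarrow> Dom (Ver K) (Lft K \<alpha>) = Dom (Hor K) (Top K \<alpha>)"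
    and corner_bot_left: "\<alpha> \<in> Sq K \<Longrightarrow> Cod (Ver K) (Lft K \<alpha>) = Dom (Hor K) (Bot K \<alpha>)"
    and corner_top_right: "\<alpha> \<in> Sq K \<Longrightarrow> Dom (Ver K) (Rgt K \<alpha>) = Cod (Hor K) (Top K \<alpha>)"
    and corner_bot_right: "\<alpha> \<in> Sq K \<Longrightarrow> Cod (Ver K) (Rgt K \<alpha>) = Cod (Hor K) (Bot K \<alpha>)"
    and Lft_vcomp: "\<alpha> \<in> Sq K \<Longrightarrow> \<beta> \<in> Sq K \<Longrightarrow> Top K \<beta> = Bot K \<alpha> \<Longrightarrow>
        Lft K (vcomp K \<beta> \<alpha>) = Lft K \<beta> \<odot>\<^bsub>Ver K\<^esub> Lft K \<alpha>"
    and Rgt_vcomp: "\<alpha> \<in> Sq K \<Longrightarrow> \<beta> \<in> Sq K \<Longrightarrow> Top K \<beta> = Bot K \<alpha> \<Longrightarrow>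
        Rgt K (vcomp K \<beta> \<alpha>) = Rgt K \<beta> \<odot>\<^bsub>Ver K\<^esub> Rgt K \<alpha>"
    and Top_hcomp: "\<alpha> \<in> Sq K \<Longrightarrow> \<beta> \<in> Sq K \<Longrightarrow> Lft K \<beta> = Rgt K \<alpha> \<Longrightarrow>
        Top K (hcomp K \<alpha> \<beta>) = Top K \<beta> \<odot>\<^bsub>Hor K\<^esub> Top K \<alpha>"
    and Bot_hcomp: "\<alpha> \<in> Sq K \<Longrightarrow> \<beta> \<in> Sq K \<Longrightarrow> Lft K \<beta> = Rgt K \<alpha> \<Longrightarrow>
        Bot K (hcomp K \<alpha> \<beta>) = Bot K \<beta> \<odot>\<^bsub>Hor K\<^esub> Bot K \<alpha>"
    and Top_sqid_v: "u \<in> Arr (Ver K) \<Longrightarrow> Top K (sqid_v K u) = hid K (Dom (Ver K) u)"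
    and Bot_sqid_v: "u \<in> Arr (Ver K) \<Longrightarrow> Bot K (sqid_v K u) = hid K (Cod (Ver K) u)"
    and Lft_sqid_h: "f \<in> Arr (Hor K) \<Longrightarrow> Lft K (sqid_h K f) = vid K (Dom (Hor K) f)"
    and Rgt_sqid_h: "f \<in> Arr (Hor K) \<Longrightarrow> Rgt K (sqid_h K f) = vid K (Cod (Hor K) f)"
    and sqid_vid_hid: "a \<in> Obj (Ver K) \<Longrightarrow> sqid_v K (vid K a) = sqid_h K (hid K a)"
    and vcomp_sqid_v: "u \<in> hom (Ver K) a b \<Longrightarrow> v \<in> hom (Ver K) b c \<Longrightarrow>
        vcomp K (sqid_v K v) (sqid_v K u) = sqid_v K (v \<odot>\<^bsub>Ver K\<^esub> u)"
    and hcomp_sqid_h: "f \<in> hom (Hor K) a b \<Longrightarrow> g \<in> hom (Hor K) b c \<Longrightarrow>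
        hcomp K (sqid_h K f) (sqid_h K g) = sqid_h K (g \<odot>\<^bsub>Hor K\<^esub> f)"
    and interchange: "\<alpha> \<in> Sq K \<Longrightarrow> \<beta> \<in> Sq K \<Longrightarrow> \<gamma> \<in> Sq K \<Longrightarrow> \<delta> \<in> Sq K \<Longrightarrow>
        Lft K \<beta> = Rgt K \<alpha> \<Longrightarrow> Lft K \<delta> = Rgt K \<gamma> \<Longrightarrow> Top K \<gamma> = Bot K \<alpha> \<Longrightarrow> Top K \<delta> = Bot K \<beta> \<Longrightarrow>
        vcomp K (hcomp K \<gamma> \<delta>) (hcomp K \<alpha> \<beta>) = hcomp K (vcomp K \<gamma> \<alpha>) (vcomp K \<delta> \<beta>)"


section \<open>Double pseudofunctors\<close>

text \<open>For a double pseudofunctor \<open>F\<close>, \<open>UnitH F a\<close> is $F_a$, \<open>UnitV F a\<close> is $F^a$, \<open>CompV F g f\<close> is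
  $F^{gf}$ and \<open>CompH F k h\<close> is $F_{kh}$.\<close>

record ('o1, 'v1, 'h1, 'q1, 'o2, 'v2, 'h2, 'q2) double_functor_data =
  MapO :: "'o1 \<Rightarrow> 'o2"
  MapV :: "'v1 \<Rightarrow> 'v2"
  MapH :: "'h1 \<Rightarrow> 'h2"
  MapS :: "'q1 \<Rightarrow> 'q2"
  UnitH :: "'o1 \<Rightarrow> 'q2"
  UnitV :: "'o1 \<Rightarrow> 'q2"
  CompV :: "'v1 \<Rightarrow> 'v1 \<Rightarrow> 'q2"
  CompH :: "'h1 \<Rightarrow> 'h1 \<Rightarrow> 'q2"

definition has_boundary ::
  "('o, 'v, 'h, 'q) double_data \<Rightarrow> 'q \<Rightarrow> 'h \<Rightarrow> 'v \<Rightarrow> 'v \<Rightarrow> 'h \<Rightarrow> bool" where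
  "has_boundary K \<alpha> t l r b \<longleftrightarrow>
     \<alpha> \<in> Sq K \<and> Top K \<alpha> = t \<and> Lft K \<alpha> = l \<and> Rgt K \<alpha> = r \<and> Bot K \<alpha> = b"

locale double_pseudofunctor =
  K: double_category K + L: double_category L
  for K :: "('o1, 'v1, 'h1, 'q1) double_data"
    and L :: "('o2, 'v2, 'h2, 'q2) double_data" +
  fixes F :: "('o1, 'v1, 'h1, 'q1, 'o2, 'v2, 'h2, 'q2) double_functor_data"
  assumes MapO_Obj: "a \<in> Obj (Ver K) \<Longrightarrow> MapO F a \<in> Obj (Ver L)"
    and MapV_hom: "u \<in> hom (Ver K) a b \<Longrightarrow> MapV F u \<in> hom (Ver L) (MapO F a) (MapO F b)"
    and MapH_hom: "f \<in> hom (Hor K) a b \<Longrightarrow> MapH F f \<in> hom (Hor L) (MapO F a) (MapO F b)"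
    and MapS_boundary: "has_boundary K \<alpha> f u v g \<Longrightarrow>
        has_boundary L (MapS F \<alpha>) (MapH F f) (MapV F u) (MapV F v) (MapH F g)"
    and UnitH_boundary: "a \<in> Obj (Ver K) \<Longrightarrow>
        has_boundary L (UnitH F a) (MapH F (hid K a)) (vid L (MapO F a)) (vid L (MapO F a))
          (hid L (MapO F a))"
    and UnitH_invertible: "a \<in> Obj (Ver K) \<Longrightarrow> invertible_arrow (SqV L) (UnitH F a)"
    and UnitV_boundary: "a \<in> Obj (Ver K) \<Longrightarrow>
        has_boundary L (UnitV F a) (hid L (MapO F a)) (vid L (MapO F a)) (MapV F (vid K a))
          (hid L (MapO F a))"
    and UnitV_invertible: "a \<in> Obj (Ver K) \<Longrightarrow> invertible_arrow (SqH L) (UnitV F a)"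
    and CompV_boundary: "u \<in> hom (Ver K) a b \<Longrightarrow> v \<in> hom (Ver K) b c \<Longrightarrow>
        has_boundary L (CompV F v u) (hid L (MapO F a)) (MapV F v \<odot>\<^bsub>Ver L\<^esub> MapV F u)
          (MapV F (v \<odot>\<^bsub>Ver K\<^esub> u)) (hid L (MapO F c))"
    and CompV_invertible: "u \<in> hom (Ver K) a b \<Longrightarrow> v \<in> hom (Ver K) b c \<Longrightarrow>
        invertible_arrow (SqH L) (CompV F v u)"
    and CompH_boundary: "h \<in> hom (Hor K) a b \<Longrightarrow> k \<in> hom (Hor K) b c \<Longrightarrow>
        has_boundary L (CompH F k h) (MapH F (k \<odot>\<^bsub>Hor K\<^esub> h)) (vid L (MapO F a)) (vid L (MapO F c))
          (MapH F k \<odot>\<^bsub>Hor L\<^esub> MapH F h)"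
    and CompH_invertible: "h \<in> hom (Hor K) a b \<Longrightarrow> k \<in> hom (Hor K) b c \<Longrightarrow>
        invertible_arrow (SqV L) (CompH F k h)"
    and vertical_assoc: "u \<in> hom (Ver K) a b \<Longrightarrow> v \<in> hom (Ver K) b c \<Longrightarrow> w \<in> hom (Ver K) c d \<Longrightarrow>
        hcomp L (vcomp L (sqid_v L (MapV F w)) (CompV F v u)) (CompV F w (v \<odot>\<^bsub>Ver K\<^esub> u)) =
        hcomp L (vcomp L (CompV F w v) (sqid_v L (MapV F u))) (CompV F (w \<odot>\<^bsub>Ver K\<^esub> v) u)"
    and vertical_unit_left: "u \<in> hom (Ver K) a b \<Longrightarrow>
        hcomp L (vcomp L (UnitV F b) (sqid_v L (MapV F u))) (CompV F (vid K b) u) =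
        sqid_v L (MapV F u)"
    and vertical_unit_right: "u \<in> hom (Ver K) a b \<Longrightarrow>
        hcomp L (vcomp L (sqid_v L (MapV F u)) (UnitV F a)) (CompV F u (vid K a)) =
        sqid_v L (MapV F u)"
    and horizontal_assoc: "f \<in> hom (Hor K) a b \<Longrightarrow> g \<in> hom (Hor K) b c \<Longrightarrow> h \<in> hom (Hor K) c d \<Longrightarrow>
        vcomp L (hcomp L (CompH F g f) (sqid_h L (MapH F h))) (CompH F h (g \<odot>\<^bsub>Hor K\<^esub> f)) =
        vcomp L (hcomp L (sqid_h L (MapH F f)) (CompH F h g)) (CompH F (h \<odot>\<^bsub>Hor K\<^esub> g) f)"
    and horizontal_unit_right: "f \<in> hom (Hor K) a b \<Longrightarrow>
        vcomp L (hcomp L (UnitH F a) (sqid_h L (MapH F f))) (CompH F f (hid K a)) =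
        sqid_h L (MapH F f)"
    and horizontal_unit_left: "f \<in> hom (Hor K) a b \<Longrightarrow>
        vcomp L (hcomp L (sqid_h L (MapH F f)) (UnitH F b)) (CompH F (hid K b) f) =
        sqid_h L (MapH F f)"
    and naturality_hcomp: "\<alpha> \<in> Sq K \<Longrightarrow> \<beta> \<in> Sq K \<Longrightarrow> Lft K \<beta> = Rgt K \<alpha> \<Longrightarrow>
        vcomp L (hcomp L (MapS F \<alpha>) (MapS F \<beta>)) (CompH F (Top K \<beta>) (Top K \<alpha>)) =
        vcomp L (CompH F (Bot K \<beta>) (Bot K \<alpha>)) (MapS F (hcomp K \<alpha> \<beta>))"
    and naturality_sqid_v: "u \<in> hom (Ver K) a b \<Longrightarrow>
        vcomp L (UnitH F b) (vcomp L (MapS F (sqid_v K u)) (inverse_arrow (SqV L) (UnitH F a))) =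
        sqid_v L (MapV F u)"
    and naturality_vcomp: "\<alpha> \<in> Sq K \<Longrightarrow> \<beta> \<in> Sq K \<Longrightarrow> Top K \<beta> = Bot K \<alpha> \<Longrightarrow>
        hcomp L (CompV F (Lft K \<beta>) (Lft K \<alpha>)) (MapS F (vcomp K \<beta> \<alpha>)) =
        hcomp L (vcomp L (MapS F \<beta>) (MapS F \<alpha>)) (CompV F (Rgt K \<beta>) (Rgt K \<alpha>))"
    and naturality_sqid_h: "f \<in> hom (Hor K) a b \<Longrightarrow>
        hcomp L (hcomp L (UnitV F a) (MapS F (sqid_h K f))) (inverse_arrow (SqH L) (UnitV F b)) =
        sqid_h L (MapH F f)"


section \<open>Double categories of categories, functors and natural transformations\<close>

text \<open>
  Functors as 1-cells. The maps are required to be \<open>undefined\<close> off the source, so that equality of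
  functors is equality of records and composition is strictly unital.
\<close>

record ('o, 'm, 'z) functor_data =
  Src :: "('o, 'm, 'z) category_data_scheme"
  Tgt :: "('o, 'm, 'z) category_data_scheme"
  FO :: "'o \<Rightarrow> 'o"
  FA :: "'m \<Rightarrow> 'm"

definition is_functor_cell :: "('o, 'm, 'z) functor_data \<Rightarrow> bool" where
  "is_functor_cell F \<longleftrightarrow>
     is_functor (Src F) (Tgt F) (FO F) (FA F) \<and>
     FO F \<in> extensional (Obj (Src F)) \<and> FA F \<in> extensional (Arr (Src F))"

definition id_functor :: "('o, 'm, 'z) category_data_scheme \<Rightarrow> ('o, 'm, 'z) functor_data" where
  "id_functor C = \<lparr>Src = C, Tgt = C, FO = (\<lambda>x\<in>Obj C. x), FA = (\<lambda>f\<in>Arr C. f)\<rparr>"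

definition comp_functor ::
  "('o, 'm, 'z) functor_data \<Rightarrow> ('o, 'm, 'z) functor_data \<Rightarrow> ('o, 'm, 'z) functor_data" where
  "comp_functor G F =
     \<lparr>Src = Src F, Tgt = Tgt G,
      FO = (\<lambda>x\<in>Obj (Src F). FO G (FO F x)), FA = (\<lambda>f\<in>Arr (Src F). FA G (FA F f))\<rparr>"

record ('o, 'm, 'z) square_data =
  STop :: "('o, 'm, 'z) functor_data"
  SLft :: "('o, 'm, 'z) functor_data"
  SRgt :: "('o, 'm, 'z) functor_data"
  SBot :: "('o, 'm, 'z) functor_data"
  Tr :: "'o \<Rightarrow> 'm"

text \<open>A square with top \<open>f\<close>, left \<open>h\<close>, right \<open>k\<close> and bottom \<open>g\<close> is a natural transformation
  $kf\to gh$.\<close>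

definition is_functor_square :: "('o, 'm, 'z) square_data \<Rightarrow> bool" where
  "is_functor_square \<alpha> \<longleftrightarrow>
     Src (SLft \<alpha>) = Src (STop \<alpha>) \<and> Src (SRgt \<alpha>) = Tgt (STop \<alpha>) \<and>
     Src (SBot \<alpha>) = Tgt (SLft \<alpha>) \<and> Tgt (SBot \<alpha>) = Tgt (SRgt \<alpha>) \<and>
     is_natural (Src (STop \<alpha>)) (Tgt (SBot \<alpha>))
       (\<lambda>x. FO (SRgt \<alpha>) (FO (STop \<alpha>) x)) (\<lambda>u. FA (SRgt \<alpha>) (FA (STop \<alpha>) u))
       (\<lambda>x. FO (SBot \<alpha>) (FO (SLft \<alpha>) x)) (\<lambda>u. FA (SBot \<alpha>) (FA (SLft \<alpha>) u))
       (Tr \<alpha>) \<and>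
     Tr \<alpha> \<in> extensional (Obj (Src (STop \<alpha>)))"

definition square_vcomp ::
  "('o, 'm, 'z) square_data \<Rightarrow> ('o, 'm, 'z) square_data \<Rightarrow> ('o, 'm, 'z) square_data" where
  "square_vcomp \<beta> \<alpha> =
     \<lparr>STop = STop \<alpha>, SLft = comp_functor (SLft \<beta>) (SLft \<alpha>),
      SRgt = comp_functor (SRgt \<beta>) (SRgt \<alpha>), SBot = SBot \<beta>,
      Tr = (\<lambda>x\<in>Obj (Src (STop \<alpha>)).
        Tr \<beta> (FO (SLft \<alpha>) x) \<odot>\<^bsub>Tgt (SBot \<beta>)\<^esub> FA (SRgt \<beta>) (Tr \<alpha> x))\<rparr>"

definition square_hcomp ::
  "('o, 'm, 'z) square_data \<Rightarrow> ('o, 'm, 'z) square_data \<Rightarrow> ('o, 'm, 'z) square_data" where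
  "square_hcomp \<alpha> \<beta> =
     \<lparr>STop = comp_functor (STop \<beta>) (STop \<alpha>), SLft = SLft \<alpha>,
      SRgt = SRgt \<beta>, SBot = comp_functor (SBot \<beta>) (SBot \<alpha>),
      Tr = (\<lambda>x\<in>Obj (Src (STop \<alpha>)).
        FA (SBot \<beta>) (Tr \<alpha> x) \<odot>\<^bsub>Tgt (SBot \<beta>)\<^esub> Tr \<beta> (FO (STop \<alpha>) x))\<rparr>"

definition square_id_v :: "('o, 'm, 'z) functor_data \<Rightarrow> ('o, 'm, 'z) square_data" where
  "square_id_v u =
     \<lparr>STop = id_functor (Src u), SLft = u, SRgt = u, SBot = id_functor (Tgt u),
      Tr = (\<lambda>x\<in>Obj (Src u). Ident (Tgt u) (FO u x))\<rparr>"

definition square_id_h :: "('o, 'm, 'z) functor_data \<Rightarrow> ('o, 'm, 'z) square_data" where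
  "square_id_h f =
     \<lparr>STop = f, SLft = id_functor (Src f), SRgt = id_functor (Tgt f), SBot = f,
      Tr = (\<lambda>x\<in>Obj (Src f). Ident (Tgt f) (FO f x))\<rparr>"

text \<open>The double category with objects \<open>\<O>\<close>, vertical 1-cells \<open>\<V>\<close>, horizontal 1-cells \<open>\<H>\<close> and all
  natural transformations of the appropriate shape as squares.\<close>

definition functor_squares ::
  "('o, 'm, 'z) category_data_scheme set \<Rightarrow> ('o, 'm, 'z) functor_data set \<Rightarrow>
   ('o, 'm, 'z) functor_data set \<Rightarrow>
   (('o, 'm, 'z) category_data_scheme, ('o, 'm, 'z) functor_data, ('o, 'm, 'z) functor_data,
    ('o, 'm, 'z) square_data) double_data" where
  "functor_squares \<O> \<V> \<H> =
     (let S = {\<alpha>. STop \<alpha> \<in> \<H> \<and> SBot \<alpha> \<in> \<H> \<and> SLft \<alpha> \<in> \<V> \<and> SRgt \<alpha> \<in> \<V> \<and> is_functor_square \<alpha>} in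
      \<lparr>Ver = \<lparr>Obj = \<O>, Arr = \<V>, Dom = Src, Cod = Tgt, Ident = id_functor, Comp = comp_functor\<rparr>,
       Hor = \<lparr>Obj = \<O>, Arr = \<H>, Dom = Src, Cod = Tgt, Ident = id_functor, Comp = comp_functor\<rparr>,
       SqV = \<lparr>Obj = \<H>, Arr = S, Dom = STop, Cod = SBot, Ident = square_id_h, Comp = square_vcomp\<rparr>,
       SqH = \<lparr>Obj = \<V>, Arr = S, Dom = SLft, Cod = SRgt, Ident = square_id_v,
              Comp = (\<lambda>\<beta> \<alpha>. square_hcomp \<alpha> \<beta>)\<rparr>\<rparr>)"

type_synonym ('o, 'm) cat_double =
  "(('o, 'm) category_data, ('o, 'm, unit) functor_data, ('o, 'm, unit) functor_data,
    ('o, 'm, unit) square_data) double_data"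

definition Cat :: "('o, 'm) cat_double" where
  "Cat = functor_squares {C. category C} {F. is_functor_cell F} {F. is_functor_cell F}"


section \<open>Model categories\<close>

text \<open>
  A functorial factorization assigns to each arrow \<open>f\<close> a factorization \<open>FacR f \<odot> FacL f = f\<close>, and
  to each commutative square \<open>(u, v)\<close> from \<open>f\<close> to \<open>g\<close>, i.e. \<open>v \<odot> f = g \<odot> u\<close>, an arrow
  \<open>FacM f g u v\<close> between the intermediate objects.
\<close>

record 'm factorization =
  FacL :: "'m \<Rightarrow> 'm"
  FacR :: "'m \<Rightarrow> 'm"
  FacM :: "'m \<Rightarrow> 'm \<Rightarrow> 'm \<Rightarrow> 'm \<Rightarrow> 'm"

definition arrow_square :: "('o, 'm, 'z) category_data_scheme \<Rightarrow> 'm \<Rightarrow> 'm \<Rightarrow> 'm \<Rightarrow> 'm \<Rightarrow> bool" where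
  "arrow_square C f g u v \<longleftrightarrow>
     f \<in> Arr C \<and> g \<in> Arr C \<and> u \<in> hom C (Dom C f) (Dom C g) \<and> v \<in> hom C (Cod C f) (Cod C g) \<and>
     v \<odot>\<^bsub>C\<^esub> f = g \<odot>\<^bsub>C\<^esub> u"

definition functorial_factorization ::
  "('o, 'm, 'z) category_data_scheme \<Rightarrow> 'm set \<Rightarrow> 'm set \<Rightarrow> 'm factorization \<Rightarrow> bool" where
  "functorial_factorization C Ls Rs E \<longleftrightarrow>
     (\<forall>f \<in> Arr C.
        FacL E f \<in> Ls \<and> FacR E f \<in> Rs \<and>
        Dom C (FacL E f) = Dom C f \<and> Cod C (FacR E f) = Cod C f \<and>
        Dom C (FacR E f) = Cod C (FacL E f) \<and> FacR E f \<odot>\<^bsub>C\<^esub> FacL E f = f) \<and>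
     (\<forall>f g u v. arrow_square C f g u v \<longrightarrow>
        arrow_square C (FacL E f) (FacL E g) u (FacM E f g u v) \<and>
        arrow_square C (FacR E f) (FacR E g) (FacM E f g u v) v) \<and>
     (\<forall>f \<in> Arr C.
        FacM E f f (Ident C (Dom C f)) (Ident C (Cod C f)) = Ident C (Cod C (FacL E f))) \<and>
     (\<forall>f g h u v u' v'. arrow_square C f g u v \<and> arrow_square C g h u' v' \<longrightarrow>
        FacM E f h (u' \<odot>\<^bsub>C\<^esub> u) (v' \<odot>\<^bsub>C\<^esub> v) = FacM E g h u' v' \<odot>\<^bsub>C\<^esub> FacM E f g u v)"

text \<open>\<open>CofFact\<close> factors into a cofibration followed by an acyclic fibration, \<open>FibFact\<close> into an acyclic
  cofibration followed by a fibration.\<close>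

record ('o, 'm) model_data = "('o, 'm) category_data" +
  Weq :: "'m set"
  Cof :: "'m set"
  Fib :: "'m set"
  CofFact :: "'m factorization"
  FibFact :: "'m factorization"

definition is_retract :: "('o, 'm, 'z) category_data_scheme \<Rightarrow> 'm \<Rightarrow> 'm \<Rightarrow> bool" where
  "is_retract C f g \<longleftrightarrow>
     (\<exists>i j r s. arrow_square C f g i j \<and> arrow_square C g f r s \<and>
        r \<odot>\<^bsub>C\<^esub> i = Ident C (Dom C f) \<and> s \<odot>\<^bsub>C\<^esub> j = Ident C (Cod C f))"

definition has_lifting :: "('o, 'm, 'z) category_data_scheme \<Rightarrow> 'm \<Rightarrow> 'm \<Rightarrow> bool" where
  "has_lifting C i p \<longleftrightarrow>
     (\<forall>u v. arrow_square C i p u v \<longrightarrow>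
        (\<exists>l \<in> hom C (Cod C i) (Dom C p). l \<odot>\<^bsub>C\<^esub> i = u \<and> p \<odot>\<^bsub>C\<^esub> l = v))"

locale model_category = category M
  for \<kappa> :: "'s::infinite itself" and M :: "('o, 'm) model_data" (structure) +
  assumes limits: "has_small_limits \<kappa> M"
    and colimits: "has_small_colimits \<kappa> M"
    and Weq_Arr: "Weq M \<subseteq> Arr M"
    and Cof_Arr: "Cof M \<subseteq> Arr M"
    and Fib_Arr: "Fib M \<subseteq> Arr M"
    and two_of_three:
      "f \<in> hom M x y \<Longrightarrow> g \<in> hom M y z \<Longrightarrow> f \<in> Weq M \<Longrightarrow> g \<in> Weq M \<Longrightarrow> g \<odot> f \<in> Weq M"
      "f \<in> hom M x y \<Longrightarrow> g \<in> hom M y z \<Longrightarrow> f \<in> Weq M \<Longrightarrow> g \<odot> f \<in> Weq M \<Longrightarrow> g \<in> Weq M"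
      "f \<in> hom M x y \<Longrightarrow> g \<in> hom M y z \<Longrightarrow> g \<in> Weq M \<Longrightarrow> g \<odot> f \<in> Weq M \<Longrightarrow> f \<in> Weq M"
    and Weq_retract: "is_retract M f g \<Longrightarrow> g \<in> Weq M \<Longrightarrow> f \<in> Weq M"
    and Cof_retract: "is_retract M f g \<Longrightarrow> g \<in> Cof M \<Longrightarrow> f \<in> Cof M"
    and Fib_retract: "is_retract M f g \<Longrightarrow> g \<in> Fib M \<Longrightarrow> f \<in> Fib M"
    and lifting: "i \<in> Cof M \<Longrightarrow> p \<in> Fib M \<Longrightarrow> i \<in> Weq M \<or> p \<in> Weq M \<Longrightarrow> has_lifting M i p"
    and CofFact: "functorial_factorization M (Cof M) (Fib M \<inter> Weq M) (CofFact M)"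
    and FibFact: "functorial_factorization M (Cof M \<inter> Weq M) (Fib M) (FibFact M)"

type_synonym ('o, 'm) model_functor = "('o, 'm, ('m, unit) model_data_ext) functor_data"

definition left_quillen :: "('o, 'm) model_functor \<Rightarrow> bool" where
  "left_quillen F \<longleftrightarrow>
     is_functor_cell F \<and>
     (\<exists>Go Ga \<eta> \<epsilon>. is_adjunction (Src F) (Tgt F) (FO F) (FA F) Go Ga \<eta> \<epsilon>) \<and>
     FA F ` Cof (Src F) \<subseteq> Cof (Tgt F) \<and>
     FA F ` (Cof (Src F) \<inter> Weq (Src F)) \<subseteq> Cof (Tgt F) \<inter> Weq (Tgt F)"

definition right_quillen :: "('o, 'm) model_functor \<Rightarrow> bool" where
  "right_quillen G \<longleftrightarrow>
     is_functor_cell G \<and>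
     (\<exists>Fo Fa \<eta> \<epsilon>. is_adjunction (Tgt G) (Src G) Fo Fa (FO G) (FA G) \<eta> \<epsilon>) \<and>
     FA G ` Fib (Src G) \<subseteq> Fib (Tgt G) \<and>
     FA G ` (Fib (Src G) \<inter> Weq (Src G)) \<subseteq> Fib (Tgt G) \<inter> Weq (Tgt G)"

type_synonym ('o, 'm) model_double =
  "(('o, 'm) model_data, ('o, 'm) model_functor, ('o, 'm) model_functor,
    ('o, 'm, ('m, unit) model_data_ext) square_data) double_data"

definition Model :: "'s::infinite itself \<Rightarrow> ('o, 'm) model_double" where
  "Model \<kappa> = functor_squares {M. model_category \<kappa> M}
     {F. left_quillen F \<and> model_category \<kappa> (Src F) \<and> model_category \<kappa> (Tgt F)}
     {F. right_quillen F \<and> model_category \<kappa> (Src F) \<and> model_category \<kappa> (Tgt F)}"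


section \<open>Cofibrant and fibrant replacement\<close>

text \<open>The initial and terminal objects entering \<open>Q\<close> and \<open>R\<close> are fixed by an arbitrary choice.\<close>

definition initial_object :: "('o, 'm, 'z) category_data_scheme \<Rightarrow> 'o" where
  "initial_object C = (SOME x. is_initial C x)"

definition terminal_object :: "('o, 'm, 'z) category_data_scheme \<Rightarrow> 'o" where
  "terminal_object C = (SOME x. is_terminal C x)"

definition from_initial :: "('o, 'm, 'z) category_data_scheme \<Rightarrow> 'o \<Rightarrow> 'm" where
  "from_initial C x = (THE f. f \<in> hom C (initial_object C) x)"

definition to_terminal :: "('o, 'm, 'z) category_data_scheme \<Rightarrow> 'o \<Rightarrow> 'm" where
  "to_terminal C x = (THE f. f \<in> hom C x (terminal_object C))"

text \<open>\<open>QO\<close> and \<open>QA\<close> are the object and arrow maps of the functor \<open>Q\<close>, \<open>RO\<close> and \<open>RA\<close> those of \<open>R\<close>;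
  \<open>qmap\<close> is $\pi\colon Q\to\mathrm{Id}$ and \<open>rmap\<close> is $\rho\colon\mathrm{Id}\to R$.\<close>

definition QO :: "('o, 'm) model_data \<Rightarrow> 'o \<Rightarrow> 'o" where
  "QO M x = Cod M (FacL (CofFact M) (from_initial M x))"

definition QA :: "('o, 'm) model_data \<Rightarrow> 'm \<Rightarrow> 'm" where
  "QA M f = FacM (CofFact M) (from_initial M (Dom M f)) (from_initial M (Cod M f))
     (Ident M (initial_object M)) f"

definition qmap :: "('o, 'm) model_data \<Rightarrow> 'o \<Rightarrow> 'm" where
  "qmap M x = FacR (CofFact M) (from_initial M x)"

definition RO :: "('o, 'm) model_data \<Rightarrow> 'o \<Rightarrow> 'o" where
  "RO M x = Cod M (FacL (FibFact M) (to_terminal M x))"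

definition RA :: "('o, 'm) model_data \<Rightarrow> 'm \<Rightarrow> 'm" where
  "RA M f = FacM (FibFact M) (to_terminal M (Dom M f)) (to_terminal M (Cod M f))
     f (Ident M (terminal_object M))"

definition rmap :: "('o, 'm) model_data \<Rightarrow> 'o \<Rightarrow> 'm" where
  "rmap M x = FacL (FibFact M) (to_terminal M x)"


section \<open>Homotopy categories and derived functors\<close>

text \<open>
  The localization of \<open>C\<close> at \<open>W\<close>: same objects; arrows are equivalence classes of zigzags, i.e. paths
  of forward arrows of \<open>C\<close> and backward arrows of \<open>W\<close>. Zigzags are written in diagrammatic order.
\<close>

datatype 'm zig = Fwd 'm | Bwd 'm

inductive zigzag :: "('o, 'm, 'z) category_data_scheme \<Rightarrow> 'm set \<Rightarrow> 'o \<Rightarrow> 'm zig list \<Rightarrow> 'o \<Rightarrow> bool"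
  for C :: "('o, 'm, 'z) category_data_scheme" and W :: "'m set" where
  nil: "x \<in> Obj C \<Longrightarrow> zigzag C W x [] x"
| fwd: "f \<in> hom C x y \<Longrightarrow> zigzag C W y p z \<Longrightarrow> zigzag C W x (Fwd f # p) z"
| bwd: "w \<in> W \<Longrightarrow> w \<in> hom C y x \<Longrightarrow> zigzag C W y p z \<Longrightarrow> zigzag C W x (Bwd w # p) z"

inductive zigzag_eq ::
  "('o, 'm, 'z) category_data_scheme \<Rightarrow> 'm set \<Rightarrow> 'o \<Rightarrow> 'm zig list \<Rightarrow> 'm zig list \<Rightarrow> 'o \<Rightarrow> bool"
  for C :: "('o, 'm, 'z) category_data_scheme" and W :: "'m set" where
  refl: "zigzag C W x p y \<Longrightarrow> zigzag_eq C W x p p y"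
| sym: "zigzag_eq C W x p q y \<Longrightarrow> zigzag_eq C W x q p y"
| trans: "zigzag_eq C W x p q y \<Longrightarrow> zigzag_eq C W x q r y \<Longrightarrow> zigzag_eq C W x p r y"
| append: "zigzag_eq C W x p p' y \<Longrightarrow> zigzag_eq C W y q q' z \<Longrightarrow> zigzag_eq C W x (p @ q) (p' @ q') z"
| ident: "x \<in> Obj C \<Longrightarrow> zigzag_eq C W x [Fwd (Ident C x)] [] x"
| comp: "f \<in> hom C x y \<Longrightarrow> g \<in> hom C y z \<Longrightarrow>
    zigzag_eq C W x [Fwd f, Fwd g] [Fwd (g \<odot>\<^bsub>C\<^esub> f)] z"
| fwd_bwd: "w \<in> W \<Longrightarrow> w \<in> hom C x y \<Longrightarrow> zigzag_eq C W x [Fwd w, Bwd w] [] x"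
| bwd_fwd: "w \<in> W \<Longrightarrow> w \<in> hom C x y \<Longrightarrow> zigzag_eq C W y [Bwd w, Fwd w] [] y"

type_synonym ('o, 'm) loc_arrow = "('o \<times> 'm zig list \<times> 'o) set"

text \<open>This set is empty unless \<open>p\<close> is a zigzag from \<open>x\<close> to \<open>y\<close>.\<close>

definition loc_class ::
  "('o, 'm, 'z) category_data_scheme \<Rightarrow> 'm set \<Rightarrow> 'o \<Rightarrow> 'm zig list \<Rightarrow> 'o \<Rightarrow> ('o, 'm) loc_arrow" where
  "loc_class C W x p y = {(x, q, y) | q. zigzag_eq C W x p q y}"

definition localization ::
  "('o, 'm, 'z) category_data_scheme \<Rightarrow> 'm set \<Rightarrow> ('o, ('o, 'm) loc_arrow) category_data" where
  "localization C W =
     \<lparr>Obj = Obj C,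
      Arr = {loc_class C W x p y | x p y. zigzag C W x p y},
      Dom = (\<lambda>X. THE x. \<exists>p y. (x, p, y) \<in> X),
      Cod = (\<lambda>X. THE y. \<exists>x p. (x, p, y) \<in> X),
      Ident = (\<lambda>x. loc_class C W x [] x),
      Comp = (\<lambda>Y X. \<Union>{loc_class C W x (p @ q) z | x p y q z. (x, p, y) \<in> X \<and> (y, q, z) \<in> Y})\<rparr>"

definition HoCat :: "('o, 'm) model_data \<Rightarrow> ('o, ('o, 'm) loc_arrow) category_data" where
  "HoCat M = localization M (Weq M)"

definition HoClass ::
  "('o, 'm) model_data \<Rightarrow> 'o \<Rightarrow> 'm zig list \<Rightarrow> 'o \<Rightarrow> ('o, 'm) loc_arrow" where
  "HoClass M x p y = loc_class M (Weq M) x p y"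

text \<open>The functor of homotopy categories induced by a functor that preserves weak equivalences.\<close>

definition HoInduced ::
  "('o, 'm) model_data \<Rightarrow> ('o, 'm) model_data \<Rightarrow> ('o \<Rightarrow> 'o) \<Rightarrow> ('m \<Rightarrow> 'm) \<Rightarrow>
   ('o, ('o, 'm) loc_arrow, unit) functor_data" where
  "HoInduced M N Fo Fa =
     \<lparr>Src = HoCat M, Tgt = HoCat N,
      FO = (\<lambda>x\<in>Obj (HoCat M). Fo x),
      FA = (\<lambda>X\<in>Arr (HoCat M).
        \<Union>{HoClass N (Fo x) (map (map_zig Fa) p) (Fo y) | x p y. (x, p, y) \<in> X})\<rparr>"

definition Lder :: "('o, 'm) model_functor \<Rightarrow> ('o, ('o, 'm) loc_arrow, unit) functor_data" where
  "Lder f = HoInduced (Src f) (Tgt f) (\<lambda>x. FO f (QO (Src f) x)) (\<lambda>u. FA f (QA (Src f) u))"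

definition Rder :: "('o, 'm) model_functor \<Rightarrow> ('o, ('o, 'm) loc_arrow, unit) functor_data" where
  "Rder g = HoInduced (Src g) (Tgt g) (\<lambda>x. FO g (RO (Src g) x)) (\<lambda>u. FA g (RA (Src g) u))"


section \<open>The assignments defining Ho\<close>

text \<open>At an object \<open>x\<close>, the zigzag is
  $kQfRx \leftarrow kQfQRx \to kfQRx \to ghQRx \to gRhQRx \leftarrow gRhQx$, with arrows
  $kQf\pi_{Rx}$, $k\pi_{fQRx}$, $\alpha_{QRx}$, $g\rho_{hQRx}$ and $gRhQ\rho_x$.\<close>

definition HoSquare ::
  "('o, 'm, ('m, unit) model_data_ext) square_data \<Rightarrow>
   ('o, ('o, 'm) loc_arrow, unit) square_data" where
  "HoSquare \<alpha> =
     (let f = STop \<alpha>; h = SLft \<alpha>; k = SRgt \<alpha>; g = SBot \<alpha>;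
          A = Src f; B = Tgt h; C = Tgt f; D = Tgt g in
      \<lparr>STop = Rder f, SLft = Lder h, SRgt = Lder k, SBot = Rder g,
       Tr = (\<lambda>x\<in>Obj A.
         HoClass D
           (FO k (QO C (FO f (RO A x))))
           [Bwd (FA k (QA C (FA f (qmap A (RO A x))))),
            Fwd (FA k (qmap C (FO f (QO A (RO A x))))),
            Fwd (Tr \<alpha> (QO A (RO A x))),
            Fwd (FA g (rmap B (FO h (QO A (RO A x))))),
            Bwd (FA g (RA B (FA h (QA A (rmap A x)))))]
           (FO g (RO B (FO h (QO A x)))))\<rparr>)"

text \<open>$\mathbf L(gf)\to\mathbf Lg\,\mathbf Lf$, the inverse of the map represented by $g\pi fQ$.\<close>

definition HoCompV ::
  "('o, 'm) model_functor \<Rightarrow> ('o, 'm) model_functor \<Rightarrow>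
   ('o, ('o, 'm) loc_arrow, unit) square_data" where
  "HoCompV g f =
     (let A = Src f; B = Tgt f; C = Tgt g in
      \<lparr>STop = id_functor (HoCat A), SLft = comp_functor (Lder g) (Lder f),
       SRgt = Lder (comp_functor g f), SBot = id_functor (HoCat C),
       Tr = (\<lambda>x\<in>Obj A.
         HoClass C (FO g (FO f (QO A x))) [Bwd (FA g (qmap B (FO f (QO A x))))]
           (FO g (QO B (FO f (QO A x)))))\<rparr>)"

text \<open>$\mathbf L(\mathrm{Id})\to\mathrm{Id}$, represented by $\pi$.\<close>

definition HoUnitV :: "('o, 'm) model_data \<Rightarrow> ('o, ('o, 'm) loc_arrow, unit) square_data" where
  "HoUnitV M =
     \<lparr>STop = id_functor (HoCat M), SLft = id_functor (HoCat M),
      SRgt = Lder (id_functor M), SBot = id_functor (HoCat M),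
      Tr = (\<lambda>x\<in>Obj M. HoClass M (QO M x) [Fwd (qmap M x)] x)\<rparr>"

text \<open>$\mathbf R(kh)\to\mathbf Rk\,\mathbf Rh$, represented by $k\rho hR$.\<close>

definition HoCompH ::
  "('o, 'm) model_functor \<Rightarrow> ('o, 'm) model_functor \<Rightarrow>
   ('o, ('o, 'm) loc_arrow, unit) square_data" where
  "HoCompH k h =
     (let A = Src h; B = Tgt h; C = Tgt k in
      \<lparr>STop = Rder (comp_functor k h), SLft = id_functor (HoCat A),
       SRgt = id_functor (HoCat C), SBot = comp_functor (Rder k) (Rder h),
       Tr = (\<lambda>x\<in>Obj A.
         HoClass C (FO k (FO h (RO A x))) [Fwd (FA k (rmap B (FO h (RO A x))))]
           (FO k (RO B (FO h (RO A x)))))\<rparr>)"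

text \<open>$\mathbf R(\mathrm{Id})\to\mathrm{Id}$, the inverse of the map represented by $\rho$.\<close>

definition HoUnitH :: "('o, 'm) model_data \<Rightarrow> ('o, ('o, 'm) loc_arrow, unit) square_data" where
  "HoUnitH M =
     \<lparr>STop = Rder (id_functor M), SLft = id_functor (HoCat M),
      SRgt = id_functor (HoCat M), SBot = id_functor (HoCat M),
      Tr = (\<lambda>x\<in>Obj M. HoClass M (RO M x) [Bwd (rmap M x)] x)\<rparr>"

definition Ho ::
  "(('o, 'm) model_data, ('o, 'm) model_functor, ('o, 'm) model_functor,
    ('o, 'm, ('m, unit) model_data_ext) square_data,
    ('o, ('o, 'm) loc_arrow) category_data, ('o, ('o, 'm) loc_arrow, unit) functor_data,
    ('o, ('o, 'm) loc_arrow, unit) functor_data, ('o, ('o, 'm) loc_arrow, unit) square_data)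
   double_functor_data" where
  "Ho = \<lparr>MapO = HoCat, MapV = Lder, MapH = Rder, MapS = HoSquare,
         UnitH = HoUnitH, UnitV = HoUnitV, CompV = HoCompV, CompH = HoCompH\<rparr>"

end

theory Submission
  imports Defs
begin

text \<open>
  For a square \<open>\<alpha>\<close> write \<open>hat y\<close> for the map \<open>kQfy \<rightarrow> kfy \<rightarrow> ghy \<rightarrow> gRhy\<close>, which is natural in all
  objects \<open>y\<close> of the source model category. Naturality of \<open>hat\<close> and of \<open>\<pi>\<close> gives, for every \<open>y\<close>, the identity
  \<open>gRh\<pi> \<circ> Ho \<alpha> \<circ> kQf\<rho> = hat y\<close> in the homotopy category: only \<open>kQf\<pi>\<close> and \<open>gRhQ\<rho>\<close> have to be weak equivalences
  for this, and they always are. At a bifibrant \<open>y\<close> also \<open>kQf\<rho>\<close> and \<open>gRh\<pi>\<close> are weak equivalences, by Ken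
  Brown's lemma, so there \<open>Ho \<alpha>\<close> is determined by \<open>hat y\<close>; and since every object is isomorphic to a
  bifibrant one in the homotopy category, natural transformations may be compared on bifibrant objects.
  Each naturality axiom thus reduces to pasting naturality squares of \<open>\<alpha>\<close>, \<open>\<beta>\<close>, \<open>\<pi>\<close> and \<open>\<rho>\<close> in the model category.
\<close>

section \<open>Categories and functors\<close>

text \<open>The homotopy category is known here only as a localization: no homotopy relation
  appears, and every computation in it inserts or cancels arrows \<open>fwd M w\<close> with
  \<open>w\<close> a weak equivalence. The obstacle is that \<open>hat\<close> is not a
  transformation of homotopical functors: \<open>kQf\<close> is guaranteed to respect weak
  equivalences only between fibrant objects and \<open>gRh\<close> only between cofibrant ones, so
  it cannot simply be pushed to the localization. Nor do the zigzags of two adjacent squares compose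
  directly, because each brings its own replacements. In every pasting the two sides are therefore
  wrapped between replacement maps, which turns each \<open>Ho\<close> into a \<open>hat\<close>,
  and the wrapping is cancelled at the end. After wrapping, one factor sits at an object such as
  \<open>fx\<close> or \<open>hx\<close> that need not be bifibrant; this is why the identity
  relating \<open>Ho\<close> and \<open>hat\<close> has to hold at all objects and not only where
  its outer maps are invertible. Facts on \<open>R\<close>, fibrations and right Quillen functors
  that rest on lifting, factorization or Ken Brown come from the opposite model category.\<close>

context category
begin

lemma Comp_Arr:
  assumes "f \<in> Arr C" "g \<in> Arr C" "Dom C g = Cod C f"
  shows "g \<odot> f \<in> Arr C" "Dom C (g \<odot> f) = Dom C f" "Cod C (g \<odot> f) = Cod C g"
  using Comp_hom[of f "Dom C f" "Cod C f" g "Cod C g"] assms by (auto simp: hom_def)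

lemma Ident_Arr:
  assumes "x \<in> Obj C"
  shows "Ident C x \<in> Arr C" "Dom C (Ident C x) = x" "Cod C (Ident C x) = x"
  using Ident_hom[OF assms] by (auto simp: hom_def)

lemma Comp_Ident_Dom: "f \<in> Arr C \<Longrightarrow> Dom C f = x \<Longrightarrow> f \<odot> Ident C x = f"
  using Comp_Ident[of f x "Cod C f"] by (simp add: hom_def)

lemma Ident_Cod_Comp: "f \<in> Arr C \<Longrightarrow> Cod C f = x \<Longrightarrow> Ident C x \<odot> f = f"
  using Ident_Comp[of f "Dom C f" x] by (simp add: hom_def)

lemma assoc:
  assumes "f \<in> Arr C" "g \<in> Arr C" "h \<in> Arr C" "Dom C g = Cod C f" "Dom C h = Cod C g"
  shows "(h \<odot> g) \<odot> f = h \<odot> (g \<odot> f)"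
  using Comp_assoc[of f "Dom C f" "Cod C f" g "Cod C g" h "Cod C h"] assms by (simp add: hom_def)

lemmas cat_simps = Dom_Obj Cod_Obj Comp_Arr Ident_Arr Comp_Ident_Dom Ident_Cod_Comp assoc

text \<open>Lets an equation for \<open>g \<odot> f\<close> be used inside a right-nested composite,
  where \<open>g \<odot> f\<close> is not a subterm.\<close>

lemma reassoc:
  assumes "g \<odot> f = k" "f \<in> Arr C" "g \<in> Arr C" "Dom C g = Cod C f" "r \<in> Arr C" "Dom C f = Cod C r"
  shows "g \<odot> (f \<odot> r) = k \<odot> r"
  using assms assoc by metis

lemma inverse_unique:
  assumes "inverse_arrows C f g" "inverse_arrows C f g'"
  shows "g = g'"
proof -
  have "g = (g' \<odot> f) \<odot> g"
    using assms by (auto simp: inverse_arrows_def hom_def cat_simps)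
  also have "\<dots> = g' \<odot> (f \<odot> g)"
    using assms by (intro assoc) (auto simp: inverse_arrows_def hom_def)
  also have "\<dots> = g'"
    using assms by (auto simp: inverse_arrows_def hom_def cat_simps)
  finally show ?thesis .
qed

lemma inverse_arrow_eq: "inverse_arrows C f g \<Longrightarrow> inverse_arrow C f = g"
  unfolding inverse_arrow_def using inverse_unique by blast

lemma inverse_arrowsD:
  assumes "inverse_arrows C w v"
  shows "w \<in> Arr C" "v \<in> Arr C" "Dom C v = Cod C w" "Cod C v = Dom C w"
    "v \<odot> w = Ident C (Dom C w)" "w \<odot> v = Ident C (Cod C w)"
  using assms by (auto simp: inverse_arrows_def hom_def)

lemma inverse_Comp:
  assumes "inverse_arrows C w v" "f \<in> Arr C" "Cod C f = Dom C w"
  shows "v \<odot> (w \<odot> f) = f"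
  using assoc[of f w v] inverse_arrowsD[OF assms(1)] assms(2,3) Ident_Cod_Comp[of f] by metis

lemma Comp_inverse:
  assumes "inverse_arrows C w v" "f \<in> Arr C" "Dom C f = Cod C w"
  shows "(f \<odot> w) \<odot> v = f"
  using assoc[of v w f] inverse_arrowsD[OF assms(1)] assms(2,3) Comp_Ident_Dom[of f] by metis

lemma cancel_left:
  assumes "inverse_arrows C w v" "f \<in> Arr C" "g \<in> Arr C" "Cod C f = Dom C w" "Cod C g = Dom C w"
    and "w \<odot> f = w \<odot> g"
  shows "f = g"
  using assms inverse_Comp by metis

lemma cancel_right:
  assumes "inverse_arrows C w v" "f \<in> Arr C" "g \<in> Arr C" "Dom C f = Cod C w" "Dom C g = Cod C w"
    and "f \<odot> w = g \<odot> w"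
  shows "f = g"
  using assms Comp_inverse by metis

end

section \<open>Functors and natural transformations given by bare maps\<close>

lemma is_functorD:
  assumes "is_functor C D Fo Fa"
  shows "category C" "category D"
    "\<And>x. x \<in> Obj C \<Longrightarrow> Fo x \<in> Obj D"
    "\<And>f. f \<in> Arr C \<Longrightarrow> Fa f \<in> Arr D"
    "\<And>f. f \<in> Arr C \<Longrightarrow> Dom D (Fa f) = Fo (Dom C f)"
    "\<And>f. f \<in> Arr C \<Longrightarrow> Cod D (Fa f) = Fo (Cod C f)"
    "\<And>x. x \<in> Obj C \<Longrightarrow> Fa (Ident C x) = Ident D (Fo x)"
    "\<And>f g. f \<in> Arr C \<Longrightarrow> g \<in> Arr C \<Longrightarrow> Dom C g = Cod C f \<Longrightarrow> Fa (g \<odot>\<^bsub>C\<^esub> f) = Fa g \<odot>\<^bsub>D\<^esub> Fa f"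
  using assms unfolding is_functor_def hom_def by auto

lemma is_functor_comp:
  assumes "is_functor C D Fo Fa" "is_functor D E Go Ga"
  shows "is_functor C E (\<lambda>x. Go (Fo x)) (\<lambda>f. Ga (Fa f))"
  using is_functorD[OF assms(1)] is_functorD[OF assms(2)]
  by (auto simp: is_functor_def hom_def)

lemma is_functor_id: "category C \<Longrightarrow> is_functor C C (\<lambda>x. x) (\<lambda>f. f)"
  by (auto simp: is_functor_def hom_def)

text \<open>The maps of a functor record are cut off outside the source, so those of a composite or
  identity record agree with the plain maps only on objects and arrows. This rule and its analogues
  for natural transformations and adjunctions pass between the two forms.\<close>

lemma is_functor_cong:
  assumes "is_functor C D Fo Fa" "\<And>x. x \<in> Obj C \<Longrightarrow> Fo x = Fo' x" "\<And>f. f \<in> Arr C \<Longrightarrow> Fa f = Fa' f"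
  shows "is_functor C D Fo' Fa'"
proof -
  interpret C: category C using is_functorD(1)[OF assms(1)] .
  show ?thesis
    using is_functorD[OF assms(1)] by (auto simp: is_functor_def hom_def C.cat_simps simp flip: assms(2,3))
qed

lemma is_natural_cong:
  assumes "is_natural C D Fo Fa Go Ga t" "category C"
    and "\<And>x. x \<in> Obj C \<Longrightarrow> Fo x = Fo' x" "\<And>f. f \<in> Arr C \<Longrightarrow> Fa f = Fa' f"
    and "\<And>x. x \<in> Obj C \<Longrightarrow> Go x = Go' x" "\<And>f. f \<in> Arr C \<Longrightarrow> Ga f = Ga' f"
    and "\<And>x. x \<in> Obj C \<Longrightarrow> t x = t' x"
  shows "is_natural C D Fo' Fa' Go' Ga' t'"
proof -
  interpret C: category C using assms(2) .
  show ?thesis using assms(1) by (auto simp: is_natural_def C.cat_simps simp flip: assms(3-))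
qed

lemma is_naturalD:
  assumes "is_natural C D Fo Fa Go Ga t"
  shows "\<And>x. x \<in> Obj C \<Longrightarrow> t x \<in> Arr D"
    "\<And>x. x \<in> Obj C \<Longrightarrow> Dom D (t x) = Fo x"
    "\<And>x. x \<in> Obj C \<Longrightarrow> Cod D (t x) = Go x"
    "\<And>f. f \<in> Arr C \<Longrightarrow> t (Cod C f) \<odot>\<^bsub>D\<^esub> Fa f = Ga f \<odot>\<^bsub>D\<^esub> t (Dom C f)"
  using assms unfolding is_natural_def hom_def by auto

lemma is_natural_vertical_comp:
  assumes "category D" "is_functor C D Fo Fa" "is_functor C D Go Ga" "is_functor C D Ko Ka"
    and "is_natural C D Fo Fa Go Ga s" "is_natural C D Go Ga Ko Ka t"
  shows "is_natural C D Fo Fa Ko Ka (\<lambda>x. t x \<odot>\<^bsub>D\<^esub> s x)"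
proof -
  interpret C: category C using is_functorD[OF assms(2)] by simp
  interpret D: category D by fact
  note S = C.cat_simps is_functorD[OF assms(2)] is_functorD[OF assms(3)] is_functorD[OF assms(4)]
    is_naturalD(1-3)[OF assms(5)] is_naturalD(1-3)[OF assms(6)]
  have "(t (Cod C f) \<odot>\<^bsub>D\<^esub> s (Cod C f)) \<odot>\<^bsub>D\<^esub> Fa f = Ka f \<odot>\<^bsub>D\<^esub> (t (Dom C f) \<odot>\<^bsub>D\<^esub> s (Dom C f))"
    if f: "f \<in> Arr C" for f
  proof -
    have "(t (Cod C f) \<odot>\<^bsub>D\<^esub> s (Cod C f)) \<odot>\<^bsub>D\<^esub> Fa f = (t (Cod C f) \<odot>\<^bsub>D\<^esub> Ga f) \<odot>\<^bsub>D\<^esub> s (Dom C f)"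
      using f is_naturalD(4)[OF assms(5)] by (simp add: S D.assoc)
    also have "\<dots> = Ka f \<odot>\<^bsub>D\<^esub> (t (Dom C f) \<odot>\<^bsub>D\<^esub> s (Dom C f))"
      using f is_naturalD(4)[OF assms(6)] by (simp add: S D.assoc)
    finally show ?thesis .
  qed
  then show ?thesis
    by (auto simp: is_natural_def hom_def S D.cat_simps)
qed

lemma is_natural_whisker_left:
  assumes "category C" "is_functor D E Ko Ka" "is_natural C D Fo Fa Go Ga t"
    and "is_functor C D Fo Fa" "is_functor C D Go Ga"
  shows "is_natural C E (\<lambda>x. Ko (Fo x)) (\<lambda>f. Ka (Fa f)) (\<lambda>x. Ko (Go x)) (\<lambda>f. Ka (Ga f)) (\<lambda>x. Ka (t x))"
proof -
  interpret C: category C by fact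
  note S = C.cat_simps is_functorD[OF assms(4)] is_functorD[OF assms(5)]
    is_naturalD(1-3)[OF assms(3)]
  have "Ka (t (Cod C f)) \<odot>\<^bsub>E\<^esub> Ka (Fa f) = Ka (Ga f) \<odot>\<^bsub>E\<^esub> Ka (t (Dom C f))" if "f \<in> Arr C" for f
    using that is_naturalD(4)[OF assms(3), of f]
      is_functorD(8)[OF assms(2), of "Fa f" "t (Cod C f)"]
      is_functorD(8)[OF assms(2), of "t (Dom C f)" "Ga f"] by (simp add: S)
  then show ?thesis
    by (simp add: is_natural_def hom_def S is_functorD(3-6)[OF assms(2)])
qed

lemma is_natural_whisker_right:
  assumes "is_functor B C Ko Ka" "is_natural C D Fo Fa Go Ga t"
  shows "is_natural B D (\<lambda>x. Fo (Ko x)) (\<lambda>f. Fa (Ka f)) (\<lambda>x. Go (Ko x)) (\<lambda>f. Ga (Ka f)) (\<lambda>x. t (Ko x))"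
proof -
  have "t (Ko (Cod B f)) \<odot>\<^bsub>D\<^esub> Fa (Ka f) = Ga (Ka f) \<odot>\<^bsub>D\<^esub> t (Ko (Dom B f))" if "f \<in> Arr B" for f
    using that is_functorD[OF assms(1)] is_naturalD(4)[OF assms(2), of "Ka f"] by simp
  then show ?thesis
    using is_functorD[OF assms(1)] is_naturalD[OF assms(2)] by (simp add: is_natural_def hom_def)
qed

section \<open>Functor records as strictly unital and associative 1-cells\<close>

lemma is_functor_cellD:
  assumes "is_functor_cell F"
  shows "is_functor (Src F) (Tgt F) (FO F) (FA F)"
    "FO F \<in> extensional (Obj (Src F))" "FA F \<in> extensional (Arr (Src F))"
  using assms unfolding is_functor_cell_def by auto

lemmas cell_functorD = is_functorD[OF is_functor_cellD(1)]

lemma functor_data_eqI: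
  fixes F G :: "('o, 'm, 'z) functor_data"
  assumes "Src F = Src G" "Tgt F = Tgt G" "FO F = FO G" "FA F = FA G"
  shows "F = G"
  using assms by (cases F; cases G) auto

lemma square_data_eqI:
  fixes \<alpha> \<beta> :: "('o, 'm, 'z) square_data"
  assumes "STop \<alpha> = STop \<beta>" "SLft \<alpha> = SLft \<beta>" "SRgt \<alpha> = SRgt \<beta>" "SBot \<alpha> = SBot \<beta>"
    "\<And>x. Tr \<alpha> x = Tr \<beta> x"
  shows "\<alpha> = \<beta>"
  using assms by (cases \<alpha>; cases \<beta>) auto

lemma id_functor_simps [simp]:
  "Src (id_functor C) = C" "Tgt (id_functor C) = C"
  "x \<in> Obj C \<Longrightarrow> FO (id_functor C) x = x"
  "f \<in> Arr C \<Longrightarrow> FA (id_functor C) f = f"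
  by (simp_all add: id_functor_def)

lemma comp_functor_simps [simp]:
  "Src (comp_functor G F) = Src F" "Tgt (comp_functor G F) = Tgt G"
  "x \<in> Obj (Src F) \<Longrightarrow> FO (comp_functor G F) x = FO G (FO F x)"
  "f \<in> Arr (Src F) \<Longrightarrow> FA (comp_functor G F) f = FA G (FA F f)"
  by (simp_all add: comp_functor_def)

lemma is_functor_cell_id: "category C \<Longrightarrow> is_functor_cell (id_functor C)"
  using is_functor_cong[OF is_functor_id[of C], of "FO (id_functor C)" "FA (id_functor C)"]
  by (simp add: is_functor_cell_def id_functor_def)

lemma is_functor_cell_comp:
  assumes "is_functor_cell F" "is_functor_cell G" "Src G = Tgt F"
  shows "is_functor_cell (comp_functor G F)"
proof -
  have "is_functor (Src F) (Tgt G) (\<lambda>x. FO G (FO F x)) (\<lambda>f. FA G (FA F f))"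
    using is_functor_comp is_functor_cellD(1)[OF assms(1)] is_functor_cellD(1)[OF assms(2)] assms(3)
    by metis
  then show ?thesis
    using is_functor_cong[of "Src F" "Tgt G" _ _ "FO (comp_functor G F)" "FA (comp_functor G F)"]
    by (simp add: is_functor_cell_def comp_functor_def)
qed

lemma comp_functor_id_right:
  assumes "is_functor_cell F" "Src F = C"
  shows "comp_functor F (id_functor C) = F"
  using is_functor_cellD(2,3)[OF assms(1)] assms(2)
  by (intro functor_data_eqI) (auto simp: comp_functor_def fun_eq_iff extensional_def)

lemma comp_functor_id_left:
  assumes "is_functor_cell F" "Tgt F = D"
  shows "comp_functor (id_functor D) F = F"
  using is_functor_cellD(2,3)[OF assms(1)] assms(2) cell_functorD[OF assms(1)]
  by (intro functor_data_eqI) (auto simp: comp_functor_def fun_eq_iff extensional_def)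

lemma comp_functor_assoc:
  assumes "is_functor_cell F" "Src G = Tgt F"
  shows "comp_functor H (comp_functor G F) = comp_functor (comp_functor H G) F"
  using cell_functorD[OF assms(1)] assms(2)
  by (intro functor_data_eqI) (auto simp: comp_functor_def fun_eq_iff)

section \<open>The double category of functors and natural transformations\<close>

lemma is_functor_squareD:
  assumes "is_functor_square \<alpha>"
  shows "Src (SLft \<alpha>) = Src (STop \<alpha>)" "Src (SRgt \<alpha>) = Tgt (STop \<alpha>)"
    "Src (SBot \<alpha>) = Tgt (SLft \<alpha>)" "Tgt (SBot \<alpha>) = Tgt (SRgt \<alpha>)"
    "is_natural (Src (STop \<alpha>)) (Tgt (SRgt \<alpha>))
       (\<lambda>x. FO (SRgt \<alpha>) (FO (STop \<alpha>) x)) (\<lambda>u. FA (SRgt \<alpha>) (FA (STop \<alpha>) u))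
       (\<lambda>x. FO (SBot \<alpha>) (FO (SLft \<alpha>) x)) (\<lambda>u. FA (SBot \<alpha>) (FA (SLft \<alpha>) u)) (Tr \<alpha>)"
    "Tr \<alpha> \<in> extensional (Obj (Src (STop \<alpha>)))"
  using assms by (auto simp: is_functor_square_def)

lemma square_simps [simp]:
  "STop (square_vcomp \<beta> \<alpha>) = STop \<alpha>" "SBot (square_vcomp \<beta> \<alpha>) = SBot \<beta>"
  "SLft (square_vcomp \<beta> \<alpha>) = comp_functor (SLft \<beta>) (SLft \<alpha>)"
  "SRgt (square_vcomp \<beta> \<alpha>) = comp_functor (SRgt \<beta>) (SRgt \<alpha>)"
  "STop (square_hcomp \<alpha> \<beta>) = comp_functor (STop \<beta>) (STop \<alpha>)"
  "SBot (square_hcomp \<alpha> \<beta>) = comp_functor (SBot \<beta>) (SBot \<alpha>)"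
  "SLft (square_hcomp \<alpha> \<beta>) = SLft \<alpha>" "SRgt (square_hcomp \<alpha> \<beta>) = SRgt \<beta>"
  "STop (square_id_v u) = id_functor (Src u)" "SBot (square_id_v u) = id_functor (Tgt u)"
  "SLft (square_id_v u) = u" "SRgt (square_id_v u) = u"
  "STop (square_id_h f) = f" "SBot (square_id_h f) = f"
  "SLft (square_id_h f) = id_functor (Src f)" "SRgt (square_id_h f) = id_functor (Tgt f)"
  by (simp_all add: square_vcomp_def square_hcomp_def square_id_v_def square_id_h_def)

lemma Tr_simps:
  "Tr (square_vcomp \<beta> \<alpha>) x = (if x \<in> Obj (Src (STop \<alpha>))
     then Tr \<beta> (FO (SLft \<alpha>) x) \<odot>\<^bsub>Tgt (SBot \<beta>)\<^esub> FA (SRgt \<beta>) (Tr \<alpha> x) else undefined)"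
  "Tr (square_hcomp \<alpha> \<beta>) x = (if x \<in> Obj (Src (STop \<alpha>))
     then FA (SBot \<beta>) (Tr \<alpha> x) \<odot>\<^bsub>Tgt (SBot \<beta>)\<^esub> Tr \<beta> (FO (STop \<alpha>) x) else undefined)"
  "Tr (square_id_v u) x = (if x \<in> Obj (Src u) then Ident (Tgt u) (FO u x) else undefined)"
  "Tr (square_id_h f) x = (if x \<in> Obj (Src f) then Ident (Tgt f) (FO f x) else undefined)"
  by (simp_all add: square_vcomp_def square_hcomp_def square_id_v_def square_id_h_def)

lemma square_comp_ext [simp]:
  "Tr (square_vcomp \<beta> \<alpha>) \<in> extensional (Obj (Src (STop \<alpha>)))"
  "Tr (square_hcomp \<alpha> \<beta>) \<in> extensional (Obj (Src (STop \<alpha>)))"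
  by (simp_all add: square_vcomp_def square_hcomp_def)

text \<open>Exactly the squares of \<open>Cat\<close>, phrased without a double category; squares of
  \<open>Model\<close> satisfy it too, so one set of pasting lemmas serves both.\<close>

definition is_cell_square :: "('o, 'm, 'z) square_data \<Rightarrow> bool" where
  "is_cell_square \<alpha> \<longleftrightarrow> is_functor_cell (STop \<alpha>) \<and> is_functor_cell (SBot \<alpha>) \<and>
     is_functor_cell (SLft \<alpha>) \<and> is_functor_cell (SRgt \<alpha>) \<and> is_functor_square \<alpha>"

lemma cell_squareD:
  assumes "is_cell_square \<alpha>"
  shows "is_functor_cell (STop \<alpha>)" "is_functor_cell (SBot \<alpha>)"
    "is_functor_cell (SLft \<alpha>)" "is_functor_cell (SRgt \<alpha>)" "is_functor_square \<alpha>"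
  using assms by (auto simp: is_cell_square_def)

text \<open>Besides the component facts, this fixes one name for each corner of a square:
  \<open>Src (STop \<alpha>)\<close>, \<open>Tgt (STop \<alpha>)\<close>,
  \<open>Tgt (SLft \<alpha>)\<close> and \<open>Tgt (SRgt \<alpha>)\<close>.\<close>

lemma cell_square_simps:
  assumes "is_cell_square \<alpha>"
  shows "category (Src (STop \<alpha>))" "category (Tgt (STop \<alpha>))"
    "category (Tgt (SLft \<alpha>))" "category (Tgt (SRgt \<alpha>))"
    "Src (SLft \<alpha>) = Src (STop \<alpha>)" "Src (SRgt \<alpha>) = Tgt (STop \<alpha>)"
    "Src (SBot \<alpha>) = Tgt (SLft \<alpha>)" "Tgt (SBot \<alpha>) = Tgt (SRgt \<alpha>)"
    "\<And>x. x \<in> Obj (Src (STop \<alpha>)) \<Longrightarrow> Tr \<alpha> x \<in> Arr (Tgt (SRgt \<alpha>))"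
    "\<And>x. x \<in> Obj (Src (STop \<alpha>)) \<Longrightarrow> Dom (Tgt (SRgt \<alpha>)) (Tr \<alpha> x) = FO (SRgt \<alpha>) (FO (STop \<alpha>) x)"
    "\<And>x. x \<in> Obj (Src (STop \<alpha>)) \<Longrightarrow> Cod (Tgt (SRgt \<alpha>)) (Tr \<alpha> x) = FO (SBot \<alpha>) (FO (SLft \<alpha>) x)"
    "\<And>x. x \<notin> Obj (Src (STop \<alpha>)) \<Longrightarrow> Tr \<alpha> x = undefined"
    "\<And>f. f \<in> Arr (Src (STop \<alpha>)) \<Longrightarrow>
       Tr \<alpha> (Cod (Src (STop \<alpha>)) f) \<odot>\<^bsub>Tgt (SRgt \<alpha>)\<^esub> FA (SRgt \<alpha>) (FA (STop \<alpha>) f) =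
       FA (SBot \<alpha>) (FA (SLft \<alpha>) f) \<odot>\<^bsub>Tgt (SRgt \<alpha>)\<^esub> Tr \<alpha> (Dom (Src (STop \<alpha>)) f)"
  using is_functor_squareD(1-4)[OF cell_squareD(5)[OF assms]]
    is_naturalD[OF is_functor_squareD(5)[OF cell_squareD(5)[OF assms]]]
    is_functor_squareD(6)[OF cell_squareD(5)[OF assms]]
    cell_functorD(1,2)[OF cell_squareD(1)[OF assms]]
    cell_functorD(1,2)[OF cell_squareD(2)[OF assms]]
    cell_functorD(1,2)[OF cell_squareD(4)[OF assms]]
  by (simp_all add: extensional_def)

lemmas cell_square_functorD = cell_functorD(3-)[OF cell_squareD(1)] cell_functorD(3-)[OF cell_squareD(2)]
  cell_functorD(3-)[OF cell_squareD(3)] cell_functorD(3-)[OF cell_squareD(4)]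

lemma cell_square_vcomp:
  assumes \<alpha>: "is_cell_square \<alpha>" and \<beta>: "is_cell_square \<beta>" and eq: "STop \<beta> = SBot \<alpha>"
  shows "is_cell_square (square_vcomp \<beta> \<alpha>)"
proof -
  note S = cell_square_simps[OF \<alpha>] cell_square_simps[OF \<beta>, unfolded eq cell_square_simps(7,8)[OF \<alpha>]]
    cell_square_functorD[OF \<alpha>, unfolded cell_square_simps(5-8)[OF \<alpha>]] cell_square_functorD[OF \<beta>, unfolded cell_square_simps(5-8)[OF \<beta>] eq cell_square_simps(7,8)[OF \<alpha>]]
  interpret A: category "Src (STop \<alpha>)" by (simp add: S)
  interpret D: category "Tgt (SRgt \<beta>)" by (simp add: S)
  let ?E = "Tgt (SRgt \<beta>)"
  have "Tr \<beta> (FO (SLft \<alpha>) (Cod (Src (STop \<alpha>)) f)) \<odot>\<^bsub>?E\<^esub> FA (SRgt \<beta>) (Tr \<alpha> (Cod (Src (STop \<alpha>)) f)) \<odot>\<^bsub>?E\<^esub>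
      FA (SRgt \<beta>) (FA (SRgt \<alpha>) (FA (STop \<alpha>) f)) =
    FA (SBot \<beta>) (FA (SLft \<beta>) (FA (SLft \<alpha>) f)) \<odot>\<^bsub>?E\<^esub>
      (Tr \<beta> (FO (SLft \<alpha>) (Dom (Src (STop \<alpha>)) f)) \<odot>\<^bsub>?E\<^esub> FA (SRgt \<beta>) (Tr \<alpha> (Dom (Src (STop \<alpha>)) f)))"
    (is "?l = ?r") if f: "f \<in> Arr (Src (STop \<alpha>))" for f
  proof -
    \<comment> \<open>Naturality of \<alpha>, the fact \<open>S(13)\<close>, enters inside
      \<open>FA (SRgt \<beta>)\<close>, and naturality of \<beta>, the fact \<open>S(26)\<close>, at
      \<open>FA (SLft \<alpha>) f\<close>. This first step is functoriality alone, hence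
      \<open>S(13)\<close> is withheld.\<close>
    have "?l = Tr \<beta> (FO (SLft \<alpha>) (Cod (Src (STop \<alpha>)) f)) \<odot>\<^bsub>?E\<^esub>
        FA (SRgt \<beta>) (Tr \<alpha> (Cod (Src (STop \<alpha>)) f) \<odot>\<^bsub>Tgt (SRgt \<alpha>)\<^esub> FA (SRgt \<alpha>) (FA (STop \<alpha>) f))"
      using f by (simp add: S A.cat_simps D.assoc del: S(13))
    also have "\<dots> = (Tr \<beta> (FO (SLft \<alpha>) (Cod (Src (STop \<alpha>)) f)) \<odot>\<^bsub>?E\<^esub>
        FA (SRgt \<beta>) (FA (SBot \<alpha>) (FA (SLft \<alpha>) f))) \<odot>\<^bsub>?E\<^esub> FA (SRgt \<beta>) (Tr \<alpha> (Dom (Src (STop \<alpha>)) f))"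
      using f by (simp add: S A.cat_simps D.assoc)
    also have "\<dots> = ?r"
      using f S(26)[of "FA (SLft \<alpha>) f"] by (simp add: S(1-25) S(27-) A.cat_simps D.assoc)
    finally show ?thesis .
  qed
  then have "is_functor_square (square_vcomp \<beta> \<alpha>)"
    unfolding is_functor_square_def is_natural_def hom_def
    by (auto simp: eq S A.cat_simps D.cat_simps Tr_simps)
  then show ?thesis
    using \<alpha> \<beta> eq S by (auto simp: is_cell_square_def intro!: is_functor_cell_comp)
qed

lemma cell_square_hcomp:
  assumes \<alpha>: "is_cell_square \<alpha>" and \<beta>: "is_cell_square \<beta>" and eq: "SLft \<beta> = SRgt \<alpha>"
  shows "is_cell_square (square_hcomp \<alpha> \<beta>)"
proof -
  have src: "Src (STop \<beta>) = Tgt (STop \<alpha>)"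
    using cell_square_simps(5)[OF \<beta>] cell_square_simps(6)[OF \<alpha>] eq by simp
  note S = cell_square_simps[OF \<alpha>] cell_square_simps[OF \<beta>, unfolded eq src]
    cell_square_functorD[OF \<alpha>, unfolded cell_square_simps(5-8)[OF \<alpha>]] cell_square_functorD[OF \<beta>, unfolded cell_square_simps(5-8)[OF \<beta>] eq src]
  interpret A: category "Src (STop \<alpha>)" by (simp add: S)
  interpret D: category "Tgt (SRgt \<beta>)" by (simp add: S)
  let ?E = "Tgt (SRgt \<beta>)"
  have "(FA (SBot \<beta>) (Tr \<alpha> (Cod (Src (STop \<alpha>)) f)) \<odot>\<^bsub>?E\<^esub> Tr \<beta> (FO (STop \<alpha>) (Cod (Src (STop \<alpha>)) f))) \<odot>\<^bsub>?E\<^esub>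
      FA (SRgt \<beta>) (FA (STop \<beta>) (FA (STop \<alpha>) f)) =
    FA (SBot \<beta>) (FA (SBot \<alpha>) (FA (SLft \<alpha>) f)) \<odot>\<^bsub>?E\<^esub>
      (FA (SBot \<beta>) (Tr \<alpha> (Dom (Src (STop \<alpha>)) f)) \<odot>\<^bsub>?E\<^esub> Tr \<beta> (FO (STop \<alpha>) (Dom (Src (STop \<alpha>)) f)))"
    (is "?l = ?r") if f: "f \<in> Arr (Src (STop \<alpha>))" for f
  proof -
    \<comment> \<open>Now \<beta> comes first, at \<open>FA (STop \<alpha>) f\<close>, and \<alpha>
      second, inside \<open>FA (SBot \<beta>)\<close>.\<close>
    have "?l = FA (SBot \<beta>) (Tr \<alpha> (Cod (Src (STop \<alpha>)) f) \<odot>\<^bsub>Tgt (SRgt \<alpha>)\<^esub> FA (SRgt \<alpha>) (FA (STop \<alpha>) f))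
        \<odot>\<^bsub>?E\<^esub> Tr \<beta> (FO (STop \<alpha>) (Dom (Src (STop \<alpha>)) f))"
      using f S(26)[of "FA (STop \<alpha>) f"] by (simp add: S(1-12) S(14-25) S(27-) A.cat_simps D.assoc)
    also have "\<dots> = ?r"
      using f by (simp add: S A.cat_simps D.assoc)
    finally show ?thesis .
  qed
  then have "is_functor_square (square_hcomp \<alpha> \<beta>)"
    unfolding is_functor_square_def is_natural_def hom_def
    by (auto simp: eq src S A.cat_simps D.cat_simps Tr_simps)
  then show ?thesis
    using \<alpha> \<beta> eq src S by (auto simp: is_cell_square_def intro!: is_functor_cell_comp)
qed

section \<open>Associativity and interchange of pasting\<close>

lemma square_vcomp_assoc:
  assumes \<alpha>: "is_cell_square \<alpha>" and \<beta>: "is_cell_square \<beta>" and \<gamma>: "is_cell_square \<gamma>"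
    and eq: "STop \<beta> = SBot \<alpha>" "STop \<gamma> = SBot \<beta>"
  shows "square_vcomp \<gamma> (square_vcomp \<beta> \<alpha>) = square_vcomp (square_vcomp \<gamma> \<beta>) \<alpha>"
proof (rule square_data_eqI)
  note A = cell_square_simps[OF \<alpha>] cell_square_functorD[OF \<alpha>, unfolded cell_square_simps(5-8)[OF \<alpha>]]
  note B = cell_square_simps[OF \<beta>, unfolded eq A(7,8)] cell_square_functorD[OF \<beta>, unfolded cell_square_simps(5-8)[OF \<beta>] eq A(7,8)]
  note C = cell_square_simps[OF \<gamma>, unfolded eq B(7,8)] cell_square_functorD[OF \<gamma>, unfolded cell_square_simps(5-8)[OF \<gamma>] eq B(7,8)]
  interpret D: category "Tgt (SRgt \<gamma>)" by (simp add: C)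
  fix x
  show "Tr (square_vcomp \<gamma> (square_vcomp \<beta> \<alpha>)) x = Tr (square_vcomp (square_vcomp \<gamma> \<beta>) \<alpha>) x"
    by (simp add: Tr_simps A B C eq D.assoc)
qed (use assms in \<open>auto simp: cell_square_simps intro!: comp_functor_assoc dest: cell_squareD\<close>)

lemma square_hcomp_assoc:
  assumes \<alpha>: "is_cell_square \<alpha>" and \<beta>: "is_cell_square \<beta>" and \<gamma>: "is_cell_square \<gamma>"
    and eq: "SLft \<beta> = SRgt \<alpha>" "SLft \<gamma> = SRgt \<beta>"
  shows "square_hcomp (square_hcomp \<alpha> \<beta>) \<gamma> = square_hcomp \<alpha> (square_hcomp \<beta> \<gamma>)"
proof (rule square_data_eqI)
  note A = cell_square_simps[OF \<alpha>] cell_square_functorD[OF \<alpha>, unfolded cell_square_simps(5-8)[OF \<alpha>]]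
  have b: "Src (STop \<beta>) = Tgt (STop \<alpha>)" using A cell_square_simps(5)[OF \<beta>] eq by simp
  note B = cell_square_simps[OF \<beta>, unfolded eq b] cell_square_functorD[OF \<beta>, unfolded cell_square_simps(5-8)[OF \<beta>] eq b]
  have c: "Src (STop \<gamma>) = Tgt (STop \<beta>)" using B cell_square_simps(5)[OF \<gamma>] eq by simp
  note C = cell_square_simps[OF \<gamma>, unfolded eq c] cell_square_functorD[OF \<gamma>, unfolded cell_square_simps(5-8)[OF \<gamma>] eq c]
  interpret D: category "Tgt (SRgt \<gamma>)" by (simp add: C)
  fix x
  show "Tr (square_hcomp (square_hcomp \<alpha> \<beta>) \<gamma>) x = Tr (square_hcomp \<alpha> (square_hcomp \<beta> \<gamma>)) x"
    by (simp add: Tr_simps A B C eq b c D.assoc)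
next
  show "STop (square_hcomp (square_hcomp \<alpha> \<beta>) \<gamma>) = STop (square_hcomp \<alpha> (square_hcomp \<beta> \<gamma>))"
    "SBot (square_hcomp (square_hcomp \<alpha> \<beta>) \<gamma>) = SBot (square_hcomp \<alpha> (square_hcomp \<beta> \<gamma>))"
    using comp_functor_assoc cell_squareD[OF \<alpha>] cell_square_simps(5-8)[OF \<alpha>]
      cell_square_simps(5-8)[OF \<beta>] eq by (metis square_simps(5), metis square_simps(6))
qed (use eq in simp_all)

text \<open>Both components are composites of four factors with the same outer two; the middle two
  are exchanged by naturality of \<delta> at the arrow \<open>Tr \<alpha> x\<close>.\<close>

lemma square_interchange:
  assumes \<alpha>: "is_cell_square \<alpha>" and \<beta>: "is_cell_square \<beta>" and \<gamma>: "is_cell_square \<gamma>" and \<delta>: "is_cell_square \<delta>"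
    and eq: "SLft \<beta> = SRgt \<alpha>" "SLft \<delta> = SRgt \<gamma>" "STop \<gamma> = SBot \<alpha>" "STop \<delta> = SBot \<beta>"
  shows "square_vcomp (square_hcomp \<gamma> \<delta>) (square_hcomp \<alpha> \<beta>) =
    square_hcomp (square_vcomp \<gamma> \<alpha>) (square_vcomp \<delta> \<beta>)"
proof (rule square_data_eqI)
  note A = cell_square_simps[OF \<alpha>] cell_square_functorD[OF \<alpha>, unfolded cell_square_simps(5-8)[OF \<alpha>]]
  have b: "Src (STop \<beta>) = Tgt (STop \<alpha>)" using A cell_square_simps(5)[OF \<beta>] eq by simp
  note B = cell_square_simps[OF \<beta>, unfolded eq b] cell_square_functorD[OF \<beta>, unfolded cell_square_simps(5-8)[OF \<beta>] eq b]
  note C = cell_square_simps[OF \<gamma>, unfolded eq A(7,8)] cell_square_functorD[OF \<gamma>, unfolded cell_square_simps(5-8)[OF \<gamma>] eq A(7,8)]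
  note D = cell_square_simps[OF \<delta>, unfolded eq B(7,8)] cell_square_functorD[OF \<delta>, unfolded cell_square_simps(5-8)[OF \<delta>] eq B(7,8)]
  interpret A: category "Src (STop \<alpha>)" by (simp add: A)
  interpret D: category "Tgt (SRgt \<delta>)" by (simp add: D)
  let ?D = "Tgt (SRgt \<delta>)"
  fix x
  show "Tr (square_vcomp (square_hcomp \<gamma> \<delta>) (square_hcomp \<alpha> \<beta>)) x =
      Tr (square_hcomp (square_vcomp \<gamma> \<alpha>) (square_vcomp \<delta> \<beta>)) x"
  proof (cases "x \<in> Obj (Src (STop \<alpha>))")
    case True
    have nat: "Tr \<delta> (FO (SBot \<alpha>) (FO (SLft \<alpha>) x)) \<odot>\<^bsub>?D\<^esub> FA (SRgt \<delta>) (FA (SBot \<beta>) (Tr \<alpha> x)) =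
      FA (SBot \<delta>) (FA (SRgt \<gamma>) (Tr \<alpha> x)) \<odot>\<^bsub>?D\<^esub> Tr \<delta> (FO (SRgt \<alpha>) (FO (STop \<alpha>) x))"
      using True D(13)[of "Tr \<alpha> x"] by (simp add: A(1-12) B(1-12))
    show ?thesis
      using True nat D.reassoc[OF nat, of "FA (SRgt \<delta>) (Tr \<beta> (FO (STop \<alpha>) x))"]
      by (simp add: Tr_simps A(1-12) A(14-) B(1-12) B(14-) C(1-12) C(14-) D(1-12) D(14-) eq b D.cat_simps)
  qed (simp add: Tr_simps)
qed (use eq in simp_all)

text \<open>What two classes of functors must satisfy for all squares with sides in them to form a
  double category. It is instantiated by all functors, giving \<open>Cat\<close>, and by left and
  right Quillen functors, giving \<open>Model\<close>.\<close>

locale functor_square_closure =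
  fixes \<O> :: "('o, 'm, 'z) category_data_scheme set" and \<V> \<H> :: "('o, 'm, 'z) functor_data set"
  assumes category: "C \<in> \<O> \<Longrightarrow> category C"
    and Ver_cell: "F \<in> \<V> \<Longrightarrow> is_functor_cell F \<and> Src F \<in> \<O> \<and> Tgt F \<in> \<O>"
    and Hor_cell: "F \<in> \<H> \<Longrightarrow> is_functor_cell F \<and> Src F \<in> \<O> \<and> Tgt F \<in> \<O>"
    and Ver_id: "C \<in> \<O> \<Longrightarrow> id_functor C \<in> \<V>"
    and Hor_id: "C \<in> \<O> \<Longrightarrow> id_functor C \<in> \<H>"
    and Ver_comp: "F \<in> \<V> \<Longrightarrow> G \<in> \<V> \<Longrightarrow> Src G = Tgt F \<Longrightarrow> comp_functor G F \<in> \<V>"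
    and Hor_comp: "F \<in> \<H> \<Longrightarrow> G \<in> \<H> \<Longrightarrow> Src G = Tgt F \<Longrightarrow> comp_functor G F \<in> \<H>"
begin

abbreviation K where "K \<equiv> functor_squares \<O> \<V> \<H>"

lemma K_simps:
  "Obj (Ver K) = \<O>" "Arr (Ver K) = \<V>" "Dom (Ver K) = Src" "Cod (Ver K) = Tgt"
  "Ident (Ver K) = id_functor" "Comp (Ver K) = comp_functor"
  "Obj (Hor K) = \<O>" "Arr (Hor K) = \<H>" "Dom (Hor K) = Src" "Cod (Hor K) = Tgt"
  "Ident (Hor K) = id_functor" "Comp (Hor K) = comp_functor"
  "Obj (SqV K) = \<H>" "Dom (SqV K) = STop" "Cod (SqV K) = SBot"
  "Ident (SqV K) = square_id_h" "Comp (SqV K) = square_vcomp"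
  "Obj (SqH K) = \<V>" "Dom (SqH K) = SLft" "Cod (SqH K) = SRgt"
  "Ident (SqH K) = square_id_v" "Comp (SqH K) = (\<lambda>\<beta> \<alpha>. square_hcomp \<alpha> \<beta>)"
  "Arr (SqH K) = Arr (SqV K)"
  "Arr (SqV K) = {\<alpha>. STop \<alpha> \<in> \<H> \<and> SBot \<alpha> \<in> \<H> \<and> SLft \<alpha> \<in> \<V> \<and> SRgt \<alpha> \<in> \<V> \<and> is_functor_square \<alpha>}"
  by (simp_all add: functor_squares_def Let_def)

lemma Sq_cell: "\<alpha> \<in> Sq K \<Longrightarrow> is_cell_square \<alpha>"
  using Ver_cell Hor_cell by (simp add: K_simps is_cell_square_def)

lemma Sq_vcomp:
  assumes "\<alpha> \<in> Sq K" "\<beta> \<in> Sq K" "STop \<beta> = SBot \<alpha>"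
  shows "square_vcomp \<beta> \<alpha> \<in> Sq K"
  using cell_square_vcomp[OF assms(1,2)[THEN Sq_cell] assms(3)] assms
    cell_square_simps(5-8)[OF Sq_cell[OF assms(1)]] cell_square_simps(5-8)[OF Sq_cell[OF assms(2)]]
  by (auto simp: K_simps is_cell_square_def intro!: Ver_comp)

lemma Sq_hcomp:
  assumes "\<alpha> \<in> Sq K" "\<beta> \<in> Sq K" "SLft \<beta> = SRgt \<alpha>"
  shows "square_hcomp \<alpha> \<beta> \<in> Sq K"
  using cell_square_hcomp[OF assms(1,2)[THEN Sq_cell] assms(3)] assms
    cell_square_simps(5-8)[OF Sq_cell[OF assms(1)]] cell_square_simps(5-8)[OF Sq_cell[OF assms(2)]]
  by (auto simp: K_simps is_cell_square_def intro!: Hor_comp)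

lemma Sq_id_v: "u \<in> \<V> \<Longrightarrow> square_id_v u \<in> Sq K"
proof -
  assume u: "u \<in> \<V>"
  note S = cell_functorD[OF conjunct1[OF Ver_cell[OF u]]]
  interpret A: category "Src u" by (rule S)
  interpret B: category "Tgt u" by (rule S)
  show ?thesis
    using u Hor_id Ver_cell
    by (auto simp: K_simps is_functor_square_def is_natural_def hom_def Tr_simps S A.cat_simps
        B.cat_simps extensional_def)
qed

lemma Sq_id_h: "u \<in> \<H> \<Longrightarrow> square_id_h u \<in> Sq K"
proof -
  assume u: "u \<in> \<H>"
  note S = cell_functorD[OF conjunct1[OF Hor_cell[OF u]]]
  interpret A: category "Src u" by (rule S)
  interpret B: category "Tgt u" by (rule S)
  show ?thesis
    using u Ver_id Hor_cell
    by (auto simp: K_simps is_functor_square_def is_natural_def hom_def Tr_simps S A.cat_simps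
        B.cat_simps extensional_def)
qed

lemma square_id_vcomp:
  assumes "\<alpha> \<in> Sq K"
  shows "square_vcomp \<alpha> (square_id_h (STop \<alpha>)) = \<alpha>" "square_vcomp (square_id_h (SBot \<alpha>)) \<alpha> = \<alpha>"
    "square_hcomp (square_id_v (SLft \<alpha>)) \<alpha> = \<alpha>" "square_hcomp \<alpha> (square_id_v (SRgt \<alpha>)) = \<alpha>"
proof -
  note S = cell_square_simps[OF Sq_cell[OF assms]] cell_square_functorD[OF Sq_cell[OF assms], unfolded cell_square_simps(5-8)[OF Sq_cell[OF assms]]]
  note F = cell_squareD[OF Sq_cell[OF assms]]
  interpret A: category "Src (STop \<alpha>)" by (simp add: S)
  interpret D: category "Tgt (SRgt \<alpha>)" by (simp add: S)
  show "square_vcomp \<alpha> (square_id_h (STop \<alpha>)) = \<alpha>" "square_vcomp (square_id_h (SBot \<alpha>)) \<alpha> = \<alpha>"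
    "square_hcomp (square_id_v (SLft \<alpha>)) \<alpha> = \<alpha>" "square_hcomp \<alpha> (square_id_v (SRgt \<alpha>)) = \<alpha>"
    using F by (auto intro!: square_data_eqI simp: Tr_simps S D.cat_simps comp_functor_id_left
      comp_functor_id_right)
qed

lemma category_1:
  assumes "\<A> = \<V> \<or> \<A> = \<H>"
  shows "category \<lparr>Obj = \<O>, Arr = \<A>, Dom = Src, Cod = Tgt, Ident = id_functor, Comp = comp_functor\<rparr>"
  using assms
  by unfold_locales
    (auto simp: hom_def Ver_id Hor_id Ver_cell Hor_cell Ver_comp Hor_comp comp_functor_id_left
      comp_functor_id_right comp_functor_assoc)

lemma double_category_functor_squares: "double_category K"
proof (rule double_category.intro)
  show "category (Ver K)" "category (Hor K)"
    using category_1 by (simp_all add: functor_squares_def Let_def)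
  have *: "square_id_h f \<in> Sq K \<and> STop (square_id_h f) = f \<and> SBot (square_id_h f) = f"
     "square_id_v u \<in> Sq K \<and> SLft (square_id_v u) = u \<and> SRgt (square_id_v u) = u"
    if "f \<in> \<H>" "u \<in> \<V>" for f u using that Sq_id_h Sq_id_v by auto
  show "category (SqV K)"
  proof
    fix \<alpha> \<beta> f g h assume "\<alpha> \<in> hom (SqV K) f g" "\<beta> \<in> hom (SqV K) g h"
    then show "\<beta> \<odot>\<^bsub>SqV K\<^esub> \<alpha> \<in> hom (SqV K) f h"
      using Sq_vcomp by (auto simp: hom_def K_simps)
  next
    fix \<alpha> \<beta> \<gamma> f g h k assume "\<alpha> \<in> hom (SqV K) f g" "\<beta> \<in> hom (SqV K) g h" "\<gamma> \<in> hom (SqV K) h k"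
    then show "\<gamma> \<odot>\<^bsub>SqV K\<^esub> (\<beta> \<odot>\<^bsub>SqV K\<^esub> \<alpha>) = (\<gamma> \<odot>\<^bsub>SqV K\<^esub> \<beta>) \<odot>\<^bsub>SqV K\<^esub> \<alpha>"
      using square_vcomp_assoc[of \<alpha> \<beta> \<gamma>] Sq_cell by (simp add: hom_def K_simps(13-23))
  qed (use * Sq_id_h square_id_vcomp in \<open>auto simp: hom_def K_simps\<close>)
  show "category (SqH K)"
  proof
    fix \<alpha> \<beta> f g h assume "\<alpha> \<in> hom (SqH K) f g" "\<beta> \<in> hom (SqH K) g h"
    then show "\<beta> \<odot>\<^bsub>SqH K\<^esub> \<alpha> \<in> hom (SqH K) f h"
      using Sq_hcomp by (auto simp: hom_def K_simps)
  next
    fix \<alpha> \<beta> \<gamma> f g h k assume "\<alpha> \<in> hom (SqH K) f g" "\<beta> \<in> hom (SqH K) g h" "\<gamma> \<in> hom (SqH K) h k"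
    then show "\<gamma> \<odot>\<^bsub>SqH K\<^esub> (\<beta> \<odot>\<^bsub>SqH K\<^esub> \<alpha>) = (\<gamma> \<odot>\<^bsub>SqH K\<^esub> \<beta>) \<odot>\<^bsub>SqH K\<^esub> \<alpha>"
      using square_hcomp_assoc[of \<alpha> \<beta> \<gamma>] Sq_cell by (simp add: hom_def K_simps(13-23))
  qed (use * Sq_id_v square_id_vcomp in \<open>auto simp: hom_def K_simps\<close>)
next
  fix \<alpha> \<beta> \<gamma> \<delta>
  assume "\<alpha> \<in> Sq K" "\<beta> \<in> Sq K" "\<gamma> \<in> Sq K" "\<delta> \<in> Sq K"
    "Lft K \<beta> = Rgt K \<alpha>" "Lft K \<delta> = Rgt K \<gamma>" "Top K \<gamma> = Bot K \<alpha>" "Top K \<delta> = Bot K \<beta>"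
  then show "vcomp K (hcomp K \<gamma> \<delta>) (hcomp K \<alpha> \<beta>) = hcomp K (vcomp K \<gamma> \<alpha>) (vcomp K \<delta> \<beta>)"
    using square_interchange[of \<alpha> \<beta> \<gamma> \<delta>] Sq_cell by (simp add: K_simps(13-23))
next
  fix a assume a: "a \<in> Obj (Ver K)"
  then interpret a: category a by (simp add: category K_simps)
  show "sqid_v K (vid K a) = sqid_h K (hid K a)"
    by (simp add: K_simps square_id_v_def square_id_h_def)
next
  fix u v a b c assume "u \<in> hom (Ver K) a b" "v \<in> hom (Ver K) b c"
  then have u: "u \<in> \<V>" "Src u = a" "Tgt u = b" and v: "v \<in> \<V>" "Src v = b" "Tgt v = c"
    by (auto simp: hom_def K_simps)
  note S = cell_functorD[OF conjunct1[OF Ver_cell[OF u(1)]], unfolded u]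
    cell_functorD[OF conjunct1[OF Ver_cell[OF v(1)]], unfolded v]
  interpret c: category c by (rule S)
  interpret b: category b by (rule S)
  show "vcomp K (sqid_v K v) (sqid_v K u) = sqid_v K (v \<odot>\<^bsub>Ver K\<^esub> u)"
    by (rule square_data_eqI) (auto simp: K_simps u v Tr_simps S c.cat_simps)
next
  fix f g a b c assume "f \<in> hom (Hor K) a b" "g \<in> hom (Hor K) b c"
  then have u: "f \<in> \<H>" "Src f = a" "Tgt f = b" and v: "g \<in> \<H>" "Src g = b" "Tgt g = c"
    by (auto simp: hom_def K_simps)
  note S = cell_functorD[OF conjunct1[OF Hor_cell[OF u(1)]], unfolded u]
    cell_functorD[OF conjunct1[OF Hor_cell[OF v(1)]], unfolded v]
  interpret c: category c by (rule S)
  interpret b: category b by (rule S)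
  show "hcomp K (sqid_h K f) (sqid_h K g) = sqid_h K (g \<odot>\<^bsub>Hor K\<^esub> f)"
    by (rule square_data_eqI) (auto simp: K_simps u v Tr_simps S c.cat_simps)
qed (auto simp: K_simps(1-23) dest!: Sq_cell dest: cell_square_simps)

end

section \<open>The double category \<open>Cat\<close> and its invertible globular cells\<close>

lemma functor_square_closure_cells:
  "functor_square_closure {C. category C} {F. is_functor_cell F} {F. is_functor_cell F}"
  by (rule functor_square_closure.intro) (auto intro: is_functor_cell_id is_functor_cell_comp dest: cell_functorD)

lemma double_category_Cat: "double_category Cat"
  unfolding Cat_def
  by (rule functor_square_closure.double_category_functor_squares[OF functor_square_closure_cells])

lemmas Cat_simps = functor_square_closure.K_simps[where ?'z = unit, OF functor_square_closure_cells,
    folded Cat_def]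

lemma Sq_Cat: "\<alpha> \<in> Sq Cat \<longleftrightarrow> is_cell_square \<alpha>"
  by (auto simp: Cat_simps is_cell_square_def)

lemma is_natural_inverse:
  assumes nat: "is_natural A B Fo Fa Go Ga t" and F: "is_functor A B Fo Fa" and G: "is_functor A B Go Ga"
    and inv: "\<And>x. x \<in> Obj A \<Longrightarrow> inverse_arrows B (t x) (s x)"
  shows "is_natural A B Go Ga Fo Fa s"
proof -
  interpret A: category A using is_functorD(1)[OF F] .
  interpret B: category B using is_functorD(2)[OF F] .
  note S = A.cat_simps is_functorD(3-6)[OF F] is_functorD(3-6)[OF G] is_naturalD(1-3)[OF nat]
  have s: "s x \<in> Arr B" "Dom B (s x) = Go x" "Cod B (s x) = Fo x" if "x \<in> Obj A" for x
    using B.inverse_arrowsD[OF inv[OF that]] that by (simp_all add: S)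
  have "s (Cod A f) \<odot>\<^bsub>B\<^esub> Ga f = Fa f \<odot>\<^bsub>B\<^esub> s (Dom A f)" if f: "f \<in> Arr A" for f
  proof -
    have "s (Cod A f) \<odot>\<^bsub>B\<^esub> Ga f = s (Cod A f) \<odot>\<^bsub>B\<^esub> ((Ga f \<odot>\<^bsub>B\<^esub> t (Dom A f)) \<odot>\<^bsub>B\<^esub> s (Dom A f))"
      using f B.Comp_inverse[OF inv[of "Dom A f"], of "Fa f"]
        B.Comp_inverse[OF inv[of "Dom A f"], of "Ga f"] by (simp add: S)
    also have "\<dots> = s (Cod A f) \<odot>\<^bsub>B\<^esub> (t (Cod A f) \<odot>\<^bsub>B\<^esub> (Fa f \<odot>\<^bsub>B\<^esub> s (Dom A f)))"
      using f by (simp add: S s B.assoc flip: is_naturalD(4)[OF nat])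
    also have "\<dots> = Fa f \<odot>\<^bsub>B\<^esub> s (Dom A f)"
      using f by (intro B.inverse_Comp[OF inv]) (simp_all add: S s B.Comp_Arr)
    finally show ?thesis .
  qed
  then show ?thesis by (simp add: is_natural_def hom_def s)
qed

text \<open>An h-globular square is an ordinary transformation from its top to its bottom, so
  objectwise inverses suffice. The inverse is displayed because the identity axioms of a double
  pseudofunctor refer to it.\<close>

lemma h_globular_invertible:
  assumes \<alpha>: "is_cell_square \<alpha>"
    and id: "SLft \<alpha> = id_functor A" "SRgt \<alpha> = id_functor B"
    and inv: "\<And>x. x \<in> Obj A \<Longrightarrow> inverse_arrows B (Tr \<alpha> x) (s x)"
  shows "inverse_arrows (SqV Cat) \<alpha> \<lparr>STop = SBot \<alpha>, SLft = id_functor A, SRgt = id_functor B,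
     SBot = STop \<alpha>, Tr = (\<lambda>x\<in>Obj A. s x)\<rparr>" (is "inverse_arrows _ \<alpha> ?\<beta>")
proof -
  note S = cell_square_simps[OF \<alpha>] cell_square_functorD[OF \<alpha>, unfolded cell_square_simps(5-8)[OF \<alpha>]]
  have ends: "Src (STop \<alpha>) = A" "Tgt (STop \<alpha>) = B" "Src (SBot \<alpha>) = A" "Tgt (SBot \<alpha>) = B"
    using S(5-8) id by auto
  note S = S[unfolded ends id id_functor_simps]
  note F = cell_squareD[OF \<alpha>]
  note G = cell_functorD[OF F(1), unfolded ends] cell_functorD[OF F(2), unfolded ends]
  interpret A: category A using S by simp
  interpret B: category B using S by simp
  have inv': "s x \<odot>\<^bsub>B\<^esub> Tr \<alpha> x = Ident B (FO (STop \<alpha>) x)" "Tr \<alpha> x \<odot>\<^bsub>B\<^esub> s x = Ident B (FO (SBot \<alpha>) x)"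
    "s x \<in> Arr B"
    if "x \<in> Obj A" for x
    using B.inverse_arrowsD[OF inv[OF that]] S that by auto
  have t: "is_natural A B (FO (STop \<alpha>)) (FA (STop \<alpha>)) (FO (SBot \<alpha>)) (FA (SBot \<alpha>)) (Tr \<alpha>)"
    by (rule is_natural_cong[OF is_functor_squareD(5)[OF F(5)], unfolded ends id id_functor_simps])
      (use G A.category_axioms in simp_all)
  have s: "is_natural A B (FO (SBot \<alpha>)) (FA (SBot \<alpha>)) (FO (STop \<alpha>)) (FA (STop \<alpha>)) s"
    using is_natural_inverse[OF t] is_functor_cellD(1)[OF F(1)] is_functor_cellD(1)[OF F(2)] inv ends by simp
  have \<beta>: "is_cell_square ?\<beta>"
    using F id is_natural_cong[OF s A.category_axioms, of "FO (SRgt ?\<beta>) \<circ> FO (STop ?\<beta>)" "FA (SRgt ?\<beta>) \<circ> FA (STop ?\<beta>)"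
      "FO (SBot ?\<beta>) \<circ> FO (SLft ?\<beta>)" "FA (SBot ?\<beta>) \<circ> FA (SLft ?\<beta>)" "Tr ?\<beta>"]
    by (simp add: is_cell_square_def is_functor_square_def ends G o_def)
  show ?thesis
    unfolding inverse_arrows_def hom_def
  proof (intro conjI CollectI)
    show "?\<beta> \<odot>\<^bsub>SqV Cat\<^esub> \<alpha> = Ident (SqV Cat) (Dom (SqV Cat) \<alpha>)"
      "\<alpha> \<odot>\<^bsub>SqV Cat\<^esub> ?\<beta> = Ident (SqV Cat) (Cod (SqV Cat) \<alpha>)"
      by (rule square_data_eqI, use id F in \<open>auto simp: Cat_simps Tr_simps ends inv' G S(9-12)
        comp_functor_id_left is_functor_cell_id A.category_axioms B.category_axioms\<close>)+
  qed (use \<alpha> \<beta> in \<open>auto simp: Sq_Cat Cat_simps(13-23)\<close>)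
qed

text \<open>Since a square is a map \<open>kf \<rightarrow> gh\<close>, a v-globular one is a
  transformation from its right side to its left side, and its inverse runs from left to
  right.\<close>

lemma v_globular_invertible:
  assumes \<alpha>: "is_cell_square \<alpha>"
    and id: "STop \<alpha> = id_functor A" "SBot \<alpha> = id_functor B"
    and inv: "\<And>x. x \<in> Obj A \<Longrightarrow> inverse_arrows B (Tr \<alpha> x) (s x)"
  shows "inverse_arrows (SqH Cat) \<alpha> \<lparr>STop = id_functor A, SLft = SRgt \<alpha>, SRgt = SLft \<alpha>,
     SBot = id_functor B, Tr = (\<lambda>x\<in>Obj A. s x)\<rparr>" (is "inverse_arrows _ \<alpha> ?\<beta>")
proof -
  note S = cell_square_simps[OF \<alpha>] cell_square_functorD[OF \<alpha>, unfolded cell_square_simps(5-8)[OF \<alpha>]]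
  have ends: "Src (SLft \<alpha>) = A" "Tgt (SLft \<alpha>) = B" "Src (SRgt \<alpha>) = A" "Tgt (SRgt \<alpha>) = B"
    using S(5-8) id by auto
  note S = S[unfolded ends id id_functor_simps]
  note F = cell_squareD[OF \<alpha>]
  note G = cell_functorD[OF F(3), unfolded ends] cell_functorD[OF F(4), unfolded ends]
  interpret A: category A using S by simp
  interpret B: category B using S by simp
  have inv': "s x \<odot>\<^bsub>B\<^esub> Tr \<alpha> x = Ident B (FO (SRgt \<alpha>) x)" "Tr \<alpha> x \<odot>\<^bsub>B\<^esub> s x = Ident B (FO (SLft \<alpha>) x)"
    "s x \<in> Arr B"
    if "x \<in> Obj A" for x
    using B.inverse_arrowsD[OF inv[OF that]] S that by auto
  have t: "is_natural A B (FO (SRgt \<alpha>)) (FA (SRgt \<alpha>)) (FO (SLft \<alpha>)) (FA (SLft \<alpha>)) (Tr \<alpha>)"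
    by (rule is_natural_cong[OF is_functor_squareD(5)[OF F(5)], unfolded ends id id_functor_simps])
      (use G A.category_axioms in simp_all)
  have s: "is_natural A B (FO (SLft \<alpha>)) (FA (SLft \<alpha>)) (FO (SRgt \<alpha>)) (FA (SRgt \<alpha>)) s"
    using is_natural_inverse[OF t] is_functor_cellD(1)[OF F(3)] is_functor_cellD(1)[OF F(4)] inv ends by simp
  have \<beta>: "is_cell_square ?\<beta>"
    using F id is_natural_cong[OF s A.category_axioms, of "FO (SRgt ?\<beta>) \<circ> FO (STop ?\<beta>)" "FA (SRgt ?\<beta>) \<circ> FA (STop ?\<beta>)"
      "FO (SBot ?\<beta>) \<circ> FO (SLft ?\<beta>)" "FA (SBot ?\<beta>) \<circ> FA (SLft ?\<beta>)" "Tr ?\<beta>"]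
    by (simp add: is_cell_square_def is_functor_square_def ends G o_def)
  show ?thesis
    unfolding inverse_arrows_def hom_def
  proof (intro conjI CollectI)
    show "?\<beta> \<odot>\<^bsub>SqH Cat\<^esub> \<alpha> = Ident (SqH Cat) (Dom (SqH Cat) \<alpha>)"
      "\<alpha> \<odot>\<^bsub>SqH Cat\<^esub> ?\<beta> = Ident (SqH Cat) (Cod (SqH Cat) \<alpha>)"
      by (rule square_data_eqI, use id F in \<open>auto simp: Cat_simps Tr_simps ends inv' G S(9-12)
        comp_functor_id_left is_functor_cell_id A.category_axioms B.category_axioms\<close>)+
  qed (use \<alpha> \<beta> in \<open>auto simp: Sq_Cat Cat_simps(13-23)\<close>)
qed

section \<open>Localization\<close>

text \<open>\<open>fwd M\<close> is the arrow part of the localization functor; for a weak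
  equivalence \<open>w\<close>, \<open>bwd M w\<close> is the formal inverse of
  \<open>fwd M w\<close>.\<close>

definition fwd :: "('o, 'm) model_data \<Rightarrow> 'm \<Rightarrow> ('o, 'm) loc_arrow" where
  "fwd M f = HoClass M (Dom M f) [Fwd f] (Cod M f)"

definition bwd :: "('o, 'm) model_data \<Rightarrow> 'm \<Rightarrow> ('o, 'm) loc_arrow" where
  "bwd M f = HoClass M (Cod M f) [Bwd f] (Dom M f)"

locale homotopical_category = category M for M :: "('o, 'm) model_data" (structure) +
  assumes Weq_Arr: "Weq M \<subseteq> Arr M"
begin

abbreviation zz where "zz \<equiv> zigzag M (Weq M)"
abbreviation zzeq where "zzeq \<equiv> zigzag_eq M (Weq M)"

lemma zigzag_Obj: "zz x p y \<Longrightarrow> x \<in> Obj M \<and> y \<in> Obj M"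
  by (induction rule: zigzag.induct) (auto simp: hom_def dest: Dom_Obj Cod_Obj)

lemma zigzag_append: "zz x p y \<Longrightarrow> zz y q z \<Longrightarrow> zz x (p @ q) z"
  by (induction rule: zigzag.induct) (auto intro: zigzag.intros)

lemma zigzag_fwd: "f \<in> Arr M \<Longrightarrow> zz (Dom M f) [Fwd f] (Cod M f)"
  by (auto intro!: zigzag.intros simp: hom_def Cod_Obj)

lemma zigzag_bwd: "f \<in> Weq M \<Longrightarrow> zz (Cod M f) [Bwd f] (Dom M f)"
  using Weq_Arr by (auto intro!: zigzag.intros simp: hom_def Dom_Obj subset_eq)

lemma HoClass_mem: "(x', q, y') \<in> HoClass M x p y \<longleftrightarrow> x' = x \<and> y' = y \<and> zzeq x p q y"
  by (auto simp: HoClass_def loc_class_def)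

lemma HoClass_eqI: "zzeq x p q y \<Longrightarrow> HoClass M x p y = HoClass M x q y"
  by (auto simp: HoClass_def loc_class_def intro: zigzag_eq.sym zigzag_eq.trans)

lemma Obj_HoCat [simp]: "Obj (HoCat M) = Obj M"
  by (simp add: HoCat_def localization_def)

lemma HoClass_Arr: "zz x p y \<Longrightarrow> HoClass M x p y \<in> Arr (HoCat M)"
  by (auto simp: HoCat_def localization_def HoClass_def)

lemma HoClass_Dom: "zz x p y \<Longrightarrow> Dom (HoCat M) (HoClass M x p y) = x"
  and HoClass_Cod: "zz x p y \<Longrightarrow> Cod (HoCat M) (HoClass M x p y) = y"
  using zigzag_eq.refl[of M "Weq M" x p y] by (auto simp: HoCat_def localization_def HoClass_mem)

lemma Ident_HoCat: "Ident (HoCat M) x = HoClass M x [] x"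
  by (auto simp: HoCat_def localization_def HoClass_def)

text \<open>Equivalence of zigzags is compatible with concatenation, so the union defining
  \<open>Comp\<close> runs over a single class.\<close>

lemma HoClass_Comp:
  assumes "zz x p y" "zz y q z"
  shows "HoClass M y q z \<odot>\<^bsub>HoCat M\<^esub> HoClass M x p y = HoClass M x (p @ q) z"
proof -
  have "HoClass M y q z \<odot>\<^bsub>HoCat M\<^esub> HoClass M x p y =
    \<Union>{HoClass M x (p' @ q') z | p' q'. zzeq x p p' y \<and> zzeq y q q' z}"
    unfolding HoCat_def localization_def by (simp add: HoClass_mem flip: HoClass_def)
  also have "{HoClass M x (p' @ q') z | p' q'. zzeq x p p' y \<and> zzeq y q q' z} = {HoClass M x (p @ q) z}"
    using zigzag_eq.refl[OF assms(1)] zigzag_eq.refl[OF assms(2)]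
      HoClass_eqI[OF zigzag_eq.append] by blast
  finally show ?thesis by simp
qed

lemma Arr_HoCatE:
  assumes "X \<in> Arr (HoCat M)"
  obtains x p y where "zz x p y" "X = HoClass M x p y"
  using assms by (auto simp: HoCat_def localization_def HoClass_def)

lemma category_HoCat: "category (HoCat M)"
proof
  fix X x y Y z assume X: "X \<in> hom (HoCat M) x y" and Y: "Y \<in> hom (HoCat M) y z"
  obtain p where p: "X = HoClass M x p y" "zz x p y"
    using X by (auto simp: hom_def HoClass_Dom HoClass_Cod elim!: Arr_HoCatE)
  obtain q where q: "Y = HoClass M y q z" "zz y q z"
    using Y by (auto simp: hom_def HoClass_Dom HoClass_Cod elim!: Arr_HoCatE)
  show "Y \<odot>\<^bsub>HoCat M\<^esub> X \<in> hom (HoCat M) x z"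
    using p q zigzag_append[OF p(2) q(2)]
    by (simp add: hom_def HoClass_Dom HoClass_Cod HoClass_Arr HoClass_Comp)
next
  fix X Y Z w x y z
  assume X: "X \<in> hom (HoCat M) w x" and Y: "Y \<in> hom (HoCat M) x y" and Z: "Z \<in> hom (HoCat M) y z"
  obtain p where p: "X = HoClass M w p x" "zz w p x"
    using X by (auto simp: hom_def HoClass_Dom HoClass_Cod elim!: Arr_HoCatE)
  obtain q where q: "Y = HoClass M x q y" "zz x q y"
    using Y by (auto simp: hom_def HoClass_Dom HoClass_Cod elim!: Arr_HoCatE)
  obtain r where r: "Z = HoClass M y r z" "zz y r z"
    using Z by (auto simp: hom_def HoClass_Dom HoClass_Cod elim!: Arr_HoCatE)
  show "Z \<odot>\<^bsub>HoCat M\<^esub> (Y \<odot>\<^bsub>HoCat M\<^esub> X) = (Z \<odot>\<^bsub>HoCat M\<^esub> Y) \<odot>\<^bsub>HoCat M\<^esub> X"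
    using p q r zigzag_append[OF p(2) q(2)] zigzag_append[OF q(2) r(2)] by (simp add: HoClass_Comp)
qed (auto elim!: Arr_HoCatE simp: HoClass_Dom HoClass_Cod HoClass_Arr Ident_HoCat hom_def zigzag.nil
  HoClass_Comp zigzag_Obj)

sublocale Ho: category "HoCat M" by (rule category_HoCat)

lemma fwd_simps:
  assumes "f \<in> Arr M"
  shows "fwd M f \<in> Arr (HoCat M)" "Dom (HoCat M) (fwd M f) = Dom M f" "Cod (HoCat M) (fwd M f) = Cod M f"
  using zigzag_fwd[OF assms] by (simp_all add: fwd_def HoClass_Arr HoClass_Dom HoClass_Cod)

lemma bwd_simps:
  assumes "f \<in> Weq M"
  shows "bwd M f \<in> Arr (HoCat M)" "Dom (HoCat M) (bwd M f) = Cod M f" "Cod (HoCat M) (bwd M f) = Dom M f"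
  using zigzag_bwd[OF assms] by (simp_all add: bwd_def HoClass_Arr HoClass_Dom HoClass_Cod)

lemma fwd_Comp:
  assumes "f \<in> Arr M" "g \<in> Arr M" "Dom M g = Cod M f"
  shows "fwd M (g \<odot> f) = fwd M g \<odot>\<^bsub>HoCat M\<^esub> fwd M f"
  using zigzag_fwd[OF assms(1)] zigzag_fwd[OF assms(2)] assms
    HoClass_eqI[OF zigzag_eq.comp[of f M "Dom M f" "Cod M f" g "Cod M g" "Weq M"]]
  by (simp add: fwd_def HoClass_Comp Comp_Arr hom_def)

lemma fwd_bwd_inverse:
  assumes "w \<in> Weq M"
  shows "inverse_arrows (HoCat M) (fwd M w) (bwd M w)"
proof -
  have w: "w \<in> Arr M" using assms Weq_Arr by auto
  show ?thesis
    using zigzag_fwd[OF w] zigzag_bwd[OF assms] fwd_simps[OF w] bwd_simps[OF assms]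
      HoClass_eqI[OF zigzag_eq.fwd_bwd[of w "Weq M" M "Dom M w" "Cod M w"]]
      HoClass_eqI[OF zigzag_eq.bwd_fwd[of w "Weq M" M "Dom M w" "Cod M w"]] assms w
    by (simp add: inverse_arrows_def hom_def) (simp add: fwd_def bwd_def HoClass_Comp Ident_HoCat hom_def)
qed

lemma bwd_fwd_inverse: "w \<in> Weq M \<Longrightarrow> inverse_arrows (HoCat M) (bwd M w) (fwd M w)"
  using Ho.inverse_arrowsD[OF fwd_bwd_inverse] by (simp add: inverse_arrows_def hom_def)

lemma bwd_Comp:
  assumes "f \<in> Weq M" "g \<in> Weq M" "g \<odot> f \<in> Weq M" "Dom M g = Cod M f"
  shows "bwd M (g \<odot> f) = bwd M f \<odot>\<^bsub>HoCat M\<^esub> bwd M g"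
proof (rule Ho.inverse_unique[OF fwd_bwd_inverse[OF assms(3)]])
  have Arr: "f \<in> Arr M" "g \<in> Arr M" using assms Weq_Arr by auto
  note S = fwd_simps bwd_simps assms Arr Comp_Arr fwd_Comp Ho.cat_simps
  note I = Ho.inverse_arrowsD[OF fwd_bwd_inverse]
  have "fwd M g \<odot>\<^bsub>HoCat M\<^esub> (fwd M f \<odot>\<^bsub>HoCat M\<^esub> (bwd M f \<odot>\<^bsub>HoCat M\<^esub> bwd M g)) = Ident (HoCat M) (Cod M g)"
    using Ho.inverse_Comp[OF bwd_fwd_inverse[OF assms(1)], of "bwd M g"] I(6)[OF assms(2)] by (simp add: S)
  moreover have "bwd M f \<odot>\<^bsub>HoCat M\<^esub> (bwd M g \<odot>\<^bsub>HoCat M\<^esub> (fwd M g \<odot>\<^bsub>HoCat M\<^esub> fwd M f)) = Ident (HoCat M) (Dom M f)"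
    using Ho.inverse_Comp[OF fwd_bwd_inverse[OF assms(2)], of "fwd M f"] I(5)[OF assms(1)] by (simp add: S)
  ultimately show "inverse_arrows (HoCat M) (fwd M (g \<odot> f)) (bwd M f \<odot>\<^bsub>HoCat M\<^esub> bwd M g)"
    by (simp add: inverse_arrows_def hom_def S)
qed

text \<open>Reversing two opposite sides of a commutative square. This makes the backward arrows of
  a zigzag natural, given a naturality square in the model category.\<close>

lemma bwd_square:
  assumes "w \<in> Weq M" "w' \<in> Weq M" "a \<in> Arr M" "b \<in> Arr M" "Dom M a = Dom M w" "Cod M a = Dom M w'"
    "Dom M b = Cod M w" "Cod M b = Cod M w'" and eq: "w' \<odot> a = b \<odot> w"
  shows "bwd M w' \<odot>\<^bsub>HoCat M\<^esub> fwd M b = fwd M a \<odot>\<^bsub>HoCat M\<^esub> bwd M w"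
proof -
  have Arr: "w \<in> Arr M" "w' \<in> Arr M" using assms Weq_Arr by auto
  note S = fwd_simps bwd_simps assms(1-8) Arr
  have "fwd M w' \<odot>\<^bsub>HoCat M\<^esub> fwd M a = fwd M b \<odot>\<^bsub>HoCat M\<^esub> fwd M w"
    using eq fwd_Comp[of a w'] fwd_Comp[of w b] by (simp add: S)
  then have "bwd M w' \<odot>\<^bsub>HoCat M\<^esub> ((fwd M b \<odot>\<^bsub>HoCat M\<^esub> fwd M w) \<odot>\<^bsub>HoCat M\<^esub> bwd M w) =
    (bwd M w' \<odot>\<^bsub>HoCat M\<^esub> (fwd M w' \<odot>\<^bsub>HoCat M\<^esub> fwd M a)) \<odot>\<^bsub>HoCat M\<^esub> bwd M w"
    by (simp add: S Ho.cat_simps)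
  then show ?thesis
    using Ho.Comp_inverse[OF fwd_bwd_inverse[OF assms(1)], of "fwd M b"]
      Ho.inverse_Comp[OF fwd_bwd_inverse[OF assms(2)], of "fwd M a"] by (simp add: S)
qed

lemma HoClass_Cons:
  "f \<in> Arr M \<Longrightarrow> Dom M f = x \<Longrightarrow> zz (Cod M f) p y \<Longrightarrow>
     HoClass M x (Fwd f # p) y = HoClass M (Cod M f) p y \<odot>\<^bsub>HoCat M\<^esub> fwd M f"
  "w \<in> Weq M \<Longrightarrow> Cod M w = x \<Longrightarrow> zz (Dom M w) p y \<Longrightarrow>
     HoClass M x (Bwd w # p) y = HoClass M (Dom M w) p y \<odot>\<^bsub>HoCat M\<^esub> bwd M w"
  using HoClass_Comp[OF zigzag_fwd[of f]] HoClass_Comp[OF zigzag_bwd[of w]] by (auto simp: fwd_def bwd_def)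

text \<open>A class is the composite of the classes of the letters of any zigzag representing it, so
  the induction runs along the zigzag.\<close>

lemma HoCat_induct [consumes 1, case_names Ident fwd bwd Comp]:
  assumes "X \<in> Arr (HoCat M)"
    and "\<And>x. x \<in> Obj M \<Longrightarrow> P (Ident (HoCat M) x)"
    and "\<And>f. f \<in> Arr M \<Longrightarrow> P (fwd M f)"
    and "\<And>w. w \<in> Weq M \<Longrightarrow> P (bwd M w)"
    and "\<And>X Y. X \<in> Arr (HoCat M) \<Longrightarrow> Y \<in> Arr (HoCat M) \<Longrightarrow> Dom (HoCat M) Y = Cod (HoCat M) X \<Longrightarrow>
      P X \<Longrightarrow> P Y \<Longrightarrow> P (Y \<odot>\<^bsub>HoCat M\<^esub> X)"
  shows "P X"
proof -
  have "P (HoClass M x p y)" if "zz x p y" for x p y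
    using that
  proof (induction rule: zigzag.induct)
    case (nil x) then show ?case using assms(2) by (simp add: Ident_HoCat)
  next
    case (fwd f x y p z)
    then show ?case
      using assms(3)[of f] assms(5)[of "fwd M f" "HoClass M y p z"]
      by (simp add: HoClass_Cons fwd_simps HoClass_Arr HoClass_Dom hom_def)
  next
    case (bwd f y x p z)
    then show ?case
      using assms(4)[of f] assms(5)[of "bwd M f" "HoClass M y p z"]
      by (simp add: HoClass_Cons bwd_simps HoClass_Arr HoClass_Dom hom_def)
  qed
  then show ?thesis using assms(1) by (auto elim!: Arr_HoCatE)
qed

text \<open>Since the inverse of an arrow along which \<open>t\<close> is natural has the same property, naturality has
  to be checked on the arrows of \<open>M\<close> only.\<close>

lemma is_natural_HoCatI:
  assumes F: "is_functor (HoCat M) D Fo Fa" and G: "is_functor (HoCat M) D Go Ga"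
    and t: "\<And>x. x \<in> Obj M \<Longrightarrow> t x \<in> Arr D" "\<And>x. x \<in> Obj M \<Longrightarrow> Dom D (t x) = Fo x"
      "\<And>x. x \<in> Obj M \<Longrightarrow> Cod D (t x) = Go x"
    and nat: "\<And>f. f \<in> Arr M \<Longrightarrow> t (Cod M f) \<odot>\<^bsub>D\<^esub> Fa (fwd M f) = Ga (fwd M f) \<odot>\<^bsub>D\<^esub> t (Dom M f)"
  shows "is_natural (HoCat M) D Fo Fa Go Ga t"
proof -
  interpret D: category D using is_functorD(2)[OF F] .
  note S = cat_simps Ho.cat_simps[unfolded Obj_HoCat] is_functorD[OF F, unfolded Obj_HoCat]
    is_functorD[OF G, unfolded Obj_HoCat] t
  have "t (Cod (HoCat M) X) \<odot>\<^bsub>D\<^esub> Fa X = Ga X \<odot>\<^bsub>D\<^esub> t (Dom (HoCat M) X)" if "X \<in> Arr (HoCat M)" for X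
    using that
  proof (induction rule: HoCat_induct)
    case (Ident x) then show ?case by (simp add: S D.cat_simps)
  next
    case (fwd f) then show ?case by (simp add: nat fwd_simps)
  next
    case (bwd w)
    then have w: "w \<in> Arr M" using Weq_Arr by auto
    note B = bwd_simps[OF bwd] fwd_simps[OF w]
    have F': "Fa (fwd M w) \<odot>\<^bsub>D\<^esub> Fa (bwd M w) = Ident D (Fo (Cod M w))"
      using is_functorD(8)[OF F, of "bwd M w" "fwd M w"] Ho.inverse_arrowsD(6)[OF fwd_bwd_inverse[OF bwd]] w
      by (simp add: B S)
    have "Ga (bwd M w) \<odot>\<^bsub>D\<^esub> Ga (fwd M w) = Ident D (Go (Dom M w))"
      using is_functorD(8)[OF G, of "fwd M w" "bwd M w"] Ho.inverse_arrowsD(5)[OF fwd_bwd_inverse[OF bwd]] w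
      by (simp add: B S)
    then have "t (Dom M w) \<odot>\<^bsub>D\<^esub> Fa (bwd M w) = (Ga (bwd M w) \<odot>\<^bsub>D\<^esub> Ga (fwd M w)) \<odot>\<^bsub>D\<^esub> (t (Dom M w) \<odot>\<^bsub>D\<^esub> Fa (bwd M w))"
      using w by (simp add: B S D.cat_simps)
    also have "\<dots> = Ga (bwd M w) \<odot>\<^bsub>D\<^esub> (t (Cod M w) \<odot>\<^bsub>D\<^esub> (Fa (fwd M w) \<odot>\<^bsub>D\<^esub> Fa (bwd M w)))"
      using w D.reassoc[OF nat[OF w, symmetric], of "Fa (bwd M w)"] by (simp add: B S D.Comp_Arr D.assoc)
    also have "\<dots> = Ga (bwd M w) \<odot>\<^bsub>D\<^esub> t (Cod M w)"
      using w by (simp add: F' B S D.cat_simps)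
    finally show ?case by (simp add: B)
  next
    case (Comp X Y)
    have "t (Cod (HoCat M) Y) \<odot>\<^bsub>D\<^esub> (Fa Y \<odot>\<^bsub>D\<^esub> Fa X) = Ga Y \<odot>\<^bsub>D\<^esub> (Ga X \<odot>\<^bsub>D\<^esub> t (Dom (HoCat M) X))"
      using Comp D.reassoc[OF Comp(5), of "Fa X"] by (simp add: S D.cat_simps)
    then show ?case using Comp by (simp add: S D.cat_simps)
  qed
  then show ?thesis by (simp add: is_natural_def hom_def t)
qed

end

section \<open>Functors induced on localizations\<close>

locale homotopical_functor =
  M: homotopical_category M + N: homotopical_category N for M N :: "('o, 'm) model_data" +
  fixes Fo :: "'o \<Rightarrow> 'o" and Fa :: "'m \<Rightarrow> 'm"
  assumes is_functor: "is_functor M N Fo Fa"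
    and Fa_Weq: "w \<in> Weq M \<Longrightarrow> Fa w \<in> Weq N"
begin

lemma zigzag_map: "M.zz x p y \<Longrightarrow> N.zz (Fo x) (map (map_zig Fa) p) (Fo y)"
  by (induction rule: zigzag.induct)
    (use is_functorD[OF is_functor] in \<open>auto intro!: zigzag.intros Fa_Weq simp: hom_def\<close>)

lemma zigzag_eq_map: "M.zzeq x p q y \<Longrightarrow> N.zzeq (Fo x) (map (map_zig Fa) p) (map (map_zig Fa) q) (Fo y)"
proof (induction rule: zigzag_eq.induct)
  case (ident x)
  then show ?case using zigzag_eq.ident[of "Fo x" N] is_functorD[OF is_functor] by simp
next
  case (comp f x y g z)
  then show ?case using zigzag_eq.comp[of "Fa f" N "Fo x" "Fo y" "Fa g" "Fo z"] is_functorD[OF is_functor]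
    by (simp add: hom_def)
qed (use is_functorD[OF is_functor] in \<open>auto intro: zigzag_eq.intros zigzag_map Fa_Weq simp: hom_def\<close>)

lemma HoInduced_simps:
  "Src (HoInduced M N Fo Fa) = HoCat M" "Tgt (HoInduced M N Fo Fa) = HoCat N"
  "x \<in> Obj M \<Longrightarrow> FO (HoInduced M N Fo Fa) x = Fo x"
  by (simp_all add: HoInduced_def)

lemma HoInduced_HoClass:
  assumes "M.zz x p y"
  shows "FA (HoInduced M N Fo Fa) (HoClass M x p y) = HoClass N (Fo x) (map (map_zig Fa) p) (Fo y)"
proof -
  have "{HoClass N (Fo x') (map (map_zig Fa) q) (Fo y') | x' q y'. (x', q, y') \<in> HoClass M x p y} =
    {HoClass N (Fo x) (map (map_zig Fa) p) (Fo y)}"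
    (is "?S = {?X}")
  proof
    show "?S \<subseteq> {?X}" using N.HoClass_eqI[OF zigzag_eq_map] by (simp add: M.HoClass_mem) blast
    show "{?X} \<subseteq> ?S" using zigzag_eq.refl[OF assms] by (auto simp: M.HoClass_mem)
  qed
  then show ?thesis
    using M.HoClass_Arr[OF assms] by (simp add: HoInduced_def)
qed

lemma HoInduced_fwd: "f \<in> Arr M \<Longrightarrow> FA (HoInduced M N Fo Fa) (fwd M f) = fwd N (Fa f)"
  and HoInduced_bwd: "w \<in> Weq M \<Longrightarrow> FA (HoInduced M N Fo Fa) (bwd M w) = bwd N (Fa w)"
  using HoInduced_HoClass[OF M.zigzag_fwd] HoInduced_HoClass[OF M.zigzag_bwd]
    is_functorD[OF is_functor] M.Weq_Arr
  by (auto simp: fwd_def bwd_def subset_eq)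

lemma is_functor_cell_HoInduced: "is_functor_cell (HoInduced M N Fo Fa)"
proof -
  let ?F = "HoInduced M N Fo Fa"
  have "is_functor (HoCat M) (HoCat N) (FO ?F) (FA ?F)"
    unfolding is_functor_def
  proof (intro conjI ballI impI M.category_HoCat N.category_HoCat)
    fix X Y assume "X \<in> Arr (HoCat M)" "Y \<in> Arr (HoCat M)" "Dom (HoCat M) Y = Cod (HoCat M) X"
    then obtain x p y q z where "M.zz x p y" "M.zz y q z" "X = HoClass M x p y" "Y = HoClass M y q z"
      by (auto elim!: M.Arr_HoCatE simp: M.HoClass_Dom M.HoClass_Cod)
    then show "FA ?F (Y \<odot>\<^bsub>HoCat M\<^esub> X) = FA ?F Y \<odot>\<^bsub>HoCat N\<^esub> FA ?F X"
      by (simp add: M.HoClass_Comp HoInduced_HoClass M.zigzag_append N.HoClass_Comp zigzag_map)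
  qed (auto elim!: M.Arr_HoCatE simp: HoInduced_simps HoInduced_HoClass hom_def zigzag_map
      N.HoClass_Arr N.HoClass_Dom N.HoClass_Cod M.HoClass_Dom M.HoClass_Cod M.Ident_HoCat N.Ident_HoCat
      zigzag.nil is_functorD[OF is_functor] dest: M.zigzag_Obj intro!: HoInduced_simps(3)[symmetric])
  then show ?thesis by (simp add: is_functor_cell_def HoInduced_simps) (simp add: HoInduced_def)
qed

end

section \<open>Model categories\<close>

lemma op_cat_simps [simp]:
  "Obj (op_cat C) = Obj C" "Arr (op_cat C) = Arr C" "Dom (op_cat C) = Cod C" "Cod (op_cat C) = Dom C"
  "Ident (op_cat C) = Ident C" "Comp (op_cat C) = (\<lambda>g f. Comp C f g)"
  by (simp_all add: op_cat_def)

lemma hom_op_cat [simp]: "hom (op_cat C) x y = hom C y x"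
  by (auto simp: hom_def)

lemma category_op_cat: "category C \<Longrightarrow> category (op_cat C)"
  by (rule category.intro)
    (auto simp: category.Dom_Obj category.Cod_Obj category.Ident_hom category.Comp_Ident category.Ident_Comp
      intro: category.Comp_hom category.Comp_assoc[symmetric])

lemma terminal_exists:
  fixes C :: "('o, 'm, 'z) category_data_scheme" and \<kappa> :: "'s::infinite itself"
  assumes "has_small_limits \<kappa> C" "category C"
  shows "\<exists>x. is_terminal C x"
proof -
  \<comment> \<open>A cone over the empty diagram is just an object, so its limit is terminal; the
    diagram maps have nothing to act on and may be \<open>undefined\<close>.\<close>
  let ?I = "\<lparr>Obj = {}, Arr = {}, Dom = id, Cod = id, Ident = id, Comp = (\<lambda>g f. f)\<rparr> :: ('s, 's) category_data"
  have "is_functor ?I C undefined undefined" "Arr ?I \<prec> (UNIV :: 's set)"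
    using assms(2) by (auto simp: is_functor_def category_def hom_def infinite_UNIV finite_lesspoll_infinite)
  then obtain x p where "is_limit ?I C undefined undefined x p"
    using assms(1) unfolding has_small_limits_def by blast
  then show ?thesis by (intro exI[of _ x]) (simp add: is_limit_def is_cone_def is_terminal_def)
qed

lemma product_exists:
  fixes C :: "('o, 'm, 'z) category_data_scheme" and \<kappa> :: "'s::infinite itself"
  assumes "has_small_limits \<kappa> C" "category C" "x \<in> Obj C" "y \<in> Obj C"
  shows "\<exists>p \<pi>\<^sub>1 \<pi>\<^sub>2. \<pi>\<^sub>1 \<in> hom C p x \<and> \<pi>\<^sub>2 \<in> hom C p y \<and>
    (\<forall>z f g. f \<in> hom C z x \<and> g \<in> hom C z y \<longrightarrow> (\<exists>!h. h \<in> hom C z p \<and> \<pi>\<^sub>1 \<odot>\<^bsub>C\<^esub> h = f \<and> \<pi>\<^sub>2 \<odot>\<^bsub>C\<^esub> h = g))"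
proof -
  interpret category C by fact
  obtain i :: 's where True by simp
  have "infinite (UNIV :: 's set)" by (rule infinite_UNIV)
  then obtain j :: 's where ij: "i \<noteq> j"
    by (metis (full_types) UNIV_eq_I finite.emptyI finite.insertI insertI1)
  \<comment> \<open>The discrete category on two distinct elements of \<open>'s\<close>, each
    identity being identified with its object. It is finite, hence small because \<open>'s\<close>
    is infinite.\<close>
  let ?I = "\<lparr>Obj = {i, j}, Arr = {i, j}, Dom = id, Cod = id, Ident = id, Comp = (\<lambda>g f. f)\<rparr> :: ('s, 's) category_data"
  define Do where "Do = (\<lambda>k. if k = i then x else y)"
  have Do: "Do i = x" "Do j = y" using ij by (auto simp: Do_def)
  let ?Da = "\<lambda>k. Ident C (Do k)"
  have "is_functor ?I C Do ?Da" "Arr ?I \<prec> (UNIV :: 's set)"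
    using assms(2-) Ident_hom
    by (auto simp: is_functor_def category_def[of ?I] hom_def infinite_UNIV finite_lesspoll_infinite Do cat_simps)
  then obtain p \<pi> where p: "is_limit ?I C Do ?Da p \<pi>"
    using assms(1) unfolding has_small_limits_def by blast
  have cone: "is_cone ?I C Do ?Da z \<sigma> \<longleftrightarrow> z \<in> Obj C \<and> \<sigma> i \<in> hom C z x \<and> \<sigma> j \<in> hom C z y" for z \<sigma>
    using assms(3,4) by (auto simp: is_cone_def Do hom_def cat_simps)
  have "\<exists>!h. h \<in> hom C z p \<and> \<pi> i \<odot>\<^bsub>C\<^esub> h = f \<and> \<pi> j \<odot>\<^bsub>C\<^esub> h = g" if "f \<in> hom C z x" "g \<in> hom C z y" for z f g
  proof -
    have "z \<in> Obj C" using that(1) Dom_Obj by (auto simp: hom_def)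
    then have "is_cone ?I C Do ?Da z (\<lambda>k. if k = i then f else g)" using ij that by (simp add: cone)
    then have "\<exists>!h. h \<in> hom C z p \<and> (\<forall>k \<in> Obj ?I. \<pi> k \<odot>\<^bsub>C\<^esub> h = (if k = i then f else g))"
      using p unfolding is_limit_def by blast
    then show ?thesis using ij by auto
  qed
  moreover have "\<pi> i \<in> hom C p x" "\<pi> j \<in> hom C p y"
    using p by (auto simp: is_limit_def cone)
  ultimately show ?thesis by blast
qed

text \<open>A square \<open>(u, v)\<close> from \<open>f\<close> to \<open>g\<close> is, in the
  opposite category, a square \<open>(v, u)\<close> from \<open>g\<close> to \<open>f\<close>; this
  dictates the order of the arguments of \<open>FacM\<close>.\<close>

definition op_factorization :: "'m factorization \<Rightarrow> 'm factorization" where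
  "op_factorization E = \<lparr>FacL = FacR E, FacR = FacL E, FacM = (\<lambda>f g u v. FacM E g f v u)\<rparr>"

text \<open>The opposite model structure, through which \<open>R\<close>, fibrant objects and right
  Quillen functors inherit the facts proved for \<open>Q\<close>, cofibrant objects and left Quillen
  functors.\<close>

definition op_model :: "('o, 'm) model_data \<Rightarrow> ('o, 'm) model_data" where
  "op_model M = (op_cat M)\<lparr>Cof := Fib M, Fib := Cof M,
     CofFact := op_factorization (FibFact M), FibFact := op_factorization (CofFact M)\<rparr>"

lemma op_model_simps [simp]:
  "Obj (op_model M) = Obj M" "Arr (op_model M) = Arr M" "Dom (op_model M) = Cod M"
  "Cod (op_model M) = Dom M" "Ident (op_model M) = Ident M" "Comp (op_model M) = (\<lambda>g f. Comp M f g)"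
  "Weq (op_model M) = Weq M" "Cof (op_model M) = Fib M" "Fib (op_model M) = Cof M"
  "CofFact (op_model M) = op_factorization (FibFact M)"
  "FibFact (op_model M) = op_factorization (CofFact M)"
  by (simp_all add: op_model_def op_cat_def)

lemma op_factorization_simps [simp]:
  "FacL (op_factorization E) = FacR E" "FacR (op_factorization E) = FacL E"
  "FacM (op_factorization E) f g u v = FacM E g f v u"
  by (simp_all add: op_factorization_def)

lemma hom_op_model [simp]: "hom (op_model M) x y = hom M y x"
  by (auto simp: hom_def)

lemma arrow_square_op_model [simp]: "arrow_square (op_model M) f g u v \<longleftrightarrow> arrow_square M g f v u"
  by (auto simp: arrow_square_def)

lemma category_op_model: "category M \<Longrightarrow> category (op_model M)"
  by (rule category.intro)
    (auto simp: category.Dom_Obj category.Cod_Obj category.Ident_hom category.Comp_Ident category.Ident_Comp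
      intro: category.Comp_hom category.Comp_assoc[symmetric])

lemma is_retract_op_model: "is_retract (op_model M) f g \<longleftrightarrow> is_retract M f g"
  unfolding is_retract_def by auto

lemma has_lifting_op_model: "has_lifting (op_model M) i p \<longleftrightarrow> has_lifting M p i"
  unfolding has_lifting_def by auto

lemma functorial_factorization_op_model:
  "functorial_factorization M Ls Rs E \<Longrightarrow>
     functorial_factorization (op_model M) Rs Ls (op_factorization E)"
  unfolding functorial_factorization_def by auto

text \<open>\<open>op_cat M\<close> still carries the classes and factorizations of \<open>M\<close>
  as record fields, and \<open>op_model M\<close> carries others. The two are different records with
  the same underlying category, which is all that limits see.\<close>

lemma has_small_limits_cong:
  fixes C :: "('o, 'm, 'z) category_data_scheme" and D :: "('o, 'm, 'w) category_data_scheme"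
  assumes "Obj C = Obj D" "Arr C = Arr D" "Dom C = Dom D" "Cod C = Cod D" "Ident C = Ident D"
    "Comp C = Comp D"
  shows "has_small_limits \<kappa> C \<longleftrightarrow> has_small_limits \<kappa> D"
  unfolding has_small_limits_def is_functor_def is_limit_def is_cone_def category_def hom_def
  by (simp only: assms)

lemma (in model_category) model_category_op: "model_category \<kappa> (op_model M)"
proof (intro model_category.intro model_category_axioms.intro)
  show "category (op_model M)" by (rule category_op_model) (rule category_axioms)
  show "has_small_limits \<kappa> (op_model M)"
    using colimits has_small_limits_cong[of "op_cat M" "op_model M" \<kappa>] by (simp add: has_small_colimits_def)
  show "has_small_colimits \<kappa> (op_model M)"
    using limits has_small_limits_cong[of M "op_cat (op_model M)" \<kappa>] by (simp add: has_small_colimits_def)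
  show "functorial_factorization (op_model M) (Cof (op_model M)) (Fib (op_model M) \<inter> Weq (op_model M))
     (CofFact (op_model M))"
    "functorial_factorization (op_model M) (Cof (op_model M) \<inter> Weq (op_model M)) (Fib (op_model M))
     (FibFact (op_model M))"
    using functorial_factorization_op_model[OF CofFact] functorial_factorization_op_model[OF FibFact] by simp_all
  show "has_lifting (op_model M) i p"
    if "i \<in> Cof (op_model M)" "p \<in> Fib (op_model M)" "i \<in> Weq (op_model M) \<or> p \<in> Weq (op_model M)" for i p
    using that lifting by (auto simp: has_lifting_op_model)
qed (use Weq_Arr Cof_Arr Fib_Arr Weq_retract Fib_retract Cof_retract in
  \<open>auto simp: is_retract_op_model intro: two_of_three\<close>)

lemma is_initial_op_model: "is_initial (op_model M) x \<longleftrightarrow> is_terminal M x"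
  by (simp add: is_initial_def is_terminal_def)

lemma initial_object_op_model [simp]: "initial_object (op_model M) = terminal_object M"
  by (simp add: initial_object_def terminal_object_def is_initial_op_model)

lemma from_initial_op_model [simp]: "from_initial (op_model M) x = to_terminal M x"
  by (simp add: from_initial_def to_terminal_def)

lemma Q_op_model [simp]:
  "QA (op_model M) f = RA M f" "qmap (op_model M) x = rmap M x"
  by (simp_all add: QA_def RA_def qmap_def rmap_def)

definition cofibrant :: "('o, 'm) model_data \<Rightarrow> 'o \<Rightarrow> bool" where
  "cofibrant M x \<longleftrightarrow> x \<in> Obj M \<and> from_initial M x \<in> Cof M"

definition fibrant :: "('o, 'm) model_data \<Rightarrow> 'o \<Rightarrow> bool" where
  "fibrant M x \<longleftrightarrow> x \<in> Obj M \<and> to_terminal M x \<in> Fib M"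

lemma cofibrant_op_model [simp]: "cofibrant (op_model M) x \<longleftrightarrow> fibrant M x"
  by (simp add: cofibrant_def fibrant_def)

section \<open>Two-out-of-three, lifting and the initial object\<close>

context model_category
begin

lemma Cof_Arr' [simp]: "f \<in> Cof M \<Longrightarrow> f \<in> Arr M" using Cof_Arr by auto
lemma Fib_Arr' [simp]: "f \<in> Fib M \<Longrightarrow> f \<in> Arr M" using Fib_Arr by auto
lemma Weq_Arr' [simp]: "f \<in> Weq M \<Longrightarrow> f \<in> Arr M" using Weq_Arr by auto

lemma homotopical_category: "homotopical_category M"
  by unfold_locales (rule Weq_Arr)

lemma Weq_cancel_left: "f \<in> Arr M \<Longrightarrow> g \<in> Weq M \<Longrightarrow> Dom M g = Cod M f \<Longrightarrow> g \<odot> f \<in> Weq M \<Longrightarrow> f \<in> Weq M"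
  using two_of_three(3)[of f "Dom M f" "Cod M f" g "Cod M g"] by (simp add: hom_def)

lemma Weq_cancel_right: "f \<in> Weq M \<Longrightarrow> g \<in> Arr M \<Longrightarrow> Dom M g = Cod M f \<Longrightarrow> g \<odot> f \<in> Weq M \<Longrightarrow> g \<in> Weq M"
  using two_of_three(2)[of f "Dom M f" "Cod M f" g "Cod M g"] by (simp add: hom_def)

lemma Weq_Comp: "f \<in> Weq M \<Longrightarrow> g \<in> Weq M \<Longrightarrow> Dom M g = Cod M f \<Longrightarrow> g \<odot> f \<in> Weq M"
  using two_of_three(1)[of f "Dom M f" "Cod M f" g "Cod M g"] by (simp add: hom_def)

lemma CofFactD:
  assumes "f \<in> Arr M"
  shows "FacL (CofFact M) f \<in> Cof M" "FacR (CofFact M) f \<in> Fib M" "FacR (CofFact M) f \<in> Weq M"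
    "Dom M (FacL (CofFact M) f) = Dom M f" "Cod M (FacR (CofFact M) f) = Cod M f"
    "Dom M (FacR (CofFact M) f) = Cod M (FacL (CofFact M) f)"
    "FacR (CofFact M) f \<odot> FacL (CofFact M) f = f"
  using CofFact assms by (simp_all add: functorial_factorization_def)

text \<open>Factor the identity of \<open>x\<close>; the right factor \<open>p\<close> is a weak
  equivalence ending at \<open>x\<close>, and \<open>Ident M x \<odot> p = p\<close> forces the
  identity to be one by two-out-of-three.\<close>

lemma Weq_Ident: "x \<in> Obj M \<Longrightarrow> Ident M x \<in> Weq M"
  using CofFactD[OF Ident_Arr(1), of x] Ident_Arr[of x]
    Weq_cancel_right[of "FacR (CofFact M) (Ident M x)" "Ident M x"] by (simp add: cat_simps)

text \<open>The retract argument.\<close>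

lemma Cof_liftingI:
  assumes i: "i \<in> Arr M" and lift: "\<And>p. p \<in> Fib M \<Longrightarrow> p \<in> Weq M \<Longrightarrow> has_lifting M i p"
  shows "i \<in> Cof M"
proof -
  let ?j = "FacL (CofFact M) i" and ?p = "FacR (CofFact M) i"
  note E = CofFactD[OF i]
  have "arrow_square M i ?p ?j (Ident M (Cod M i))"
    using i E by (simp add: arrow_square_def hom_def cat_simps)
  then obtain l where l: "l \<in> hom M (Cod M i) (Dom M ?p)" "l \<odot> i = ?j" "?p \<odot> l = Ident M (Cod M i)"
    using lift[OF E(2,3)] unfolding has_lifting_def by blast
  have "is_retract M i ?j"
    unfolding is_retract_def arrow_square_def
    using i E l
    by (intro exI[of _ "Ident M (Dom M i)"] exI[of _ l] exI[of _ ?p])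
      (simp add: hom_def cat_simps)
  then show ?thesis using Cof_retract E(1) by blast
qed

text \<open>By the retract argument it is enough to lift against acyclic fibrations, first along
  \<open>f\<close> and then along \<open>g\<close>.\<close>

lemma Cof_Comp:
  assumes f: "f \<in> Cof M" and g: "g \<in> Cof M" and eq: "Dom M g = Cod M f"
  shows "g \<odot> f \<in> Cof M"
proof (rule Cof_liftingI)
  show "g \<odot> f \<in> Arr M" using assms by (simp add: cat_simps)
  fix p assume p: "p \<in> Fib M" "p \<in> Weq M"
  show "has_lifting M (g \<odot> f) p"
    unfolding has_lifting_def
  proof (intro allI impI)
    fix u v assume sq: "arrow_square M (g \<odot> f) p u v"
    then have "arrow_square M f p u (v \<odot> g)"
      using assms p by (simp add: arrow_square_def hom_def cat_simps)
    then obtain l where l: "l \<in> hom M (Cod M f) (Dom M p)" "l \<odot> f = u" "p \<odot> l = v \<odot> g"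
      using lifting[OF f p(1)] p unfolding has_lifting_def by blast
    then have "arrow_square M g p l v"
      using assms p sq by (simp add: arrow_square_def hom_def cat_simps)
    then obtain m where m: "m \<in> hom M (Cod M g) (Dom M p)" "m \<odot> g = l" "p \<odot> m = v"
      using lifting[OF g p(1)] p unfolding has_lifting_def by blast
    have "m \<odot> (g \<odot> f) = u"
      using assms l m assoc[of f g m] by (simp add: hom_def)
    then show "\<exists>l\<in>hom M (Cod M (g \<odot> f)) (Dom M p). l \<odot> (g \<odot> f) = u \<and> p \<odot> l = v"
      using assms m by (auto simp: cat_simps)
  qed
qed

lemma is_initial_initial_object: "is_initial M (initial_object M)"
proof -
  have "\<exists>x. is_terminal (op_cat M) x"
    using terminal_exists[OF colimits[unfolded has_small_colimits_def]] category_op_cat category_axioms by blast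
  then have "\<exists>x. is_initial M x"
    by (simp add: is_terminal_def is_initial_def)
  then show ?thesis unfolding initial_object_def by (rule someI_ex)
qed

lemma initial_Obj [simp]: "initial_object M \<in> Obj M"
  using is_initial_initial_object by (simp add: is_initial_def)

lemma from_initial:
  assumes "x \<in> Obj M"
  shows "from_initial M x \<in> Arr M" "Dom M (from_initial M x) = initial_object M" "Cod M (from_initial M x) = x"
proof -
  have "\<exists>!f. f \<in> hom M (initial_object M) x"
    using is_initial_initial_object assms by (simp add: is_initial_def)
  then have "from_initial M x \<in> hom M (initial_object M) x"
    unfolding from_initial_def by (rule theI')
  then show "from_initial M x \<in> Arr M" "Dom M (from_initial M x) = initial_object M" "Cod M (from_initial M x) = x"
    by (simp_all add: hom_def)
qed

lemma from_initial_unique: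
  assumes "f \<in> Arr M" "Dom M f = initial_object M" "Cod M f = x"
  shows "f = from_initial M x"
proof -
  have x: "x \<in> Obj M" using assms Cod_Obj by auto
  then have "\<exists>!f. f \<in> hom M (initial_object M) x"
    using is_initial_initial_object by (simp add: is_initial_def)
  then show ?thesis using assms from_initial[OF x] by (auto simp: hom_def)
qed

section \<open>Coproducts and Ken Brown's lemma\<close>

lemma coproduct_exists:
  assumes "x \<in> Obj M" "y \<in> Obj M"
  shows "\<exists>s i j. i \<in> hom M x s \<and> j \<in> hom M y s \<and>
    (\<forall>z f g. f \<in> hom M x z \<and> g \<in> hom M y z \<longrightarrow> (\<exists>!h. h \<in> hom M s z \<and> h \<odot> i = f \<and> h \<odot> j = g))"
  using product_exists[OF colimits[unfolded has_small_colimits_def] category_op_cat[OF category_axioms], of x y]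
    assms by simp

text \<open>The inclusion \<open>i\<close> is a pushout of the map from the initial object to
  \<open>y\<close>. A lift is given by \<open>u\<close> on the summand \<open>x\<close> and by
  cofibrancy on \<open>y\<close>; the lower triangle commutes by uniqueness in the universal
  property.\<close>

lemma Cof_coproduct_inclusion:
  assumes i: "i \<in> hom M x s" and j: "j \<in> hom M y s"
    and univ: "\<And>z f g. f \<in> hom M x z \<Longrightarrow> g \<in> hom M y z \<Longrightarrow> \<exists>!h. h \<in> hom M s z \<and> h \<odot> i = f \<and> h \<odot> j = g"
    and y: "cofibrant M y"
  shows "i \<in> Cof M"
proof (rule Cof_liftingI)
  show "i \<in> Arr M" using i by (simp add: hom_def)
  fix p assume p: "p \<in> Fib M" "p \<in> Weq M"
  have y0: "y \<in> Obj M" "from_initial M y \<in> Cof M" using y by (auto simp: cofibrant_def)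
  show "has_lifting M i p"
    unfolding has_lifting_def
  proof (intro allI impI)
    fix u v assume sq: "arrow_square M i p u v"
    then have uv: "u \<in> hom M x (Dom M p)" "v \<in> hom M s (Cod M p)" "v \<odot> i = p \<odot> u"
      using i by (auto simp: arrow_square_def hom_def)
    have a: "v \<odot> j \<in> hom M y (Cod M p)" using j uv(2) Comp_hom by blast
    have "arrow_square M (from_initial M y) p (from_initial M (Dom M p)) (v \<odot> j)"
      using y0 p a from_initial[OF y0(1)] from_initial[of "Dom M p"]
        from_initial_unique[of "(v \<odot> j) \<odot> from_initial M y" "Cod M p"]
        from_initial_unique[of "p \<odot> from_initial M (Dom M p)" "Cod M p"]
      by (simp add: arrow_square_def hom_def Comp_Arr Dom_Obj)
    then obtain l where l: "l \<in> hom M y (Dom M p)" "p \<odot> l = v \<odot> j"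
      using lifting[OF y0(2) p(1)] p from_initial[OF y0(1)] unfolding has_lifting_def by auto
    obtain m where m: "m \<in> hom M s (Dom M p)" "m \<odot> i = u" "m \<odot> j = l"
      using univ[OF uv(1) l(1)] by blast
    have "p \<odot> m = v"
    proof -
      have "\<exists>!h. h \<in> hom M s (Cod M p) \<and> h \<odot> i = v \<odot> i \<and> h \<odot> j = v \<odot> j"
        using univ[OF Comp_hom[OF i uv(2)] a] .
      moreover have "p \<odot> m \<in> hom M s (Cod M p)" "(p \<odot> m) \<odot> i = v \<odot> i" "(p \<odot> m) \<odot> j = v \<odot> j"
        using m l i j p uv by (auto simp: hom_def cat_simps)
      ultimately show ?thesis using uv(2) by blast
    qed
    then show "\<exists>l\<in>hom M (Cod M i) (Dom M p). l \<odot> i = u \<and> p \<odot> l = v"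
      using m i by (auto simp: hom_def)
  qed
qed

text \<open>Factor the map from the coproduct of domain and codomain that is \<open>w\<close> on one
  summand and the identity on the other, as a cofibration \<open>p\<close> followed by an acyclic
  fibration \<open>q\<close>. Both inclusions followed by \<open>p\<close> are acyclic cofibrations,
  and \<open>w\<close> is \<open>q\<close> after the first of them.\<close>

lemma ken_brown:
  assumes N: "model_category \<kappa>' N" and F: "is_functor M N Fo Fa"
    and AC: "\<And>f. f \<in> Cof M \<Longrightarrow> f \<in> Weq M \<Longrightarrow> Fa f \<in> Weq N"
    and w: "w \<in> Weq M" "cofibrant M (Dom M w)" "cofibrant M (Cod M w)"
  shows "Fa w \<in> Weq N"
proof -
  interpret N: model_category \<kappa>' N by fact
  note F = is_functorD[OF F]
  define x y where "x = Dom M w" and "y = Cod M w"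
  have xy: "x \<in> Obj M" "y \<in> Obj M" "w \<in> hom M x y" "cofibrant M x" "cofibrant M y"
    using w by (auto simp: x_def y_def cat_simps hom_def)
  obtain s i j where i: "i \<in> hom M x s" and j: "j \<in> hom M y s"
    and univ0: "\<forall>z f g. f \<in> hom M x z \<and> g \<in> hom M y z \<longrightarrow> (\<exists>!h. h \<in> hom M s z \<and> h \<odot> i = f \<and> h \<odot> j = g)"
    using coproduct_exists[OF xy(1,2)] by (elim exE conjE)
  have univ: "\<exists>!h. h \<in> hom M s z \<and> h \<odot> i = f \<and> h \<odot> j = g" if "f \<in> hom M x z" "g \<in> hom M y z" for z f g
    using univ0 that by blast
  have univ': "\<exists>!h. h \<in> hom M s z \<and> h \<odot> j = g \<and> h \<odot> i = f" if "g \<in> hom M y z" "f \<in> hom M x z" for z f g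
    using univ[OF that(2,1)] by metis
  have ij: "i \<in> Cof M" "j \<in> Cof M"
    using Cof_coproduct_inclusion[OF i j univ xy(5)] Cof_coproduct_inclusion[OF j i univ' xy(4)] by blast+
  obtain h where h: "h \<in> hom M s y" "h \<odot> i = w" "h \<odot> j = Ident M y"
    using univ[OF xy(3) Ident_hom[OF xy(2)]] by blast
  let ?p = "FacL (CofFact M) h" and ?q = "FacR (CofFact M) h"
  have hA: "h \<in> Arr M" "Dom M h = s" "Cod M h = y" using h by (auto simp: hom_def)
  note E = CofFactD[OF hA(1), unfolded hA]
  have iA: "i \<in> Arr M" "Dom M i = x" "Cod M i = s" and jA: "j \<in> Arr M" "Dom M j = y" "Cod M j = s"
    using i j by (auto simp: hom_def)
  have pi: "?p \<odot> i \<in> Cof M" and pj: "?p \<odot> j \<in> Cof M"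
    using ij E iA jA by (auto intro!: Cof_Comp)
  have qi: "?q \<odot> (?p \<odot> i) = w" and qj: "?q \<odot> (?p \<odot> j) = Ident M y"
    using h E iA jA assoc[of i ?p ?q] assoc[of j ?p ?q] by simp_all
  have Wi: "?p \<odot> i \<in> Weq M"
    using Weq_cancel_left[of "?p \<odot> i" ?q] qi w(1) E iA by (simp add: cat_simps)
  have Wj: "?p \<odot> j \<in> Weq M"
    using Weq_cancel_left[of "?p \<odot> j" ?q] qj Weq_Ident[OF xy(2)] E jA by (simp add: cat_simps)
  have FWi: "Fa (?p \<odot> i) \<in> Weq N" and FWj: "Fa (?p \<odot> j) \<in> Weq N"
    using AC pi Wi pj Wj by auto
  have Fq: "Fa ?q \<in> Arr N" "Dom N (Fa ?q) = Cod N (Fa (?p \<odot> i))" "Dom N (Fa ?q) = Cod N (Fa (?p \<odot> j))"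
    using F(4,5)[of ?q] F(6)[of "?p \<odot> i"] F(6)[of "?p \<odot> j"] E iA jA pi pj by (simp_all add: Comp_Arr)
  \<comment> \<open>Nothing is assumed about the image of an acyclic fibration; \<open>Fa ?q\<close>
    is a weak equivalence because it is a retraction of the weak equivalence
    \<open>Fa (?p \<odot> j)\<close>.\<close>
  have "Fa ?q \<odot>\<^bsub>N\<^esub> Fa (?p \<odot> j) = Ident N (Fo y)"
    using F(7)[OF xy(2)] F(8)[of "?p \<odot> j" ?q] qj E jA pj by (simp add: Comp_Arr)
  then have "Fa ?q \<in> Weq N"
    using N.Weq_cancel_right[OF FWj Fq(1,3)] N.Weq_Ident[OF F(3)[OF xy(2)]] by simp
  moreover have "Fa w = Fa ?q \<odot>\<^bsub>N\<^esub> Fa (?p \<odot> i)"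
    using F(8)[of "?p \<odot> i" ?q] qi E iA pi by (simp add: Comp_Arr)
  ultimately show ?thesis
    using N.Weq_Comp[OF FWi _ Fq(2)] by simp
qed

section \<open>Cofibrant and fibrant replacement\<close>

lemma qmap:
  assumes "x \<in> Obj M"
  shows "qmap M x \<in> Arr M" "qmap M x \<in> Fib M" "qmap M x \<in> Weq M" "Dom M (qmap M x) = QO M x"
    "Cod M (qmap M x) = x" "QO M x \<in> Obj M" "cofibrant M (QO M x)"
proof -
  note E = CofFactD[OF from_initial(1)[OF assms]] from_initial[OF assms]
  show *: "qmap M x \<in> Arr M" "qmap M x \<in> Fib M" "qmap M x \<in> Weq M" "Dom M (qmap M x) = QO M x"
    "Cod M (qmap M x) = x"
    using E by (simp_all add: qmap_def QO_def)
  show "QO M x \<in> Obj M" using * Dom_Obj[of "qmap M x"] by simp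
  then show "cofibrant M (QO M x)"
    \<comment> \<open>The left factor starts at the initial object, so it is the map that defines
      cofibrancy of \<open>QO M x\<close>.\<close>
    using E from_initial_unique[of "FacL (CofFact M) (from_initial M x)" "QO M x"]
    by (simp add: cofibrant_def QO_def)
qed

lemma from_initial_square:
  assumes "f \<in> Arr M"
  shows "arrow_square M (from_initial M (Dom M f)) (from_initial M (Cod M f)) (Ident M (initial_object M)) f"
proof -
  note D = from_initial[OF Dom_Obj[OF assms]] and C = from_initial[OF Cod_Obj[OF assms]]
  have "f \<odot> from_initial M (Dom M f) = from_initial M (Cod M f)"
    by (rule from_initial_unique) (use assms D in \<open>simp_all add: Comp_Arr\<close>)
  moreover have "from_initial M (Cod M f) \<odot> Ident M (initial_object M) = from_initial M (Cod M f)"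
    using C by (simp add: Comp_Ident_Dom)
  ultimately show ?thesis
    unfolding arrow_square_def hom_def using assms C D Ident_Arr[OF initial_Obj] by simp
qed

lemma QA:
  assumes "f \<in> Arr M"
  shows "QA M f \<in> Arr M" "Dom M (QA M f) = QO M (Dom M f)" "Cod M (QA M f) = QO M (Cod M f)"
    "qmap M (Cod M f) \<odot> QA M f = f \<odot> qmap M (Dom M f)"
proof -
  have "arrow_square M (FacL (CofFact M) (from_initial M (Dom M f))) (FacL (CofFact M) (from_initial M (Cod M f)))
      (Ident M (initial_object M)) (QA M f)"
    "arrow_square M (FacR (CofFact M) (from_initial M (Dom M f))) (FacR (CofFact M) (from_initial M (Cod M f)))
      (QA M f) f"
    using CofFact from_initial_square[OF assms] unfolding functorial_factorization_def QA_def by blast+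
  then show "QA M f \<in> Arr M" "Dom M (QA M f) = QO M (Dom M f)" "Cod M (QA M f) = QO M (Cod M f)"
    "qmap M (Cod M f) \<odot> QA M f = f \<odot> qmap M (Dom M f)"
    by (simp_all add: arrow_square_def hom_def QO_def qmap_def)
qed

lemma is_functor_Q: "is_functor M M (QO M) (QA M)"
proof -
  have id: "QA M (Ident M x) = Ident M (QO M x)" if "x \<in> Obj M" for x
  proof -
    have "FacM (CofFact M) (from_initial M x) (from_initial M x) (Ident M (Dom M (from_initial M x)))
      (Ident M (Cod M (from_initial M x))) = Ident M (Cod M (FacL (CofFact M) (from_initial M x)))"
      using CofFact from_initial[OF that] unfolding functorial_factorization_def by blast
    then show ?thesis using that from_initial[OF that] by (simp add: QA_def QO_def Ident_Arr)
  qed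
  have comp: "QA M (g \<odot> f) = QA M g \<odot> QA M f" if "f \<in> Arr M" "g \<in> Arr M" "Dom M g = Cod M f" for f g
  proof -
    let ?i = "Ident M (initial_object M)"
    have "FacM (CofFact M) (from_initial M (Dom M f)) (from_initial M (Cod M g)) (?i \<odot> ?i) (g \<odot> f) =
      FacM (CofFact M) (from_initial M (Cod M f)) (from_initial M (Cod M g)) ?i g \<odot>
      FacM (CofFact M) (from_initial M (Dom M f)) (from_initial M (Cod M f)) ?i f"
      using CofFact from_initial_square[OF that(1)] from_initial_square[OF that(2)] that(3)
      unfolding functorial_factorization_def by metis
    then show ?thesis using that by (simp add: QA_def cat_simps)
  qed
  show ?thesis
    using id comp QA qmap(6) category_axioms by (simp add: is_functor_def hom_def)
qed

text \<open>Two-out-of-three in the naturality square of \<pi> at \<open>w\<close>.\<close>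

lemma QA_Weq:
  assumes "w \<in> Weq M"
  shows "QA M w \<in> Weq M"
  using assms QA[OF Weq_Arr'[OF assms]] qmap[of "Cod M w"] qmap[of "Dom M w"] Weq_Comp[of "qmap M (Dom M w)" w]
    Weq_cancel_left[of "QA M w" "qmap M (Cod M w)"]
  by (simp add: cat_simps)

lemma fibrant_Fib:
  assumes "p \<in> Fib M" "fibrant M (Cod M p)"
  shows "fibrant M (Dom M p)"
proof -
  interpret op: model_category \<kappa> "op_model M" by (rule model_category_op)
  have "Cod M p \<in> Obj M" using assms by (simp add: cat_simps)
  then show ?thesis
    using op.Cof_Comp[of "to_terminal M (Cod M p)" p] assms op.from_initial[of "Cod M p"]
      op.from_initial_unique[of "to_terminal M (Cod M p) \<odot> p" "Dom M p"]
    by (simp add: fibrant_def cat_simps)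
qed

text \<open>Because \<pi> is a fibration, \<open>QRx\<close> is fibrant as well as
  cofibrant.\<close>

lemma fibrant_Q: "fibrant M x \<Longrightarrow> fibrant M (QO M x)"
  using fibrant_Fib[of "qmap M x"] qmap[of x] by (simp add: fibrant_def)

text \<open>Opposed, \<open>QO\<close> reads off the domain of the right factor, whereas
  \<open>RO\<close> is the codomain of the left factor. These agree by the factorization axiom,
  which speaks of arrows only; hence the restriction to objects \<open>x\<close> of
  \<open>M\<close>.\<close>

lemma QO_op_model:
  assumes "x \<in> Obj M"
  shows "QO (op_model M) x = RO M x"
proof -
  have "to_terminal M x \<in> Arr M"
    using model_category.from_initial(1)[OF model_category_op, of x] assms by simp
  then show ?thesis
    using FibFact by (simp add: QO_def RO_def functorial_factorization_def)
qed

lemma rmap: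
  assumes "x \<in> Obj M"
  shows "rmap M x \<in> Arr M" "rmap M x \<in> Cof M" "rmap M x \<in> Weq M" "Dom M (rmap M x) = x"
    "Cod M (rmap M x) = RO M x" "RO M x \<in> Obj M" "fibrant M (RO M x)"
  using model_category.qmap[OF model_category_op, of x] assms by (simp_all add: QO_op_model)

lemma RA:
  assumes "f \<in> Arr M"
  shows "RA M f \<in> Arr M" "Dom M (RA M f) = RO M (Dom M f)" "Cod M (RA M f) = RO M (Cod M f)"
    "rmap M (Cod M f) \<odot> f = RA M f \<odot> rmap M (Dom M f)"
  using model_category.QA[OF model_category_op, of f] assms by (simp_all add: QO_op_model cat_simps)

lemma RA_Weq: "w \<in> Weq M \<Longrightarrow> RA M w \<in> Weq M"
  using model_category.QA_Weq[OF model_category_op, of w] by simp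

lemma is_functor_R: "is_functor M M (RO M) (RA M)"
  using is_functorD[OF model_category.is_functor_Q[OF model_category_op]] category_axioms rmap(6) RA
  by (simp add: is_functor_def hom_def QO_op_model)

end

section \<open>Quillen functors\<close>

sublocale model_category \<subseteq> homotopical_category M
  by (rule homotopical_category)

section \<open>Comparing transformations out of the homotopy category\<close>

context model_category
begin

text \<open>Both functors send \<open>w\<close> to an isomorphism, so naturality at \<open>w\<close>
  expresses the component at either end through the one at the other end.\<close>

lemma natural_eq_transport:
  assumes F: "is_functor (HoCat M) D Fo Fa" and G: "is_functor (HoCat M) D Go Ga"
    and s: "is_natural (HoCat M) D Fo Fa Go Ga s" and t: "is_natural (HoCat M) D Fo Fa Go Ga t"
    and w: "w \<in> Weq M"
  shows "s (Dom M w) = t (Dom M w) \<longleftrightarrow> s (Cod M w) = t (Cod M w)"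
proof -
  interpret D: category D using is_functorD(2)[OF F] .
  note W = Weq_Arr'[OF w] fwd_simps[OF Weq_Arr'[OF w]] Dom_Obj[OF Weq_Arr'[OF w]] Cod_Obj[OF Weq_Arr'[OF w]]
  have inv: "inverse_arrows D (Ka (fwd M w)) (Ka (bwd M w))" if K: "is_functor (HoCat M) D Ko Ka" for Ko Ka
  proof -
    note I = Ho.inverse_arrowsD[OF fwd_bwd_inverse[OF w]]
    have "Ka (bwd M w) \<odot>\<^bsub>D\<^esub> Ka (fwd M w) = Ident D (Ko (Dom M w))"
      "Ka (fwd M w) \<odot>\<^bsub>D\<^esub> Ka (bwd M w) = Ident D (Ko (Cod M w))"
      using is_functorD(8)[OF K, of "fwd M w" "bwd M w"] is_functorD(8)[OF K, of "bwd M w" "fwd M w"]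
        is_functorD(7)[OF K] I W by simp_all
    then show ?thesis
      using is_functorD(4-6)[OF K] I W by (simp add: inverse_arrows_def hom_def)
  qed
  note S = is_functorD(3-6)[OF F, unfolded Obj_HoCat] is_functorD(3-6)[OF G, unfolded Obj_HoCat]
    is_naturalD(1-3)[OF s, unfolded Obj_HoCat] is_naturalD(1-3)[OF t, unfolded Obj_HoCat] W
  have n: "u (Cod M w) \<odot>\<^bsub>D\<^esub> Fa (fwd M w) = Ga (fwd M w) \<odot>\<^bsub>D\<^esub> u (Dom M w)"
    if "is_natural (HoCat M) D Fo Fa Go Ga u" for u
    using is_naturalD(4)[OF that W(2)] W(3,4) by simp
  show ?thesis
  proof
    assume "s (Dom M w) = t (Dom M w)"
    then have "s (Cod M w) \<odot>\<^bsub>D\<^esub> Fa (fwd M w) = t (Cod M w) \<odot>\<^bsub>D\<^esub> Fa (fwd M w)"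
      using n[OF s] n[OF t] by simp
    then show "s (Cod M w) = t (Cod M w)"
      by (rule D.cancel_right[OF inv[OF F], rotated -1]) (simp_all add: S)
  next
    assume "s (Cod M w) = t (Cod M w)"
    then have "Ga (fwd M w) \<odot>\<^bsub>D\<^esub> s (Dom M w) = Ga (fwd M w) \<odot>\<^bsub>D\<^esub> t (Dom M w)"
      using n[OF s] n[OF t] by simp
    then show "s (Dom M w) = t (Dom M w)"
      by (rule D.cancel_left[OF inv[OF G], rotated -1]) (simp_all add: S)
  qed
qed

text \<open>Every object \<open>x\<close> is connected to a bifibrant one by \<open>x \<rightarrow> Rx \<leftarrow> QRx\<close>.\<close>

lemma natural_eq_bifibrant:
  assumes "is_functor (HoCat M) D Fo Fa" "is_functor (HoCat M) D Go Ga"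
    and "is_natural (HoCat M) D Fo Fa Go Ga s" "is_natural (HoCat M) D Fo Fa Go Ga t"
    and eq: "\<And>y. cofibrant M y \<Longrightarrow> fibrant M y \<Longrightarrow> y \<in> Obj M \<Longrightarrow> s y = t y"
    and x: "x \<in> Obj M"
  shows "s x = t x"
proof -
  note T = natural_eq_transport[OF assms(1-4)]
  note R = rmap[OF x]
  note Q = qmap[OF R(6)]
  show ?thesis
    using T[OF R(3)] T[OF Q(3)] eq[of "QO M (RO M x)"] R Q fibrant_Q[OF R(7)] by simp
qed

end

lemmas (in model_category) model_simps = cat_simps qmap(1,3-6) rmap(1,3-6) QA(1-3) RA(1-3)
  is_functorD(7,8)[OF is_functor_Q] is_functorD(7,8)[OF is_functor_R] fwd_simps bwd_simps
  Ho.cat_simps[unfolded Obj_HoCat]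

section \<open>Adjunctions, and closure of Quillen functors under composition\<close>

lemma is_adjunctionD:
  assumes "is_adjunction C D Fo Fa Go Ga \<eta> \<epsilon>"
  shows "is_functor C D Fo Fa" "is_functor D C Go Ga"
    "is_natural C C (\<lambda>x. x) (\<lambda>f. f) (\<lambda>x. Go (Fo x)) (\<lambda>f. Ga (Fa f)) \<eta>"
    "is_natural D D (\<lambda>y. Fo (Go y)) (\<lambda>g. Fa (Ga g)) (\<lambda>y. y) (\<lambda>g. g) \<epsilon>"
    "\<And>x. x \<in> Obj C \<Longrightarrow> \<epsilon> (Fo x) \<odot>\<^bsub>D\<^esub> Fa (\<eta> x) = Ident D (Fo x)"
    "\<And>y. y \<in> Obj D \<Longrightarrow> Ga (\<epsilon> y) \<odot>\<^bsub>C\<^esub> \<eta> (Go y) = Ident C (Go y)"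
  using assms by (auto simp: is_adjunction_def)

lemma is_functor_op_model: "is_functor M N Fo Fa \<Longrightarrow> is_functor (op_model M) (op_model N) Fo Fa"
  by (auto simp: is_functor_def intro: category_op_model)

lemma is_adjunction_op_model:
  assumes "is_adjunction M N Fo Fa Go Ga \<eta> \<epsilon>"
  shows "is_adjunction (op_model N) (op_model M) Go Ga Fo Fa \<epsilon> \<eta>"
  using is_adjunctionD[OF assms] by (auto simp: is_adjunction_def is_functor_op_model is_natural_def)

lemma is_adjunction_id: "category C \<Longrightarrow> is_adjunction C C (\<lambda>x. x) (\<lambda>f. f) (\<lambda>x. x) (\<lambda>f. f) (Ident C) (Ident C)"
  by (simp add: is_adjunction_def is_functor_id is_natural_def hom_def category.cat_simps)

text \<open>Each triangle identity of the composite reduces to one of either factor, after the unit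
  or counit of one adjunction is moved past that of the other by naturality.\<close>

lemma is_adjunction_comp:
  assumes 1: "is_adjunction C D Fo Fa Go Ga \<eta> \<epsilon>" and 2: "is_adjunction D E Fo' Fa' Go' Ga' \<eta>' \<epsilon>'"
  shows "is_adjunction C E (\<lambda>x. Fo' (Fo x)) (\<lambda>f. Fa' (Fa f)) (\<lambda>x. Go (Go' x)) (\<lambda>f. Ga (Ga' f))
    (\<lambda>x. Ga (\<eta>' (Fo x)) \<odot>\<^bsub>C\<^esub> \<eta> x) (\<lambda>y. \<epsilon>' y \<odot>\<^bsub>E\<^esub> Fa' (\<epsilon> (Go' y)))"
proof -
  note A = is_adjunctionD[OF 1] and B = is_adjunctionD[OF 2]
  interpret C: category C using is_functorD(1)[OF A(1)] .
  interpret D: category D using is_functorD(1)[OF A(2)] .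
  interpret E: category E using is_functorD(1)[OF B(2)] .
  note F = is_functorD(3-6)[OF A(1)] is_functorD(3-6)[OF A(2)] is_functorD(3-6)[OF B(1)]
    is_functorD(3-6)[OF B(2)] is_naturalD(1-3)[OF A(3)] is_naturalD(1-3)[OF A(4)]
    is_naturalD(1-3)[OF B(3)] is_naturalD(1-3)[OF B(4)]
  show ?thesis
    unfolding is_adjunction_def
  proof (intro conjI ballI)
    show "is_functor C E (\<lambda>x. Fo' (Fo x)) (\<lambda>f. Fa' (Fa f))" by (rule is_functor_comp[OF A(1) B(1)])
    show "is_functor E C (\<lambda>x. Go (Go' x)) (\<lambda>f. Ga (Ga' f))" by (rule is_functor_comp[OF B(2) A(2)])
    have fg: "is_functor C C (\<lambda>x. Go (Fo x)) (\<lambda>f. Ga (Fa f))" by (rule is_functor_comp[OF A(1) A(2)])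
    have fffgg: "is_functor C D (\<lambda>x. Go' (Fo' (Fo x))) (\<lambda>f. Ga' (Fa' (Fa f)))"
      by (rule is_functor_comp[OF A(1) is_functor_comp[OF B(1) B(2)]])
    show "is_natural C C (\<lambda>x. x) (\<lambda>f. f) (\<lambda>x. Go (Go' (Fo' (Fo x)))) (\<lambda>f. Ga (Ga' (Fa' (Fa f))))
      (\<lambda>x. Ga (\<eta>' (Fo x)) \<odot>\<^bsub>C\<^esub> \<eta> x)"
      by (rule is_natural_vertical_comp[OF C.category_axioms is_functor_id[OF C.category_axioms] fg
            is_functor_comp[OF fffgg A(2)] A(3)])
        (rule is_natural_whisker_left[OF C.category_axioms A(2) is_natural_whisker_right[OF A(1) B(3)] A(1) fffgg])
    have fg': "is_functor E E (\<lambda>x. Fo' (Go' x)) (\<lambda>f. Fa' (Ga' f))" by (rule is_functor_comp[OF B(2) B(1)])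
    have fffgg': "is_functor E D (\<lambda>x. Fo (Go (Go' x))) (\<lambda>f. Fa (Ga (Ga' f)))"
      by (rule is_functor_comp[OF B(2) is_functor_comp[OF A(2) A(1)]])
    show "is_natural E E (\<lambda>y. Fo' (Fo (Go (Go' y)))) (\<lambda>g. Fa' (Fa (Ga (Ga' g)))) (\<lambda>y. y) (\<lambda>g. g)
      (\<lambda>y. \<epsilon>' y \<odot>\<^bsub>E\<^esub> Fa' (\<epsilon> (Go' y)))"
      by (rule is_natural_vertical_comp[OF E.category_axioms is_functor_comp[OF fffgg' B(1)] fg'
            is_functor_id[OF E.category_axioms] _ B(4)])
        (rule is_natural_whisker_left[OF E.category_axioms B(1) is_natural_whisker_right[OF B(2) A(4)] fffgg' B(2)])
  next
    fix x assume x: "x \<in> Obj C"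
    let ?h = "\<eta>' (Fo x)"
    \<comment> \<open>Naturality of the first counit at the second unit brings \<epsilon> next to
      \<eta>, where the first triangle identity cancels them under \<open>Fa'\<close>.\<close>
    have n: "\<epsilon> (Go' (Fo' (Fo x))) \<odot>\<^bsub>D\<^esub> Fa (Ga ?h) = ?h \<odot>\<^bsub>D\<^esub> \<epsilon> (Fo x)"
      using is_naturalD(4)[OF A(4), of ?h] x by (simp add: F)
    have "Fa' (\<epsilon> (Go' (Fo' (Fo x)))) \<odot>\<^bsub>E\<^esub> Fa' (Fa (Ga ?h \<odot>\<^bsub>C\<^esub> \<eta> x)) =
      Fa' (\<epsilon> (Go' (Fo' (Fo x))) \<odot>\<^bsub>D\<^esub> Fa (Ga ?h \<odot>\<^bsub>C\<^esub> \<eta> x))"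
      using x by (intro is_functorD(8)[OF B(1), symmetric]) (simp_all add: F C.cat_simps)
    also have "\<epsilon> (Go' (Fo' (Fo x))) \<odot>\<^bsub>D\<^esub> Fa (Ga ?h \<odot>\<^bsub>C\<^esub> \<eta> x) = ?h \<odot>\<^bsub>D\<^esub> (\<epsilon> (Fo x) \<odot>\<^bsub>D\<^esub> Fa (\<eta> x))"
      using x is_functorD(8)[OF A(1), of "\<eta> x" "Ga ?h"] D.reassoc[OF n, of "Fa (\<eta> x)"]
      by (simp add: F C.cat_simps D.assoc)
    also have "\<dots> = ?h" using x by (simp add: A(5) F D.cat_simps)
    finally have "Fa' (\<epsilon> (Go' (Fo' (Fo x)))) \<odot>\<^bsub>E\<^esub> Fa' (Fa (Ga ?h \<odot>\<^bsub>C\<^esub> \<eta> x)) = Fa' ?h" .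
    then show "(\<epsilon>' (Fo' (Fo x)) \<odot>\<^bsub>E\<^esub> Fa' (\<epsilon> (Go' (Fo' (Fo x))))) \<odot>\<^bsub>E\<^esub> Fa' (Fa (Ga ?h \<odot>\<^bsub>C\<^esub> \<eta> x)) =
        Ident E (Fo' (Fo x))"
      using x B(5)[of "Fo x"] by (simp add: E.assoc F C.Comp_Arr)
  next
    fix y assume y: "y \<in> Obj E"
    let ?e = "\<epsilon> (Go' y)"
    \<comment> \<open>Dually, naturality of the second unit at the first counit brings
      \<open>\<epsilon>'\<close> next to \<open>\<eta>'\<close>.\<close>
    have n: "Ga' (Fa' ?e) \<odot>\<^bsub>D\<^esub> \<eta>' (Fo (Go (Go' y))) = \<eta>' (Go' y) \<odot>\<^bsub>D\<^esub> ?e"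
      using is_naturalD(4)[OF B(3), of ?e] y by (simp add: F)
    have "Ga (Ga' (\<epsilon>' y \<odot>\<^bsub>E\<^esub> Fa' ?e)) \<odot>\<^bsub>C\<^esub> Ga (\<eta>' (Fo (Go (Go' y)))) =
      Ga (Ga' (\<epsilon>' y \<odot>\<^bsub>E\<^esub> Fa' ?e) \<odot>\<^bsub>D\<^esub> \<eta>' (Fo (Go (Go' y))))"
      using y by (intro is_functorD(8)[OF A(2), symmetric]) (simp_all add: F E.cat_simps)
    also have "Ga' (\<epsilon>' y \<odot>\<^bsub>E\<^esub> Fa' ?e) \<odot>\<^bsub>D\<^esub> \<eta>' (Fo (Go (Go' y))) =
      (Ga' (\<epsilon>' y) \<odot>\<^bsub>D\<^esub> \<eta>' (Go' y)) \<odot>\<^bsub>D\<^esub> ?e"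
      using y is_functorD(8)[OF B(2), of "Fa' ?e" "\<epsilon>' y"] n by (simp add: F D.assoc)
    also have "\<dots> = ?e" using y by (simp add: B(6) F D.cat_simps)
    finally have "Ga (Ga' (\<epsilon>' y \<odot>\<^bsub>E\<^esub> Fa' ?e)) \<odot>\<^bsub>C\<^esub> Ga (\<eta>' (Fo (Go (Go' y)))) = Ga ?e" .
    then have "(Ga (Ga' (\<epsilon>' y \<odot>\<^bsub>E\<^esub> Fa' ?e)) \<odot>\<^bsub>C\<^esub> Ga (\<eta>' (Fo (Go (Go' y))))) \<odot>\<^bsub>C\<^esub> \<eta> (Go (Go' y)) =
        Ident C (Go (Go' y))"
      using y A(6)[of "Go' y"] by (simp add: F)
    then show "Ga (Ga' (\<epsilon>' y \<odot>\<^bsub>E\<^esub> Fa' ?e)) \<odot>\<^bsub>C\<^esub> (Ga (\<eta>' (Fo (Go (Go' y)))) \<odot>\<^bsub>C\<^esub> \<eta> (Go (Go' y))) =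
        Ident C (Go (Go' y))"
      using y by (subst C.assoc[symmetric]) (simp_all add: F E.Comp_Arr)
  qed
qed

lemma is_adjunction_cong:
  assumes "is_adjunction C D Fo Fa Go Ga \<eta> \<epsilon>"
    and eq: "\<And>x. x \<in> Obj C \<Longrightarrow> Fo x = Fo' x" "\<And>f. f \<in> Arr C \<Longrightarrow> Fa f = Fa' f"
    "\<And>x. x \<in> Obj D \<Longrightarrow> Go x = Go' x" "\<And>f. f \<in> Arr D \<Longrightarrow> Ga f = Ga' f"
  shows "is_adjunction C D Fo' Fa' Go' Ga' \<eta> \<epsilon>"
proof -
  note A = is_adjunctionD[OF assms(1)]
  note F = is_functorD[OF A(1)] is_functorD[OF A(2)]
  show ?thesis
    unfolding is_adjunction_def
  proof (intro conjI ballI)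
    show "is_functor C D Fo' Fa'" "is_functor D C Go' Ga'"
      using is_functor_cong[OF A(1), of Fo' Fa'] is_functor_cong[OF A(2), of Go' Ga'] eq by auto
    show "is_natural C C (\<lambda>x. x) (\<lambda>f. f) (\<lambda>x. Go' (Fo' x)) (\<lambda>f. Ga' (Fa' f)) \<eta>"
      by (rule is_natural_cong[OF A(3) F(1)]) (use F(3,4) eq in force)+
    show "is_natural D D (\<lambda>y. Fo' (Go' y)) (\<lambda>g. Fa' (Ga' g)) (\<lambda>y. y) (\<lambda>g. g) \<epsilon>"
      by (rule is_natural_cong[OF A(4) F(2)]) (use F(11,12) eq in force)+
    show "\<epsilon> (Fo' x) \<odot>\<^bsub>D\<^esub> Fa' (\<eta> x) = Ident D (Fo' x)" if "x \<in> Obj C" for x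
      using A(5)[OF that] is_naturalD(1)[OF A(3) that] eq that by simp
    show "Ga' (\<epsilon> y) \<odot>\<^bsub>C\<^esub> \<eta> (Go' y) = Ident C (Go' y)" if "y \<in> Obj D" for y
      using A(6)[OF that] is_naturalD(1)[OF A(4) that] eq that by simp
  qed
qed

lemma left_quillen_id:
  assumes "model_category \<kappa> M"
  shows "left_quillen (id_functor M)"
proof -
  interpret model_category \<kappa> M by fact
  have "is_adjunction M M (FO (id_functor M)) (FA (id_functor M)) (\<lambda>x. x) (\<lambda>f. f) (Ident M) (Ident M)"
    by (rule is_adjunction_cong[OF is_adjunction_id[OF category_axioms]]) auto
  then show ?thesis
    using is_functor_cell_id[OF category_axioms] by (auto simp: left_quillen_def)
qed

lemma right_quillen_id:
  assumes "model_category \<kappa> M"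
  shows "right_quillen (id_functor M)"
proof -
  interpret model_category \<kappa> M by fact
  have "is_adjunction M M (\<lambda>x. x) (\<lambda>f. f) (FO (id_functor M)) (FA (id_functor M)) (Ident M) (Ident M)"
    by (rule is_adjunction_cong[OF is_adjunction_id[OF category_axioms]]) auto
  then show ?thesis
    using is_functor_cell_id[OF category_axioms] by (auto simp: right_quillen_def)
qed

lemma left_quillen_comp:
  assumes F: "left_quillen F" and G: "left_quillen G" and eq: "Src G = Tgt F"
    and Cof: "Cof (Src F) \<subseteq> Arr (Src F)"
  shows "left_quillen (comp_functor G F)"
proof -
  obtain Ko Ka \<eta> \<epsilon> where 1: "is_adjunction (Src F) (Tgt F) (FO F) (FA F) Ko Ka \<eta> \<epsilon>"
    using F by (auto simp: left_quillen_def)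
  obtain Ko' Ka' \<eta>' \<epsilon>' where 2: "is_adjunction (Tgt F) (Tgt G) (FO G) (FA G) Ko' Ka' \<eta>' \<epsilon>'"
    using G eq by (auto simp: left_quillen_def)
  have "is_adjunction (Src F) (Tgt G) (FO (comp_functor G F)) (FA (comp_functor G F)) (\<lambda>x. Ko (Ko' x))
    (\<lambda>f. Ka (Ka' f)) (\<lambda>x. Ka (\<eta>' (FO F x)) \<odot>\<^bsub>Src F\<^esub> \<eta> x) (\<lambda>y. \<epsilon>' y \<odot>\<^bsub>Tgt G\<^esub> FA G (\<epsilon> (Ko' y)))"
    by (rule is_adjunction_cong[OF is_adjunction_comp[OF 1 2]]) auto
  then have "\<exists>Go Ga \<eta> \<epsilon>. is_adjunction (Src F) (Tgt G) (FO (comp_functor G F)) (FA (comp_functor G F)) Go Ga \<eta> \<epsilon>"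
    by blast
  moreover have "FA (comp_functor G F) u = FA G (FA F u)" if "u \<in> Cof (Src F)" for u
    using that Cof by auto
  ultimately show ?thesis
    using F G eq is_functor_cell_comp[of F G] by (auto simp: left_quillen_def subset_eq)
qed

lemma right_quillen_comp:
  assumes F: "right_quillen F" and G: "right_quillen G" and eq: "Src G = Tgt F"
    and Fib: "Fib (Src F) \<subseteq> Arr (Src F)"
  shows "right_quillen (comp_functor G F)"
proof -
  obtain Ko Ka \<eta> \<epsilon> where 1: "is_adjunction (Tgt F) (Src F) Ko Ka (FO F) (FA F) \<eta> \<epsilon>"
    using F by (auto simp: right_quillen_def)
  obtain Ko' Ka' \<eta>' \<epsilon>' where 2: "is_adjunction (Tgt G) (Tgt F) Ko' Ka' (FO G) (FA G) \<eta>' \<epsilon>'"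
    using G eq by (auto simp: right_quillen_def)
  have "is_adjunction (Tgt G) (Src F) (\<lambda>x. Ko (Ko' x)) (\<lambda>f. Ka (Ka' f)) (FO (comp_functor G F)) (FA (comp_functor G F))
    (\<lambda>x. FA G (\<eta> (Ko' x)) \<odot>\<^bsub>Tgt G\<^esub> \<eta>' x) (\<lambda>y. \<epsilon> y \<odot>\<^bsub>Src F\<^esub> Ka (\<epsilon>' (FO F y)))"
    by (rule is_adjunction_cong[OF is_adjunction_comp[OF 2 1]]) auto
  then have "\<exists>Fo Fa \<eta> \<epsilon>. is_adjunction (Tgt G) (Src F) Fo Fa (FO (comp_functor G F)) (FA (comp_functor G F)) \<eta> \<epsilon>"
    by blast
  moreover have "FA (comp_functor G F) u = FA G (FA F u)" if "u \<in> Fib (Src F)" for u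
    using that Fib by auto
  ultimately show ?thesis
    using F G eq is_functor_cell_comp[of F G] by (auto simp: right_quillen_def subset_eq)
qed

section \<open>The double category \<open>Model\<close>\<close>

lemma functor_square_closure_Model:
  fixes \<kappa> :: "'s::infinite itself"
  shows "functor_square_closure {M :: ('o, 'm) model_data. model_category \<kappa> M}
     {F. left_quillen F \<and> model_category \<kappa> (Src F) \<and> model_category \<kappa> (Tgt F)}
     {F. right_quillen F \<and> model_category \<kappa> (Src F) \<and> model_category \<kappa> (Tgt F)}"
  by (rule functor_square_closure.intro)
    (auto simp: left_quillen_def[THEN iffD1, THEN conjunct1] right_quillen_def[THEN iffD1, THEN conjunct1]
      left_quillen_id right_quillen_id
      intro!: left_quillen_comp right_quillen_comp
      dest: model_category.Cof_Arr model_category.Fib_Arr model_category.axioms(1))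

lemmas double_category_Model =
  functor_square_closure.double_category_functor_squares[OF functor_square_closure_Model, folded Model_def]

lemmas Model_simps = functor_square_closure.K_simps[OF functor_square_closure_Model, folded Model_def]

section \<open>Left Quillen functors and their left derived functors\<close>

locale left_quillen_functor = A: model_category \<kappa> A + B: model_category \<kappa> B
  for \<kappa> :: "'s::infinite itself" and A B :: "('o, 'm) model_data" +
  fixes f :: "('o, 'm) model_functor"
  assumes left_quillen: "left_quillen f" and Src: "Src f = A" and Tgt: "Tgt f = B"
begin

lemma cell: "is_functor_cell f"
  using left_quillen by (simp add: left_quillen_def)

lemma f_functor: "is_functor A B (FO f) (FA f)"
  using is_functor_cellD(1)[OF cell] by (simp add: Src Tgt)

lemmas f_simps = is_functorD(3-)[OF f_functor] Src Tgt

lemma FA_Cof: "u \<in> Cof A \<Longrightarrow> FA f u \<in> Cof B"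
  and FA_acyclic_Cof: "u \<in> Cof A \<Longrightarrow> u \<in> Weq A \<Longrightarrow> FA f u \<in> Weq B"
  using left_quillen by (auto simp: left_quillen_def Src Tgt)

lemma FA_Weq_cofibrant:
  "w \<in> Weq A \<Longrightarrow> cofibrant A (Dom A w) \<Longrightarrow> cofibrant A (Cod A w) \<Longrightarrow> FA f w \<in> Weq B"
  by (rule A.ken_brown[OF B.model_category_axioms f_functor FA_acyclic_Cof])

text \<open>\<open>Q\<close> preserves weak equivalences and takes cofibrant values, so Ken Brown
  applies; this makes \<open>f \<circ> Q\<close> induce a functor of homotopy categories.\<close>

lemma FA_QA_Weq: "w \<in> Weq A \<Longrightarrow> FA f (QA A w) \<in> Weq B"
  using A.QA[of w] A.qmap(7) by (intro FA_Weq_cofibrant A.QA_Weq) (auto simp: A.cat_simps)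

lemma FA_qmap_Weq: "cofibrant A x \<Longrightarrow> FA f (qmap A x) \<in> Weq B"
  using A.qmap[of x] by (intro FA_Weq_cofibrant) (auto simp: cofibrant_def)

lemma FA_rmap_Weq: "x \<in> Obj A \<Longrightarrow> FA f (rmap A x) \<in> Weq B"
  using A.rmap[of x] by (intro FA_acyclic_Cof) auto

text \<open>The arrow is the transpose of the map from the initial object to \<open>Go z\<close>;
  transposing any competitor \<open>u\<close> gives that same map, and the triangle identity
  recovers \<open>u\<close>.\<close>

lemma FO_initial:
  assumes "z \<in> Obj B"
  shows "\<exists>!u. u \<in> hom B (FO f (initial_object A)) z"
proof -
  obtain Go Ga \<eta> \<epsilon> where "is_adjunction A B (FO f) (FA f) Go Ga \<eta> \<epsilon>"
    using left_quillen by (auto simp: left_quillen_def Src Tgt)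
  note adj = is_adjunctionD[OF this]
  note G = is_functorD[OF adj(2)]
  let ?o = "initial_object A"
  note o = A.initial_Obj A.from_initial[OF G(3)[OF assms]]
  note e = is_naturalD(1-3)[OF adj(4) assms] is_naturalD(1-3)[OF adj(3) A.initial_Obj]
  have "\<epsilon> z \<odot>\<^bsub>B\<^esub> FA f (from_initial A (Go z)) \<in> hom B (FO f ?o) z"
    using o e f_simps by (simp add: hom_def B.cat_simps)
  moreover have "u = \<epsilon> z \<odot>\<^bsub>B\<^esub> FA f (from_initial A (Go z))" if "u \<in> hom B (FO f ?o) z" for u
  proof -
    have u: "u \<in> Arr B" "Dom B u = FO f ?o" "Cod B u = z" using that by (auto simp: hom_def)
    have "from_initial A (Go z) = Ga u \<odot>\<^bsub>A\<^esub> \<eta> ?o"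
      by (rule A.from_initial_unique[symmetric]) (use u e G in \<open>simp_all add: A.cat_simps f_simps\<close>)
    then have "\<epsilon> z \<odot>\<^bsub>B\<^esub> FA f (from_initial A (Go z)) = \<epsilon> z \<odot>\<^bsub>B\<^esub> (FA f (Ga u) \<odot>\<^bsub>B\<^esub> FA f (\<eta> ?o))"
      using u e G f_simps by simp
    also have "\<dots> = (\<epsilon> z \<odot>\<^bsub>B\<^esub> FA f (Ga u)) \<odot>\<^bsub>B\<^esub> FA f (\<eta> ?o)"
      using u e G f_simps by (intro B.assoc[symmetric]) simp_all
    also have "\<epsilon> z \<odot>\<^bsub>B\<^esub> FA f (Ga u) = u \<odot>\<^bsub>B\<^esub> \<epsilon> (FO f ?o)"
      using is_naturalD(4)[OF adj(4), of u] u by simp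
    also have "(u \<odot>\<^bsub>B\<^esub> \<epsilon> (FO f ?o)) \<odot>\<^bsub>B\<^esub> FA f (\<eta> ?o) = u \<odot>\<^bsub>B\<^esub> (\<epsilon> (FO f ?o) \<odot>\<^bsub>B\<^esub> FA f (\<eta> ?o))"
      using u e f_simps is_naturalD(1-3)[OF adj(4), of "FO f ?o"] by (intro B.assoc) simp_all
    also have "\<dots> = u" using u adj(5)[OF A.initial_Obj] by (simp add: B.cat_simps)
    finally show ?thesis by simp
  qed
  ultimately show ?thesis by blast
qed

text \<open>The image of the chosen initial object is initial but need not be the chosen initial
  object of \<open>B\<close>, so the map from the latter to it has to be shown a cofibration. It
  lifts against everything: both triangles compare maps out of initial objects. The image of the map
  defining cofibrancy of \<open>x\<close> is then composed with it.\<close>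

lemma cofibrant_FO:
  assumes "cofibrant A x"
  shows "cofibrant B (FO f x)"
proof -
  let ?o = "FO f (initial_object A)"
  have x: "x \<in> Obj A" "from_initial A x \<in> Cof A" using assms by (auto simp: cofibrant_def)
  have o: "?o \<in> Obj B" using f_simps by simp
  note i = B.from_initial[OF o] and j = A.from_initial[OF x(1)]
  have "from_initial B ?o \<in> Cof B"
  proof (rule B.Cof_liftingI[OF i(1)])
    fix p assume p: "p \<in> Fib B" "p \<in> Weq B"
    show "has_lifting B (from_initial B ?o) p"
      unfolding has_lifting_def
    proof (intro allI impI)
      fix u v assume "arrow_square B (from_initial B ?o) p u v"
      then have uv: "u \<in> Arr B" "Dom B u = initial_object B" "Cod B u = Dom B p"
        "v \<in> Arr B" "Dom B v = ?o" "Cod B v = Cod B p"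
        using i by (auto simp: arrow_square_def hom_def)
      obtain l where l: "l \<in> hom B ?o (Dom B p)"
        using FO_initial[of "Dom B p"] p by (auto simp: B.cat_simps)
      then have l': "l \<in> Arr B" "Dom B l = ?o" "Cod B l = Dom B p" by (auto simp: hom_def)
      have "l \<odot>\<^bsub>B\<^esub> from_initial B ?o = from_initial B (Dom B p)" "u = from_initial B (Dom B p)"
        using l' uv i by (auto intro!: B.from_initial_unique simp: B.Comp_Arr)
      moreover have "p \<odot>\<^bsub>B\<^esub> l = v"
      proof -
        have "\<exists>!u. u \<in> hom B ?o (Cod B p)" using FO_initial p B.cat_simps by simp
        moreover have "p \<odot>\<^bsub>B\<^esub> l \<in> hom B ?o (Cod B p)" "v \<in> hom B ?o (Cod B p)"
          using l' uv p by (simp_all add: hom_def B.Comp_Arr)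
        ultimately show ?thesis by blast
      qed
      ultimately show "\<exists>l\<in>hom B (Cod B (from_initial B ?o)) (Dom B p). l \<odot>\<^bsub>B\<^esub> from_initial B ?o = u \<and> p \<odot>\<^bsub>B\<^esub> l = v"
        using l i by auto
    qed
  qed
  then have "FA f (from_initial A x) \<odot>\<^bsub>B\<^esub> from_initial B ?o \<in> Cof B"
    using FA_Cof[OF x(2)] i j f_simps by (intro B.Cof_Comp) simp_all
  moreover have "FA f (from_initial A x) \<odot>\<^bsub>B\<^esub> from_initial B ?o = from_initial B (FO f x)"
    using i j f_simps by (intro B.from_initial_unique) (simp_all add: B.Comp_Arr)
  ultimately show ?thesis using x f_simps by (simp add: cofibrant_def)
qed

lemma cofibrant_FO_QO: "x \<in> Obj A \<Longrightarrow> cofibrant B (FO f (QO A x))"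
  by (rule cofibrant_FO) (rule A.qmap(7))

sublocale L: homotopical_functor A B "\<lambda>x. FO f (QO A x)" "\<lambda>u. FA f (QA A u)"
  by unfold_locales (rule is_functor_comp[OF A.is_functor_Q f_functor], rule FA_QA_Weq)

lemma Lder_eq: "Lder f = HoInduced A B (\<lambda>x. FO f (QO A x)) (\<lambda>u. FA f (QA A u))"
  by (simp add: Lder_def Src Tgt)

lemma FA_qmap_natural:
  assumes "v \<in> Arr A"
  shows "FA f (qmap A (Cod A v)) \<odot>\<^bsub>B\<^esub> FA f (QA A v) = FA f v \<odot>\<^bsub>B\<^esub> FA f (qmap A (Dom A v))"
  using assms A.QA[OF assms] A.qmap[OF A.Cod_Obj[OF assms]] A.qmap[OF A.Dom_Obj[OF assms]]
    f_simps(6)[of "QA A v" "qmap A (Cod A v)"] f_simps(6)[of "qmap A (Dom A v)" v] by simp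

lemmas Lder_simps = L.HoInduced_simps[folded Lder_eq] L.HoInduced_fwd[folded Lder_eq]
  L.HoInduced_bwd[folded Lder_eq] L.is_functor_cell_HoInduced[folded Lder_eq]

lemma Lder_functor: "is_functor (HoCat A) (HoCat B) (FO (Lder f)) (FA (Lder f))"
  using is_functor_cellD(1)[OF Lder_simps(6)] by (simp add: Lder_simps)

end

section \<open>Right Quillen functors and their right derived functors, by duality\<close>

definition op_functor :: "('o, 'm) model_functor \<Rightarrow> ('o, 'm) model_functor" where
  "op_functor g = \<lparr>Src = op_model (Src g), Tgt = op_model (Tgt g), FO = FO g, FA = FA g\<rparr>"

lemma op_functor_simps [simp]:
  "Src (op_functor g) = op_model (Src g)" "Tgt (op_functor g) = op_model (Tgt g)"
  "FO (op_functor g) = FO g" "FA (op_functor g) = FA g"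
  by (simp_all add: op_functor_def)

lemma left_quillen_op_functor: "right_quillen g \<Longrightarrow> left_quillen (op_functor g)"
  using is_functor_op_model is_adjunction_op_model
  by (fastforce simp: left_quillen_def right_quillen_def is_functor_cell_def)

locale right_quillen_functor = A: model_category \<kappa> A + B: model_category \<kappa> B
  for \<kappa> :: "'s::infinite itself" and A B :: "('o, 'm) model_data" +
  fixes g :: "('o, 'm) model_functor"
  assumes right_quillen: "right_quillen g" and Src: "Src g = A" and Tgt: "Tgt g = B"
begin

text \<open>What depends on Ken Brown or on the adjoint is read off from this left Quillen functor:
  \<open>FA_RA_Weq\<close>, \<open>FA_rmap_Weq\<close> and \<open>fibrant_FO\<close>.\<close>

lemma op: "left_quillen_functor \<kappa> (op_model A) (op_model B) (op_functor g)"
  using left_quillen_op_functor[OF right_quillen] A.model_category_op B.model_category_op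
  by (simp add: left_quillen_functor_def left_quillen_functor_axioms_def Src Tgt)

lemma cell: "is_functor_cell g"
  using right_quillen by (simp add: right_quillen_def)

lemma g_functor: "is_functor A B (FO g) (FA g)"
  using is_functor_cellD(1)[OF cell] by (simp add: Src Tgt)

lemmas g_simps = is_functorD(3-)[OF g_functor] Src Tgt

lemma FA_RA_Weq: "w \<in> Weq A \<Longrightarrow> FA g (RA A w) \<in> Weq B"
  using left_quillen_functor.FA_QA_Weq[OF op, of w] by simp

lemma FA_rmap_Weq: "fibrant A x \<Longrightarrow> FA g (rmap A x) \<in> Weq B"
  using left_quillen_functor.FA_qmap_Weq[OF op, of x] by simp

lemma FA_qmap_Weq: "x \<in> Obj A \<Longrightarrow> FA g (qmap A x) \<in> Weq B"
  using right_quillen A.qmap[of x] by (auto simp: right_quillen_def Src Tgt)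

lemma fibrant_FO: "fibrant A x \<Longrightarrow> fibrant B (FO g x)"
  using left_quillen_functor.cofibrant_FO[OF op, of x] by simp

sublocale R: homotopical_functor A B "\<lambda>x. FO g (RO A x)" "\<lambda>u. FA g (RA A u)"
  by unfold_locales (rule is_functor_comp[OF A.is_functor_R g_functor], rule FA_RA_Weq)

lemma Rder_eq: "Rder g = HoInduced A B (\<lambda>x. FO g (RO A x)) (\<lambda>u. FA g (RA A u))"
  by (simp add: Rder_def Src Tgt)

lemma FA_rmap_natural:
  assumes "v \<in> Arr A"
  shows "FA g (rmap A (Cod A v)) \<odot>\<^bsub>B\<^esub> FA g v = FA g (RA A v) \<odot>\<^bsub>B\<^esub> FA g (rmap A (Dom A v))"
  using assms A.RA[OF assms] A.rmap[OF A.Cod_Obj[OF assms]] A.rmap[OF A.Dom_Obj[OF assms]]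
    g_simps(6)[of v "rmap A (Cod A v)"] g_simps(6)[of "rmap A (Dom A v)" "RA A v"] by simp

lemmas Rder_simps = R.HoInduced_simps[folded Rder_eq] R.HoInduced_fwd[folded Rder_eq]
  R.HoInduced_bwd[folded Rder_eq] R.is_functor_cell_HoInduced[folded Rder_eq]

lemma Rder_functor: "is_functor (HoCat A) (HoCat B) (FO (Rder g)) (FA (Rder g))"
  using is_functor_cellD(1)[OF Rder_simps(6)] by (simp add: Rder_simps)

end

section \<open>Derived squares\<close>

text \<open>Pastes two commutative squares along the edge \<open>v\<close>; used to chain naturality
  of the factors of a composite.\<close>

lemma (in category) square_comp:
  assumes "c' \<odot> v = w \<odot> c" "b' \<odot> u = v \<odot> b"
    and "u \<in> Arr C" "v \<in> Arr C" "w \<in> Arr C" "b \<in> Arr C" "b' \<in> Arr C" "c \<in> Arr C" "c' \<in> Arr C"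
    and "Dom C b' = Cod C u" "Dom C v = Cod C b" "Dom C c' = Cod C v" "Dom C c' = Cod C b'"
      "Dom C w = Cod C c" "Dom C c = Cod C b"
  shows "(c' \<odot> b') \<odot> u = w \<odot> (c \<odot> b)"
proof -
  have "(c' \<odot> b') \<odot> u = (c' \<odot> v) \<odot> b" using assms(2-) by (simp add: assoc)
  also have "\<dots> = w \<odot> (c \<odot> b)" using assms by (simp add: assoc)
  finally show ?thesis .
qed

lemma is_functor_comm:
  assumes "is_functor C D Fo Fa" "v \<odot>\<^bsub>C\<^esub> u = v' \<odot>\<^bsub>C\<^esub> u'" "u \<in> Arr C" "v \<in> Arr C" "u' \<in> Arr C" "v' \<in> Arr C"
    "Dom C v = Cod C u" "Dom C v' = Cod C u'"
  shows "Fa v \<odot>\<^bsub>D\<^esub> Fa u = Fa v' \<odot>\<^bsub>D\<^esub> Fa u'"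
  using assms is_functorD(8)[OF assms(1)] by metis

context homotopical_category
begin

text \<open>Reduces well-formedness of an explicit zigzag, such as the one in
  \<open>HoSquare\<close>, to conditions on its letters.\<close>

lemma zigzag_iff:
  "zz x [] y \<longleftrightarrow> x \<in> Obj M \<and> x = y"
  "zz x (Fwd f # p) y \<longleftrightarrow> f \<in> Arr M \<and> Dom M f = x \<and> zz (Cod M f) p y"
  "zz x (Bwd f # p) y \<longleftrightarrow> f \<in> Weq M \<and> Cod M f = x \<and> zz (Dom M f) p y"
  using Weq_Arr zigzag.bwd[of f "Weq M" M "Dom M f" "Cod M f" p y]
  by (auto elim: zigzag.cases intro: zigzag.intros simp: hom_def)

lemma HoClass_single:
  "f \<in> Arr M \<Longrightarrow> Dom M f = x \<Longrightarrow> Cod M f = y \<Longrightarrow> HoClass M x [Fwd f] y = fwd M f"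
  "w \<in> Weq M \<Longrightarrow> Cod M w = x \<Longrightarrow> Dom M w = y \<Longrightarrow> HoClass M x [Bwd w] y = bwd M w"
  by (auto simp: fwd_def bwd_def)

end

text \<open>The corners are \<open>A\<close> top left, \<open>C\<close> top right, \<open>B\<close>
  bottom left and \<open>D\<close> bottom right.\<close>

locale quillen_square =
  A: model_category \<kappa> A + B: model_category \<kappa> B + C: model_category \<kappa> C + D: model_category \<kappa> D +
  h: left_quillen_functor \<kappa> A B h + k: left_quillen_functor \<kappa> C D k +
  f: right_quillen_functor \<kappa> A C f + g: right_quillen_functor \<kappa> B D g
  for \<kappa> :: "'s::infinite itself" and A B C D :: "('o, 'm) model_data" and f g h k +
  fixes \<alpha> :: "('o, 'm, ('m, unit) model_data_ext) square_data"
  assumes sides: "STop \<alpha> = f" "SBot \<alpha> = g" "SLft \<alpha> = h" "SRgt \<alpha> = k"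
    and functor_square: "is_functor_square \<alpha>"
begin

lemma cell_square: "is_cell_square \<alpha>"
  using functor_square h.cell k.cell f.cell g.cell by (simp add: is_cell_square_def sides)

lemma natural: "is_natural A D (\<lambda>x. FO k (FO f x)) (\<lambda>u. FA k (FA f u))
    (\<lambda>x. FO g (FO h x)) (\<lambda>u. FA g (FA h u)) (Tr \<alpha>)"
  using is_functor_squareD(5)[OF functor_square] by (simp add: sides f.Src k.Tgt)

lemmas S = A.model_simps B.model_simps C.model_simps D.model_simps h.f_simps k.f_simps f.g_simps g.g_simps
  h.FA_QA_Weq k.FA_QA_Weq f.FA_RA_Weq g.FA_RA_Weq h.FA_rmap_Weq k.FA_rmap_Weq f.FA_qmap_Weq g.FA_qmap_Weq
  is_naturalD(1-3)[OF natural] A.QA_Weq A.RA_Weq B.QA_Weq B.RA_Weq C.QA_Weq C.RA_Weq D.QA_Weq D.RA_Weq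

text \<open>The transformation \<open>kQf \<rightarrow> kf \<rightarrow> gh \<rightarrow> gRh\<close> of functors on \<open>A\<close>. It does not preserve weak
  equivalences, but \<open>Ho \<alpha>\<close> is obtained from its values at the bifibrant objects \<open>QRx\<close>.\<close>

definition hat :: "'o \<Rightarrow> 'm" where
  "hat y = FA g (rmap B (FO h y)) \<odot>\<^bsub>D\<^esub> (Tr \<alpha> y \<odot>\<^bsub>D\<^esub> FA k (qmap C (FO f y)))"

abbreviation "kQf u \<equiv> FA k (QA C (FA f u))"
abbreviation "gRh u \<equiv> FA g (RA B (FA h u))"

lemma kQf_functor: "is_functor A D (\<lambda>x. FO k (QO C (FO f x))) kQf"
  by (rule is_functor_comp[OF f.g_functor k.L.is_functor])

lemma gRh_functor: "is_functor A D (\<lambda>x. FO g (RO B (FO h x))) gRh"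
  by (rule is_functor_comp[OF h.f_functor g.R.is_functor])

lemma hat_Arr:
  assumes "y \<in> Obj A"
  shows "hat y \<in> Arr D" "Dom D (hat y) = FO k (QO C (FO f y))" "Cod D (hat y) = FO g (RO B (FO h y))"
  using assms by (simp_all add: hat_def S)

lemma hat_natural:
  assumes u: "u \<in> Arr A"
  shows "hat (Cod A u) \<odot>\<^bsub>D\<^esub> FA k (QA C (FA f u)) = FA g (RA B (FA h u)) \<odot>\<^bsub>D\<^esub> hat (Dom A u)"
proof -
  have 1: "FA k (qmap C (FO f (Cod A u))) \<odot>\<^bsub>D\<^esub> FA k (QA C (FA f u)) =
      FA k (FA f u) \<odot>\<^bsub>D\<^esub> FA k (qmap C (FO f (Dom A u)))"
    using k.FA_qmap_natural[of "FA f u"] u by (simp add: S)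
  have 2: "FA g (rmap B (FO h (Cod A u))) \<odot>\<^bsub>D\<^esub> FA g (FA h u) =
      FA g (RA B (FA h u)) \<odot>\<^bsub>D\<^esub> FA g (rmap B (FO h (Dom A u)))"
    using g.FA_rmap_natural[of "FA h u"] u by (simp add: S)
  have 3: "(Tr \<alpha> (Cod A u) \<odot>\<^bsub>D\<^esub> FA k (qmap C (FO f (Cod A u)))) \<odot>\<^bsub>D\<^esub> FA k (QA C (FA f u)) =
      FA g (FA h u) \<odot>\<^bsub>D\<^esub> (Tr \<alpha> (Dom A u) \<odot>\<^bsub>D\<^esub> FA k (qmap C (FO f (Dom A u))))"
    by (rule D.square_comp[OF is_naturalD(4)[OF natural u] 1]) (use u in \<open>simp_all add: S\<close>)
  show ?thesis
    unfolding hat_def by (rule D.square_comp[OF 2 3]) (use u in \<open>simp_all add: S\<close>)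
qed

text \<open>The three forward arrows of the zigzag compose to \<open>hat\<close> at
  \<open>QRx\<close>, which leaves one formal inverse on either side.\<close>

lemma Tr_HoSquare:
  assumes x: "x \<in> Obj A"
  shows "Tr (HoSquare \<alpha>) x = bwd D (FA g (RA B (FA h (QA A (rmap A x))))) \<odot>\<^bsub>HoCat D\<^esub>
    (fwd D (hat (QO A (RO A x))) \<odot>\<^bsub>HoCat D\<^esub> bwd D (FA k (QA C (FA f (qmap A (RO A x))))))"
  using x
  by (simp add: HoSquare_def Let_def sides f.Src h.Tgt f.Tgt g.Tgt hat_def S D.zigzag_iff
    D.HoClass_Cons(1) D.HoClass_Cons(2) D.fwd_Comp flip: D.Ident_HoCat)

lemma HoSquare_sides:
  "STop (HoSquare \<alpha>) = Rder f" "SBot (HoSquare \<alpha>) = Rder g" "SLft (HoSquare \<alpha>) = Lder h"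
  "SRgt (HoSquare \<alpha>) = Lder k"
  by (simp_all add: HoSquare_def Let_def sides)

lemma Tr_HoSquare_Arr:
  assumes x: "x \<in> Obj A"
  shows "Tr (HoSquare \<alpha>) x \<in> Arr (HoCat D)" "Dom (HoCat D) (Tr (HoSquare \<alpha>) x) = FO k (QO C (FO f (RO A x)))"
    "Cod (HoCat D) (Tr (HoSquare \<alpha>) x) = FO g (RO B (FO h (QO A x)))"
  using x hat_Arr[of "QO A (RO A x)"] by (simp_all add: Tr_HoSquare S)

text \<open>One square for each factor in \<open>Tr_HoSquare\<close>: \<open>hat\<close> is natural
  at \<open>QRu\<close>, and the outer two are images of naturality squares of \<pi> and \<rho>,
  with the weak equivalences reversed by \<open>bwd_square\<close>.\<close>

lemma Tr_HoSquare_natural: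
  assumes u: "u \<in> Arr A"
  shows "Tr (HoSquare \<alpha>) (Cod A u) \<odot>\<^bsub>HoCat D\<^esub> fwd D (kQf (RA A u)) =
    fwd D (gRh (QA A u)) \<odot>\<^bsub>HoCat D\<^esub> Tr (HoSquare \<alpha>) (Dom A u)"
proof -
  let ?x = "(Dom A u)"
  let ?y = "(Cod A u)"
  let ?H = "HoCat D"
  have w: "qmap A (RO A ?y) \<odot>\<^bsub>A\<^esub> QA A (RA A u) = RA A u \<odot>\<^bsub>A\<^esub> qmap A (RO A ?x)"
    "QA A (rmap A ?y) \<odot>\<^bsub>A\<^esub> QA A u = QA A (RA A u) \<odot>\<^bsub>A\<^esub> QA A (rmap A ?x)"
    using A.QA(4)[of "RA A u"] is_functor_comm[OF A.is_functor_Q A.RA(4)[OF u]] u by (simp_all add: S)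
  have 1: "bwd D (kQf (qmap A (RO A ?y))) \<odot>\<^bsub>?H\<^esub> fwd D (kQf (RA A u)) =
      fwd D (kQf (QA A (RA A u))) \<odot>\<^bsub>?H\<^esub> bwd D (kQf (qmap A (RO A ?x)))"
    using u by (intro D.bwd_square is_functor_comm[OF kQf_functor w(1)]) (simp_all add: S)
  have 2: "fwd D (hat (QO A (RO A ?y))) \<odot>\<^bsub>?H\<^esub> fwd D (kQf (QA A (RA A u))) =
      fwd D (gRh (QA A (RA A u))) \<odot>\<^bsub>?H\<^esub> fwd D (hat (QO A (RO A ?x)))"
    using u hat_natural[of "QA A (RA A u)"] by (simp add: S hat_Arr flip: D.fwd_Comp)
  have 3: "bwd D (gRh (QA A (rmap A ?y))) \<odot>\<^bsub>?H\<^esub> fwd D (gRh (QA A (RA A u))) =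
      fwd D (gRh (QA A u)) \<odot>\<^bsub>?H\<^esub> bwd D (gRh (QA A (rmap A ?x)))"
    using u by (intro D.bwd_square is_functor_comm[OF gRh_functor w(2)]) (simp_all add: S)
  have 4: "(fwd D (hat (QO A (RO A ?y))) \<odot>\<^bsub>?H\<^esub> bwd D (kQf (qmap A (RO A ?y)))) \<odot>\<^bsub>?H\<^esub>
      fwd D (kQf (RA A u)) = fwd D (gRh (QA A (RA A u))) \<odot>\<^bsub>?H\<^esub>
      (fwd D (hat (QO A (RO A ?x))) \<odot>\<^bsub>?H\<^esub> bwd D (kQf (qmap A (RO A ?x))))"
    by (rule D.Ho.square_comp[OF 2 1]) (use u in \<open>simp_all add: S hat_Arr\<close>)
  have "(bwd D (gRh (QA A (rmap A ?y))) \<odot>\<^bsub>?H\<^esub> (fwd D (hat (QO A (RO A ?y))) \<odot>\<^bsub>?H\<^esub>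
      bwd D (kQf (qmap A (RO A ?y))))) \<odot>\<^bsub>?H\<^esub> fwd D (kQf (RA A u)) = fwd D (gRh (QA A u)) \<odot>\<^bsub>?H\<^esub>
      (bwd D (gRh (QA A (rmap A ?x))) \<odot>\<^bsub>?H\<^esub> (fwd D (hat (QO A (RO A ?x))) \<odot>\<^bsub>?H\<^esub>
      bwd D (kQf (qmap A (RO A ?x)))))"
    by (rule D.Ho.square_comp[OF 3 4]) (use u in \<open>simp_all add: S hat_Arr\<close>)
  then show ?thesis
    using u by (simp add: Tr_HoSquare A.cat_simps(1,2))
qed

lemma is_cell_square_HoSquare: "is_cell_square (HoSquare \<alpha>)"
proof -
  note LR = h.Lder_simps k.Lder_simps f.Rder_simps g.Rder_simps
  have "is_natural (HoCat A) (HoCat D) (\<lambda>x. FO (Lder k) (FO (Rder f) x)) (\<lambda>u. FA (Lder k) (FA (Rder f) u))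
      (\<lambda>x. FO (Rder g) (FO (Lder h) x)) (\<lambda>u. FA (Rder g) (FA (Lder h) u)) (Tr (HoSquare \<alpha>))"
    by (intro A.is_natural_HoCatI is_functor_comp[OF f.Rder_functor k.Lder_functor]
        is_functor_comp[OF h.Lder_functor g.Rder_functor])
      (simp_all add: LR S Tr_HoSquare_Arr Tr_HoSquare_natural)
  then show ?thesis
    by (simp add: is_cell_square_def is_functor_square_def HoSquare_sides LR)
      (simp add: HoSquare_def Let_def sides f.Src)
qed

text \<open>At fibrant \<open>y\<close>, \<rho> is a weak equivalence between fibrant objects, which
  \<open>f\<close> preserves, and \<open>kQ\<close> preserves all weak equivalences. The second
  claim is dual, with \<pi> at cofibrant \<open>y\<close>, \<open>h\<close> and
  \<open>gR\<close>.\<close>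

lemma kQf_rmap_Weq: "fibrant A y \<Longrightarrow> kQf (rmap A y) \<in> Weq D"
  and gRh_qmap_Weq: "cofibrant A y \<Longrightarrow> gRh (qmap A y) \<in> Weq D"
  by (simp_all add: k.FA_QA_Weq f.FA_rmap_Weq g.FA_RA_Weq h.FA_qmap_Weq)

text \<open>This determines \<open>Ho \<alpha>\<close>: for \<open>y\<close> bifibrant the outer two maps are invertible.\<close>

lemma Tr_HoSquare_hat:
  assumes y: "y \<in> Obj A"
  shows "fwd D (gRh (qmap A y)) \<odot>\<^bsub>HoCat D\<^esub> (Tr (HoSquare \<alpha>) y \<odot>\<^bsub>HoCat D\<^esub> fwd D (kQf (rmap A y))) =
    fwd D (hat y)"
proof -
  let ?T = "Tr (HoSquare \<alpha>) y"
  let ?r = "fwd D (kQf (rmap A y))"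
  let ?q = "fwd D (kQf (qmap A y))"
  let ?Qr = "fwd D (kQf (QA A (rmap A y)))"
  let ?Rq = "fwd D (kQf (qmap A (RO A y)))"
  let ?H = "HoCat D"
  note T = Tr_HoSquare_Arr[OF y]
  note W = D.fwd_bwd_inverse[of "kQf (qmap A y)"] D.fwd_bwd_inverse[of "kQf (qmap A (RO A y))"]
    D.fwd_bwd_inverse[of "gRh (QA A (rmap A y))"]
  \<comment> \<open>Precomposing further with \<pi> at \<open>y\<close> allows \<rho> and \<pi> to
    change places; this puts the image of \<pi> at \<open>Ry\<close> next to its formal inverse in
    \<open>Ho \<alpha>\<close>.\<close>
  have "rmap A y \<odot>\<^bsub>A\<^esub> qmap A y = qmap A (RO A y) \<odot>\<^bsub>A\<^esub> QA A (rmap A y)"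
    using A.QA(4)[of "rmap A y"] y by (simp add: S)
  then have 1: "?r \<odot>\<^bsub>?H\<^esub> ?q =
      ?Rq \<odot>\<^bsub>?H\<^esub> ?Qr"
    using y is_functor_comm[OF kQf_functor, of "rmap A y" "qmap A y"] by (simp add: S flip: D.fwd_Comp)
  have 2: "fwd D (hat (QO A (RO A y))) \<odot>\<^bsub>?H\<^esub> ?Qr =
      fwd D (gRh (QA A (rmap A y))) \<odot>\<^bsub>?H\<^esub> fwd D (hat (QO A y))"
    using y hat_natural[of "QA A (rmap A y)"] by (simp add: S hat_Arr flip: D.fwd_Comp)
  have 3: "fwd D (hat y) \<odot>\<^bsub>?H\<^esub> ?q = fwd D (gRh (qmap A y)) \<odot>\<^bsub>?H\<^esub> fwd D (hat (QO A y))"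
    using y hat_natural[of "qmap A y"] by (simp add: S hat_Arr flip: D.fwd_Comp)
  have "(?T \<odot>\<^bsub>?H\<^esub> ?r) \<odot>\<^bsub>?H\<^esub> ?q =
      ?T \<odot>\<^bsub>?H\<^esub> (?Rq \<odot>\<^bsub>?H\<^esub> ?Qr)"
    using y T 1 by (simp add: S)
  also have "\<dots> = bwd D (gRh (QA A (rmap A y))) \<odot>\<^bsub>?H\<^esub> (fwd D (hat (QO A (RO A y))) \<odot>\<^bsub>?H\<^esub>
      (bwd D (kQf (qmap A (RO A y))) \<odot>\<^bsub>?H\<^esub>
        (?Rq \<odot>\<^bsub>?H\<^esub> ?Qr)))"
    using y by (simp add: Tr_HoSquare S hat_Arr)
  also have "bwd D (kQf (qmap A (RO A y))) \<odot>\<^bsub>?H\<^esub>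
        (?Rq \<odot>\<^bsub>?H\<^esub> ?Qr) = ?Qr"
    using y by (intro D.Ho.inverse_Comp[OF W(2)]) (simp_all add: S)
  also have "bwd D (gRh (QA A (rmap A y))) \<odot>\<^bsub>?H\<^esub> (fwd D (hat (QO A (RO A y))) \<odot>\<^bsub>?H\<^esub> ?Qr) =
      fwd D (hat (QO A y))"
    unfolding 2 using y by (intro D.Ho.inverse_Comp[OF W(3)]) (simp_all add: S hat_Arr)
  finally have 4: "(?T \<odot>\<^bsub>?H\<^esub> ?r) \<odot>\<^bsub>?H\<^esub> ?q =
      fwd D (hat (QO A y))" .
  have "(fwd D (gRh (qmap A y)) \<odot>\<^bsub>?H\<^esub> (?T \<odot>\<^bsub>?H\<^esub> ?r)) \<odot>\<^bsub>?H\<^esub>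
      ?q = fwd D (gRh (qmap A y)) \<odot>\<^bsub>?H\<^esub>
      ((?T \<odot>\<^bsub>?H\<^esub> ?r) \<odot>\<^bsub>?H\<^esub> ?q)"
    by (rule D.Ho.assoc) (use y T in \<open>simp_all add: S\<close>)
  also have "\<dots> = fwd D (hat y) \<odot>\<^bsub>?H\<^esub> ?q"
    unfolding 4 3 ..
  \<comment> \<open>The auxiliary factor \<open>?q\<close> is invertible at every \<open>y\<close>,
    since right Quillen functors preserve the acyclic fibration \<pi> and \<open>kQ\<close>
    preserves weak equivalences.\<close>
  finally show ?thesis
    by (rule D.Ho.cancel_right[OF W(1), rotated -1]) (use y T in \<open>simp_all add: S hat_Arr\<close>)
qed

end

section \<open>Pasting\<close>

lemma left_quillen_functor_id: "model_category \<kappa> A \<Longrightarrow> left_quillen_functor \<kappa> A A (id_functor A)"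
  by (simp add: left_quillen_functor_def left_quillen_functor_axioms_def left_quillen_id)

lemma right_quillen_functor_id: "model_category \<kappa> A \<Longrightarrow> right_quillen_functor \<kappa> A A (id_functor A)"
  by (simp add: right_quillen_functor_def right_quillen_functor_axioms_def right_quillen_id)

lemma left_quillen_functor_comp:
  assumes "left_quillen_functor \<kappa> A B f" "left_quillen_functor \<kappa> B C g"
  shows "left_quillen_functor \<kappa> A C (comp_functor g f)"
proof -
  interpret f: left_quillen_functor \<kappa> A B f by fact
  interpret g: left_quillen_functor \<kappa> B C g by fact
  show ?thesis
    by unfold_locales
      (simp_all add: left_quillen_comp f.left_quillen g.left_quillen f.Src f.Tgt g.Src g.Tgt f.A.Cof_Arr)
qed

lemma right_quillen_functor_comp:
  assumes "right_quillen_functor \<kappa> A B f" "right_quillen_functor \<kappa> B C g"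
  shows "right_quillen_functor \<kappa> A C (comp_functor g f)"
proof -
  interpret f: right_quillen_functor \<kappa> A B f by fact
  interpret g: right_quillen_functor \<kappa> B C g by fact
  show ?thesis
    by unfold_locales
      (simp_all add: right_quillen_comp f.right_quillen g.right_quillen f.Src f.Tgt g.Src g.Tgt f.A.Fib_Arr)
qed

context category
begin

text \<open>The chase behind \<open>hcomp_bifibrant\<close>: 1 and 2 carry the right-hand wrapping
  \<open>q\<close> leftwards past \<open>r\<close> and \<open>s\<close>, after which 3 and 4 absorb
  the two components of \<open>Ho\<close>.\<close>

lemma paste_hcomp:
  assumes 1: "r \<odot> q = m \<odot> r'" and 2: "s \<odot> m = n \<odot> s'" and 3: "p \<odot> (t \<odot> n) = a \<odot> b" and 4: "b \<odot> (s' \<odot> r') = c"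
    and Arr: "r \<in> Arr C" "q \<in> Arr C" "m \<in> Arr C" "r' \<in> Arr C" "s \<in> Arr C" "n \<in> Arr C" "s' \<in> Arr C"
      "p \<in> Arr C" "t \<in> Arr C" "a \<in> Arr C" "b \<in> Arr C"
    and "Dom C r = Cod C q" "Dom C m = Cod C r'" "Dom C s = Cod C m" "Dom C n = Cod C s'"
      "Dom C p = Cod C t" "Dom C t = Cod C n" "Dom C a = Cod C b" "Dom C s' = Cod C r'" "Dom C b = Cod C s'"
      "Dom C s = Cod C r" "Dom C t = Cod C s"
  shows "(p \<odot> ((t \<odot> s) \<odot> r)) \<odot> q = a \<odot> c"
proof -
  have "(p \<odot> ((t \<odot> s) \<odot> r)) \<odot> q = p \<odot> (t \<odot> (s \<odot> (r \<odot> q)))"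
    using assms(5-) by (simp add: assoc Comp_Arr)
  also have "\<dots> = p \<odot> (t \<odot> ((s \<odot> m) \<odot> r'))" using assms(5-) by (simp add: 1 assoc Comp_Arr)
  also have "\<dots> = (p \<odot> (t \<odot> n)) \<odot> (s' \<odot> r')" unfolding 2 using assms(5-) by (simp add: assoc Comp_Arr)
  also have "\<dots> = a \<odot> (b \<odot> (s' \<odot> r'))" unfolding 3 using assms(5-) by (simp add: assoc Comp_Arr)
  finally show ?thesis using 4 by simp
qed

text \<open>The mirror image, behind \<open>vcomp_bifibrant\<close>: the left-hand wrapping
  \<open>q\<close> travels rightwards past \<open>r\<close> and \<open>s\<close>.\<close>

lemma paste_vcomp:
  assumes 1: "q \<odot> r = r' \<odot> m" and 2: "m \<odot> s = s' \<odot> n" and 3: "(n \<odot> t) \<odot> p = b \<odot> a" and 4: "(r' \<odot> s') \<odot> b = c"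
    and Arr: "r \<in> Arr C" "q \<in> Arr C" "m \<in> Arr C" "r' \<in> Arr C" "s \<in> Arr C" "n \<in> Arr C" "s' \<in> Arr C"
      "p \<in> Arr C" "t \<in> Arr C" "a \<in> Arr C" "b \<in> Arr C"
    and "Dom C q = Cod C r" "Dom C r' = Cod C m" "Dom C m = Cod C s" "Dom C s' = Cod C n"
      "Dom C t = Cod C p" "Dom C n = Cod C t" "Dom C b = Cod C a" "Dom C r' = Cod C s'" "Dom C s' = Cod C b"
      "Dom C r = Cod C s" "Dom C s = Cod C t"
  shows "q \<odot> ((r \<odot> (s \<odot> t)) \<odot> p) = c \<odot> a"
proof -
  have "q \<odot> ((r \<odot> (s \<odot> t)) \<odot> p) = (q \<odot> r) \<odot> (s \<odot> (t \<odot> p))"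
    using assms(5-) by (simp add: assoc Comp_Arr)
  also have "\<dots> = r' \<odot> ((m \<odot> s) \<odot> (t \<odot> p))" unfolding 1 using assms(5-) by (simp add: assoc Comp_Arr)
  also have "\<dots> = (r' \<odot> s') \<odot> ((n \<odot> t) \<odot> p)" unfolding 2 using assms(5-) by (simp add: assoc Comp_Arr)
  also have "\<dots> = ((r' \<odot> s') \<odot> b) \<odot> a" unfolding 3 using assms(5-) by (simp add: assoc Comp_Arr)
  finally show ?thesis using 4 by simp
qed

end

section \<open>Horizontal pasting of derived squares\<close>

locale hcomp_squares =
  \<alpha>: quillen_square \<kappa> A B C D f g h k \<alpha> + \<beta>: quillen_square \<kappa> C D E F f' g' k l \<beta>
  for \<kappa> :: "'s::infinite itself" and A B C D E F :: "('o, 'm) model_data" and f g h k f' g' l \<alpha> \<beta>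
begin

sublocale \<gamma>: quillen_square \<kappa> A B E F "comp_functor f' f" "comp_functor g' g" h l "square_hcomp \<alpha> \<beta>"
proof (intro quillen_square.intro quillen_square_axioms.intro)
  show "right_quillen_functor \<kappa> A E (comp_functor f' f)"
    by (rule right_quillen_functor_comp[OF \<alpha>.f.right_quillen_functor_axioms \<beta>.f.right_quillen_functor_axioms])
  show "right_quillen_functor \<kappa> B F (comp_functor g' g)"
    by (rule right_quillen_functor_comp[OF \<alpha>.g.right_quillen_functor_axioms \<beta>.g.right_quillen_functor_axioms])
  show "is_functor_square (square_hcomp \<alpha> \<beta>)"
    by (rule cell_squareD(5)[OF cell_square_hcomp[OF \<alpha>.cell_square \<beta>.cell_square]])
      (simp add: \<alpha>.sides \<beta>.sides)
qed (simp_all add: \<alpha>.sides \<beta>.sides \<alpha>.A.model_category_axioms \<alpha>.B.model_category_axioms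
  \<beta>.C.model_category_axioms \<beta>.D.model_category_axioms \<alpha>.h.left_quillen_functor_axioms \<beta>.k.left_quillen_functor_axioms)

abbreviation Ho_Comp (infixl "\<cdot>" 70) where "v \<cdot> u \<equiv> v \<odot>\<^bsub>HoCat F\<^esub> u"

lemmas SS = \<alpha>.S \<beta>.S \<alpha>.hat_Arr \<beta>.hat_Arr \<gamma>.hat_Arr \<alpha>.Tr_HoSquare_Arr \<beta>.Tr_HoSquare_Arr \<gamma>.Tr_HoSquare_Arr
  is_functorD(3-6)[OF \<beta>.g.Rder_functor, unfolded \<alpha>.D.Obj_HoCat \<beta>.D.Obj_HoCat] \<beta>.g.Rder_simps

lemma Tr_hcomp: "x \<in> Obj A \<Longrightarrow> Tr (square_hcomp \<alpha> \<beta>) x = FA g' (Tr \<alpha> x) \<odot>\<^bsub>F\<^esub> Tr \<beta> (FO f x)"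
  by (simp add: Tr_simps \<alpha>.sides \<beta>.sides \<alpha>.f.Src \<beta>.g.Tgt)

text \<open>A component of the naturality axiom for horizontal composition. Both sides are
  multiplied by \<open>?p\<close>, an image of \<pi> at \<open>x\<close>, and by \<open>?q\<close>,
  an image of \<rho> at \<open>x\<close>. These are invertible for bifibrant \<open>x\<close>, and
  with them every \<open>Ho\<close> can be traded for a \<open>hat\<close>.\<close>

lemma hcomp_bifibrant:
  assumes x: "x \<in> Obj A" "cofibrant A x" "fibrant A x"
  shows "(FA (Rder g') (Tr (HoSquare \<alpha>) x) \<cdot> Tr (HoSquare \<beta>) (FO f (RO A x))) \<cdot>
      fwd F (\<beta>.kQf (rmap C (FO f (RO A x)))) =
    fwd F (FA g' (rmap D (FO g (RO B (FO h (QO A x)))))) \<cdot> Tr (HoSquare (square_hcomp \<alpha> \<beta>)) x"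
proof -
  let ?p = "fwd F (FA g' (RA D (\<alpha>.gRh (qmap A x))))"
  let ?q = "fwd F (\<beta>.kQf (FA f (rmap A x)))"
  let ?r = "fwd F (\<beta>.kQf (rmap C (FO f (RO A x))))"
  let ?s = "fwd F (FA g' (rmap D (FO g (RO B (FO h (QO A x))))))"
  let ?s' = "fwd F (FA g' (rmap D (FO g (RO B (FO h x)))))"
  let ?T = "Tr (HoSquare (square_hcomp \<alpha> \<beta>)) x"
  let ?R = "FA (Rder g')"
  \<comment> \<open>The part of the \<open>hat\<close> of \<alpha> that follows \<pi>. The remaining
    factor, the image under \<open>k\<close> of \<pi> at \<open>fx\<close>, is split off because
    \<open>Tr_HoSquare_hat\<close> for \<beta> needs exactly this map on its left.\<close>
  define z where "z = FA g (rmap B (FO h x)) \<odot>\<^bsub>D\<^esub> Tr \<alpha> x"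
  have z: "z \<in> Arr D" "Dom D z = FO k (FO f x)" "Cod D z = FO g (RO B (FO h x))"
    using x by (simp_all add: z_def SS)
  have hat_z: "\<alpha>.hat x = z \<odot>\<^bsub>D\<^esub> FA k (qmap C (FO f x))"
    using x by (simp add: z_def \<alpha>.hat_def SS)
  have 1: "?r \<cdot> ?q =
      fwd F (\<beta>.kQf (RA C (FA f (rmap A x)))) \<cdot> fwd F (\<beta>.kQf (rmap C (FO f x)))"
    using x is_functor_comm[OF \<beta>.kQf_functor \<alpha>.C.RA(4)[of "FA f (rmap A x)"]]
    by (simp add: SS flip: \<beta>.D.fwd_Comp)
  \<comment> \<open>\<open>Ho \<beta>\<close> is given at \<open>fRx\<close> but comparable with the
    \<open>hat\<close> of \<beta> at \<open>fx\<close>; naturality along the image of \<rho> moves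
    between the two.\<close>
  have 2: "Tr (HoSquare \<beta>) (FO f (RO A x)) \<cdot> fwd F (\<beta>.kQf (RA C (FA f (rmap A x)))) =
      fwd F (\<beta>.gRh (QA C (FA f (rmap A x)))) \<cdot> Tr (HoSquare \<beta>) (FO f x)"
    using x \<beta>.Tr_HoSquare_natural[of "FA f (rmap A x)"] by (simp add: SS)
  have "?R (fwd D (\<alpha>.gRh (qmap A x)) \<odot>\<^bsub>HoCat D\<^esub> (Tr (HoSquare \<alpha>) x \<odot>\<^bsub>HoCat D\<^esub> fwd D (\<alpha>.kQf (rmap A x)))) =
      fwd F (FA g' (RA D (\<alpha>.hat x)))"
    unfolding \<alpha>.Tr_HoSquare_hat[OF x(1)] using x by (simp add: SS)
  then have 3: "?p \<cdot> (?R (Tr (HoSquare \<alpha>) x) \<cdot>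
      fwd F (\<beta>.gRh (QA C (FA f (rmap A x))))) = fwd F (FA g' (RA D z)) \<cdot> fwd F (\<beta>.gRh (qmap C (FO f x)))"
    using x z by (simp add: SS is_functorD(8)[OF \<beta>.g.Rder_functor] hat_z \<beta>.D.fwd_Comp)
  \<comment> \<open>The object \<open>fx\<close> is not known to be cofibrant, so this rests on
    \<open>Tr_HoSquare_hat\<close> being valid at every object.\<close>
  have 4: "fwd F (\<beta>.gRh (qmap C (FO f x))) \<cdot> (Tr (HoSquare \<beta>) (FO f x) \<cdot> fwd F (\<beta>.kQf (rmap C (FO f x)))) =
      fwd F (\<beta>.hat (FO f x))"
    by (rule \<beta>.Tr_HoSquare_hat) (use x in \<open>simp add: SS\<close>)
  \<comment> \<open>Here the hats of \<beta> and of the composite square meet: naturality of \<rho>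
    at \<open>z\<close>, in the model category \<open>F\<close>.\<close>
  have 5: "FA g' (RA D z) \<odot>\<^bsub>F\<^esub> \<beta>.hat (FO f x) = FA g' (rmap D (FO g (RO B (FO h x)))) \<odot>\<^bsub>F\<^esub> \<gamma>.hat x"
  proof -
    have "FA g' (RA D z) \<odot>\<^bsub>F\<^esub> \<beta>.hat (FO f x) = (FA g' (RA D z) \<odot>\<^bsub>F\<^esub> FA g' (rmap D (Dom D z))) \<odot>\<^bsub>F\<^esub>
        (Tr \<beta> (FO f x) \<odot>\<^bsub>F\<^esub> FA l (qmap E (FO f' (FO f x))))"
      using x z by (simp add: \<beta>.hat_def SS)
    also have "\<dots> = (FA g' (rmap D (Cod D z)) \<odot>\<^bsub>F\<^esub> FA g' z) \<odot>\<^bsub>F\<^esub>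
        (Tr \<beta> (FO f x) \<odot>\<^bsub>F\<^esub> FA l (qmap E (FO f' (FO f x))))"
      unfolding \<beta>.g.FA_rmap_natural[OF z(1)] ..
    also have "\<dots> = FA g' (rmap D (FO g (RO B (FO h x)))) \<odot>\<^bsub>F\<^esub> \<gamma>.hat x"
      using x by (simp add: \<gamma>.hat_def SS z Tr_hcomp) (simp add: z_def SS)
    finally show ?thesis .
  qed
  have "(?p \<cdot> ((?R (Tr (HoSquare \<alpha>) x) \<cdot> Tr (HoSquare \<beta>) (FO f (RO A x))) \<cdot>
      ?r)) \<cdot> ?q =
      fwd F (FA g' (RA D z)) \<cdot> fwd F (\<beta>.hat (FO f x))"
    by (rule \<beta>.D.Ho.paste_hcomp[OF 1 2 3 4]) (use x z in \<open>simp_all add: SS\<close>)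
  also have "\<dots> = ?s' \<cdot> fwd F (\<gamma>.hat x)"
    using x z 5 by (simp add: SS flip: \<beta>.D.fwd_Comp)
  also have "\<dots> = ?s' \<cdot> (fwd F (\<gamma>.gRh (qmap A x)) \<cdot>
      (?T \<cdot> fwd F (\<gamma>.kQf (rmap A x))))"
    using \<gamma>.Tr_HoSquare_hat[OF x(1)] by simp
  also have "\<dots> = (?s' \<cdot> fwd F (FA g' (\<alpha>.gRh (qmap A x)))) \<cdot>
      (?T \<cdot> ?q)"
    using x by (simp add: SS)
  \<comment> \<open>Naturality of \<rho> once more, bringing \<open>?p\<close> to the outside so
    that it can be cancelled.\<close>
  also have "?s' \<cdot> fwd F (FA g' (\<alpha>.gRh (qmap A x))) =
      ?p \<cdot> ?s"
    using x \<beta>.g.FA_rmap_natural[of "\<alpha>.gRh (qmap A x)"] by (simp add: SS flip: \<beta>.D.fwd_Comp)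
  finally have eq: "(?p \<cdot> ((?R (Tr (HoSquare \<alpha>) x) \<cdot> Tr (HoSquare \<beta>) (FO f (RO A x))) \<cdot>
      ?r)) \<cdot> ?q =
      (?p \<cdot> (?s \<cdot>
      ?T)) \<cdot> ?q"
    using x by (simp add: SS)
  have inv: "inverse_arrows (HoCat F) (?q) (bwd F (\<beta>.kQf (FA f (rmap A x))))"
    "inverse_arrows (HoCat F) (?p) (bwd F (FA g' (RA D (\<alpha>.gRh (qmap A x)))))"
    using x \<gamma>.kQf_rmap_Weq[of x] \<alpha>.gRh_qmap_Weq[of x]
    by (auto intro!: \<beta>.D.fwd_bwd_inverse \<beta>.g.FA_RA_Weq simp: SS)
  show ?thesis
    by (rule \<beta>.D.Ho.cancel_left[OF inv(2) _ _ _ _ \<beta>.D.Ho.cancel_right[OF inv(1) _ _ _ _ eq]])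
      (use x in \<open>simp_all add: SS\<close>)
qed

end

section \<open>Vertical pasting of derived squares\<close>

locale vcomp_squares =
  \<alpha>: quillen_square \<kappa> A B C D f g h k \<alpha> + \<beta>: quillen_square \<kappa> B E D F g g' h' k' \<beta>
  for \<kappa> :: "'s::infinite itself" and A B C D E F :: "('o, 'm) model_data" and f g h k g' h' k' \<alpha> \<beta>
begin

sublocale \<gamma>: quillen_square \<kappa> A E C F f g' "comp_functor h' h" "comp_functor k' k" "square_vcomp \<beta> \<alpha>"
proof (intro quillen_square.intro quillen_square_axioms.intro)
  show "left_quillen_functor \<kappa> A E (comp_functor h' h)"
    by (rule left_quillen_functor_comp[OF \<alpha>.h.left_quillen_functor_axioms \<beta>.h.left_quillen_functor_axioms])
  show "left_quillen_functor \<kappa> C F (comp_functor k' k)"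
    by (rule left_quillen_functor_comp[OF \<alpha>.k.left_quillen_functor_axioms \<beta>.k.left_quillen_functor_axioms])
  show "is_functor_square (square_vcomp \<beta> \<alpha>)"
    by (rule cell_squareD(5)[OF cell_square_vcomp[OF \<alpha>.cell_square \<beta>.cell_square]])
      (simp add: \<alpha>.sides \<beta>.sides)
qed (simp_all add: \<alpha>.sides \<beta>.sides \<alpha>.A.model_category_axioms \<beta>.B.model_category_axioms
  \<alpha>.C.model_category_axioms \<beta>.D.model_category_axioms \<alpha>.f.right_quillen_functor_axioms \<beta>.g.right_quillen_functor_axioms)

abbreviation Ho_Comp (infixl "\<cdot>" 70) where "v \<cdot> u \<equiv> v \<odot>\<^bsub>HoCat F\<^esub> u"

lemmas SS = \<alpha>.S \<beta>.S \<alpha>.hat_Arr \<beta>.hat_Arr \<gamma>.hat_Arr \<alpha>.Tr_HoSquare_Arr \<beta>.Tr_HoSquare_Arr \<gamma>.Tr_HoSquare_Arr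
  is_functorD(3-6)[OF \<beta>.k.Lder_functor, unfolded \<alpha>.D.Obj_HoCat \<beta>.D.Obj_HoCat] \<beta>.k.Lder_simps

lemma Tr_vcomp: "x \<in> Obj A \<Longrightarrow> Tr (square_vcomp \<beta> \<alpha>) x = Tr \<beta> (FO h x) \<odot>\<^bsub>F\<^esub> FA k' (Tr \<alpha> x)"
  by (simp add: Tr_simps \<alpha>.sides \<beta>.sides \<alpha>.f.Src \<beta>.g.Tgt)

lemma vcomp_bifibrant:
  assumes x: "x \<in> Obj A" "cofibrant A x" "fibrant A x"
  shows "fwd F (\<beta>.gRh (qmap B (FO h (QO A x)))) \<cdot>
      (Tr (HoSquare \<beta>) (FO h (QO A x)) \<cdot> FA (Lder k') (Tr (HoSquare \<alpha>) x)) =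
    Tr (HoSquare (square_vcomp \<beta> \<alpha>)) x \<cdot> fwd F (FA k' (qmap D (FO k (QO C (FO f (RO A x))))))"
proof -
  let ?p = "fwd F (\<beta>.gRh (FA h (qmap A x)))"
  let ?q = "fwd F (FA k' (QA D (\<alpha>.kQf (rmap A x))))"
  let ?r = "fwd F (\<beta>.gRh (qmap B (FO h (QO A x))))"
  let ?s = "fwd F (FA k' (qmap D (FO k (QO C (FO f (RO A x))))))"
  let ?s' = "fwd F (FA k' (qmap D (FO k (QO C (FO f x)))))"
  let ?T = "Tr (HoSquare (square_vcomp \<beta> \<alpha>)) x"
  let ?L = "FA (Lder k')"
  \<comment> \<open>This time the part of the \<open>hat\<close> of \<alpha> before \<rho>; the
    image of \<rho> at \<open>hx\<close> is left for \<open>Tr_HoSquare_hat\<close> of \<beta>,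
    which again is needed at an object \<open>hx\<close> not known to be bifibrant.\<close>
  define z where "z = Tr \<alpha> x \<odot>\<^bsub>D\<^esub> FA k (qmap C (FO f x))"
  have z: "z \<in> Arr D" "Dom D z = FO k (QO C (FO f x))" "Cod D z = FO g (FO h x)"
    using x by (simp_all add: z_def SS)
  have hat_z: "\<alpha>.hat x = FA g (rmap B (FO h x)) \<odot>\<^bsub>D\<^esub> z"
    by (simp add: z_def \<alpha>.hat_def)
  have 1: "?p \<cdot> ?r =
      fwd F (\<beta>.gRh (qmap B (FO h x))) \<cdot> fwd F (\<beta>.gRh (QA B (FA h (qmap A x))))"
    using x is_functor_comm[OF \<beta>.gRh_functor \<alpha>.B.QA(4)[of "FA h (qmap A x)"]]
    by (simp add: SS flip: \<beta>.D.fwd_Comp)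
  have 2: "fwd F (\<beta>.gRh (QA B (FA h (qmap A x)))) \<cdot> Tr (HoSquare \<beta>) (FO h (QO A x)) =
      Tr (HoSquare \<beta>) (FO h x) \<cdot> fwd F (\<beta>.kQf (RA B (FA h (qmap A x))))"
    using x \<beta>.Tr_HoSquare_natural[of "FA h (qmap A x)"] by (simp add: SS)
  have "?L (fwd D (\<alpha>.gRh (qmap A x)) \<odot>\<^bsub>HoCat D\<^esub> (Tr (HoSquare \<alpha>) x \<odot>\<^bsub>HoCat D\<^esub> fwd D (\<alpha>.kQf (rmap A x)))) =
      fwd F (FA k' (QA D (\<alpha>.hat x)))"
    unfolding \<alpha>.Tr_HoSquare_hat[OF x(1)] using x by (simp add: SS)
  then have 3: "(fwd F (\<beta>.kQf (RA B (FA h (qmap A x)))) \<cdot> ?L (Tr (HoSquare \<alpha>) x)) \<cdot>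
      ?q = fwd F (\<beta>.kQf (rmap B (FO h x))) \<cdot> fwd F (FA k' (QA D z))"
    using x z by (simp add: SS is_functorD(8)[OF \<beta>.k.Lder_functor] hat_z \<beta>.D.fwd_Comp)
  have 4: "(fwd F (\<beta>.gRh (qmap B (FO h x))) \<cdot> Tr (HoSquare \<beta>) (FO h x)) \<cdot> fwd F (\<beta>.kQf (rmap B (FO h x))) =
      fwd F (\<beta>.hat (FO h x))"
    using x \<beta>.Tr_HoSquare_hat[of "FO h x"] by (simp add: SS)
  \<comment> \<open>Naturality of \<pi> at \<open>z\<close>.\<close>
  have 5: "\<beta>.hat (FO h x) \<odot>\<^bsub>F\<^esub> FA k' (QA D z) = \<gamma>.hat x \<odot>\<^bsub>F\<^esub> FA k' (qmap D (FO k (QO C (FO f x))))"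
  proof -
    have "\<beta>.hat (FO h x) \<odot>\<^bsub>F\<^esub> FA k' (QA D z) = (FA g' (rmap E (FO h' (FO h x))) \<odot>\<^bsub>F\<^esub> Tr \<beta> (FO h x)) \<odot>\<^bsub>F\<^esub>
        (FA k' (qmap D (Cod D z)) \<odot>\<^bsub>F\<^esub> FA k' (QA D z))"
      using x z by (simp add: \<beta>.hat_def SS)
    also have "\<dots> = (FA g' (rmap E (FO h' (FO h x))) \<odot>\<^bsub>F\<^esub> Tr \<beta> (FO h x)) \<odot>\<^bsub>F\<^esub>
        (FA k' z \<odot>\<^bsub>F\<^esub> FA k' (qmap D (Dom D z)))"
      unfolding \<beta>.k.FA_qmap_natural[OF z(1)] ..
    also have "\<dots> = \<gamma>.hat x \<odot>\<^bsub>F\<^esub> FA k' (qmap D (FO k (QO C (FO f x))))"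
      using x by (simp add: \<gamma>.hat_def SS z Tr_vcomp) (simp add: z_def SS)
    finally show ?thesis .
  qed
  have "?p \<cdot> ((?r \<cdot>
      (Tr (HoSquare \<beta>) (FO h (QO A x)) \<cdot> ?L (Tr (HoSquare \<alpha>) x))) \<cdot> ?q) =
      fwd F (\<beta>.hat (FO h x)) \<cdot> fwd F (FA k' (QA D z))"
    by (rule \<beta>.D.Ho.paste_vcomp[OF 1 2 3 4]) (use x z in \<open>simp_all add: SS\<close>)
  also have "\<dots> = fwd F (\<gamma>.hat x) \<cdot> ?s'"
    using x z 5 by (simp add: SS flip: \<beta>.D.fwd_Comp)
  also have "\<dots> = (fwd F (\<gamma>.gRh (qmap A x)) \<cdot> (?T \<cdot> fwd F (\<gamma>.kQf (rmap A x)))) \<cdot>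
      ?s'"
    using \<gamma>.Tr_HoSquare_hat[OF x(1)] by simp
  also have "\<dots> = (?p \<cdot> ?T) \<cdot>
      (fwd F (FA k' (\<alpha>.kQf (rmap A x))) \<cdot> ?s')"
    using x by (simp add: SS)
  also have "fwd F (FA k' (\<alpha>.kQf (rmap A x))) \<cdot> ?s' =
      ?s \<cdot> ?q"
    using x \<beta>.k.FA_qmap_natural[of "\<alpha>.kQf (rmap A x)"] by (simp add: SS flip: \<beta>.D.fwd_Comp)
  finally have eq: "?p \<cdot> ((?r \<cdot>
      (Tr (HoSquare \<beta>) (FO h (QO A x)) \<cdot> ?L (Tr (HoSquare \<alpha>) x))) \<cdot> ?q) =
      ?p \<cdot> ((?T \<cdot>
      ?s) \<cdot> ?q)"
    using x by (simp add: SS)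
  have inv: "inverse_arrows (HoCat F) (?p) (bwd F (\<beta>.gRh (FA h (qmap A x))))"
    "inverse_arrows (HoCat F) (?q) (bwd F (FA k' (QA D (\<alpha>.kQf (rmap A x)))))"
    using x \<gamma>.gRh_qmap_Weq[of x] \<alpha>.kQf_rmap_Weq[of x]
    by (auto intro!: \<beta>.D.fwd_bwd_inverse \<beta>.k.FA_QA_Weq simp: SS)
  show ?thesis
    by (rule \<beta>.D.Ho.cancel_right[OF inv(2) _ _ _ _ \<beta>.D.Ho.cancel_left[OF inv(1) _ _ _ _ eq]])
      (use x in \<open>simp_all add: SS\<close>)
qed

end

section \<open>Constraint cells\<close>

lemma (in model_category) bwd_Comp_Weq:
  "f \<in> Weq M \<Longrightarrow> g \<in> Weq M \<Longrightarrow> Dom M g = Cod M f \<Longrightarrow> bwd M (g \<odot> f) = bwd M f \<odot>\<^bsub>HoCat M\<^esub> bwd M g"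
  by (intro bwd_Comp Weq_Comp) simp_all

text \<open>\<open>natural_eq_bifibrant\<close> in the form needed for squares: with equal
  boundaries both sides are transformations between the same functors, and off the objects both are
  \<open>undefined\<close>.\<close>

lemma (in model_category) square_eq_bifibrant:
  assumes s: "is_cell_square s" and t: "is_cell_square t"
    and eq: "STop s = STop t" "SLft s = SLft t" "SRgt s = SRgt t" "SBot s = SBot t"
    and src: "Src (STop t) = HoCat M"
    and bif: "\<And>y. y \<in> Obj M \<Longrightarrow> cofibrant M y \<Longrightarrow> fibrant M y \<Longrightarrow> Tr s y = Tr t y"
  shows "s = t"
proof (rule square_data_eqI)
  fix x
  note F = cell_squareD[OF t] and S = cell_square_simps(5-8)[OF t]
  have 1: "is_functor (HoCat M) (Tgt (SRgt t)) (\<lambda>x. FO (SRgt t) (FO (STop t) x)) (\<lambda>u. FA (SRgt t) (FA (STop t) u))"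
    using is_functor_comp is_functor_cellD(1)[OF F(1)] is_functor_cellD(1)[OF F(4)] S src by metis
  have 2: "is_functor (HoCat M) (Tgt (SRgt t)) (\<lambda>x. FO (SBot t) (FO (SLft t) x)) (\<lambda>u. FA (SBot t) (FA (SLft t) u))"
    using is_functor_comp is_functor_cellD(1)[OF F(2)] is_functor_cellD(1)[OF F(3)] S src by metis
  show "Tr s x = Tr t x"
  proof (cases "x \<in> Obj M")
    case True
    show ?thesis
      by (rule natural_eq_bifibrant[OF 1 2 _ _ _ True])
        (use is_functor_squareD(5)[OF cell_squareD(5)[OF s]] is_functor_squareD(5)[OF F(5)] bif in
          \<open>simp_all add: eq src\<close>)
  next
    case False
    then show ?thesis
      using cell_square_simps(12)[OF s] cell_square_simps(12)[OF t] by (simp add: eq src)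
  qed
qed (use eq in simp_all)

lemmas id_cell_functor = is_functor_cellD(1)[OF is_functor_cell_id, unfolded id_functor_simps]

section \<open>Unit cells\<close>

context model_category
begin

interpretation idL: left_quillen_functor \<kappa> M M "id_functor M"
  by (rule left_quillen_functor_id) (rule model_category_axioms)

interpretation idR: right_quillen_functor \<kappa> M M "id_functor M"
  by (rule right_quillen_functor_id) (rule model_category_axioms)

lemma HoUnitV_sides [simp]:
  "STop (HoUnitV M) = id_functor (HoCat M)" "SBot (HoUnitV M) = id_functor (HoCat M)"
  "SLft (HoUnitV M) = id_functor (HoCat M)" "SRgt (HoUnitV M) = Lder (id_functor M)"
  by (simp_all add: HoUnitV_def)

lemma HoUnitH_sides [simp]:
  "STop (HoUnitH M) = Rder (id_functor M)" "SBot (HoUnitH M) = id_functor (HoCat M)"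
  "SLft (HoUnitH M) = id_functor (HoCat M)" "SRgt (HoUnitH M) = id_functor (HoCat M)"
  by (simp_all add: HoUnitH_def)

lemma Tr_HoUnitV: "x \<in> Obj M \<Longrightarrow> Tr (HoUnitV M) x = fwd M (qmap M x)"
  by (simp add: HoUnitV_def HoClass_single model_simps)

lemma Tr_HoUnitH: "x \<in> Obj M \<Longrightarrow> Tr (HoUnitH M) x = bwd M (rmap M x)"
  by (simp add: HoUnitH_def HoClass_single model_simps)

lemma is_cell_square_HoUnitV: "is_cell_square (HoUnitV M)"
proof -
  have "is_natural (HoCat M) (HoCat M)
      (\<lambda>x. FO (Lder (id_functor M)) (FO (id_functor (HoCat M)) x))
      (\<lambda>u. FA (Lder (id_functor M)) (FA (id_functor (HoCat M)) u))
      (\<lambda>x. FO (id_functor (HoCat M)) (FO (id_functor (HoCat M)) x))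
      (\<lambda>u. FA (id_functor (HoCat M)) (FA (id_functor (HoCat M)) u)) (Tr (HoUnitV M))"
    by (intro is_natural_HoCatI is_functor_comp[OF id_cell_functor idL.Lder_functor]
        is_functor_comp[OF id_cell_functor id_cell_functor])
      (simp_all add: model_simps Tr_HoUnitV idL.Lder_simps category_HoCat QA(4) flip: fwd_Comp)
  then show ?thesis
    by (simp add: is_cell_square_def is_functor_square_def idL.Lder_simps is_functor_cell_id category_HoCat)
      (simp add: HoUnitV_def)
qed

lemma is_cell_square_HoUnitH: "is_cell_square (HoUnitH M)"
proof -
  have "is_natural (HoCat M) (HoCat M)
      (\<lambda>x. FO (id_functor (HoCat M)) (FO (Rder (id_functor M)) x))
      (\<lambda>u. FA (id_functor (HoCat M)) (FA (Rder (id_functor M)) u))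
      (\<lambda>x. FO (id_functor (HoCat M)) (FO (id_functor (HoCat M)) x))
      (\<lambda>u. FA (id_functor (HoCat M)) (FA (id_functor (HoCat M)) u)) (Tr (HoUnitH M))"
    by (intro is_natural_HoCatI is_functor_comp[OF idR.Rder_functor id_cell_functor]
        is_functor_comp[OF id_cell_functor id_cell_functor])
      (simp_all add: model_simps Tr_HoUnitH idR.Rder_simps category_HoCat bwd_square RA(4))
  then show ?thesis
    by (simp add: is_cell_square_def is_functor_square_def idR.Rder_simps is_functor_cell_id category_HoCat)
      (simp add: HoUnitH_def)
qed

text \<open>The inverse is named explicitly because the axiom for the squares $1_f$ composes with
  \<open>inverse_arrow\<close> of this cell.\<close>

lemma inverse_HoUnitV:
  "inverse_arrows (SqH Cat) (HoUnitV M) \<lparr>STop = id_functor (HoCat M), SLft = Lder (id_functor M),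
    SRgt = id_functor (HoCat M), SBot = id_functor (HoCat M), Tr = (\<lambda>x\<in>Obj M. bwd M (qmap M x))\<rparr>"
  using v_globular_invertible[OF is_cell_square_HoUnitV HoUnitV_sides(1,2), of "\<lambda>x. bwd M (qmap M x)"]
  by (simp add: Tr_HoUnitV fwd_bwd_inverse model_simps)

lemma inverse_HoUnitH:
  "inverse_arrows (SqV Cat) (HoUnitH M) \<lparr>STop = id_functor (HoCat M), SLft = id_functor (HoCat M),
    SRgt = id_functor (HoCat M), SBot = Rder (id_functor M), Tr = (\<lambda>x\<in>Obj M. fwd M (rmap M x))\<rparr>"
  using h_globular_invertible[OF is_cell_square_HoUnitH HoUnitH_sides(3,4), of "\<lambda>x. fwd M (rmap M x)"]
  by (simp add: Tr_HoUnitH bwd_fwd_inverse model_simps)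

end

section \<open>Composition cells\<close>

locale left_quillen_pair =
  f: left_quillen_functor \<kappa> A B f + g: left_quillen_functor \<kappa> B C g
  for \<kappa> :: "'s::infinite itself" and A B C :: "('o, 'm) model_data" and f g
begin

sublocale gf: left_quillen_functor \<kappa> A C "comp_functor g f"
  by (rule left_quillen_functor_comp[OF f.left_quillen_functor_axioms g.left_quillen_functor_axioms])

lemmas S = f.A.model_simps f.B.model_simps g.B.model_simps f.f_simps g.f_simps f.Lder_simps g.Lder_simps
  gf.Lder_simps f.FA_QA_Weq g.FA_QA_Weq gf.FA_QA_Weq f.cofibrant_FO_QO g.FA_qmap_Weq

lemma HoCompV_sides [simp]:
  "STop (HoCompV g f) = id_functor (HoCat A)" "SBot (HoCompV g f) = id_functor (HoCat C)"
  "SLft (HoCompV g f) = comp_functor (Lder g) (Lder f)" "SRgt (HoCompV g f) = Lder (comp_functor g f)"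
  by (simp_all add: HoCompV_def Let_def S)

lemma Tr_HoCompV: "x \<in> Obj A \<Longrightarrow> Tr (HoCompV g f) x = bwd C (FA g (qmap B (FO f (QO A x))))"
  by (simp add: HoCompV_def Let_def S g.B.HoClass_single)

lemma is_cell_square_HoCompV: "is_cell_square (HoCompV g f)"
proof -
  have nat: "bwd C (FA g (qmap B (FO f (QO A (Cod A u))))) \<odot>\<^bsub>HoCat C\<^esub> fwd C (FA g (FA f (QA A u))) =
      fwd C (FA g (QA B (FA f (QA A u)))) \<odot>\<^bsub>HoCat C\<^esub> bwd C (FA g (qmap B (FO f (QO A (Dom A u)))))"
    if "u \<in> Arr A" for u
    using that g.FA_qmap_natural[of "FA f (QA A u)"] by (intro g.B.bwd_square) (simp_all add: S)
  have "is_natural (HoCat A) (HoCat C)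
      (\<lambda>x. FO (Lder (comp_functor g f)) (FO (id_functor (HoCat A)) x))
      (\<lambda>u. FA (Lder (comp_functor g f)) (FA (id_functor (HoCat A)) u))
      (\<lambda>x. FO (id_functor (HoCat C)) (FO (comp_functor (Lder g) (Lder f)) x))
      (\<lambda>u. FA (id_functor (HoCat C)) (FA (comp_functor (Lder g) (Lder f)) u)) (Tr (HoCompV g f))"
    using is_functor_cellD(1)[OF is_functor_cell_comp, of "Lder f" "Lder g"]
    by (intro f.A.is_natural_HoCatI is_functor_comp[OF id_cell_functor gf.Lder_functor]
        is_functor_comp[OF _ id_cell_functor])
      (simp_all add: S Tr_HoCompV f.A.category_HoCat g.B.category_HoCat nat)
  then show ?thesis
    by (simp add: is_cell_square_def is_functor_square_def S is_functor_cell_id is_functor_cell_comp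
        f.A.category_HoCat g.B.category_HoCat)
      (simp add: HoCompV_def Let_def f.Src)
qed

lemma inverse_HoCompV: "invertible_arrow (SqH Cat) (HoCompV g f)"
  using v_globular_invertible[OF is_cell_square_HoCompV HoCompV_sides(1,2),
      of "\<lambda>x. fwd C (FA g (qmap B (FO f (QO A x))))"]
  by (auto simp: invertible_arrow_def Tr_HoCompV g.B.bwd_fwd_inverse S)

end

locale right_quillen_pair =
  f: right_quillen_functor \<kappa> A B f + g: right_quillen_functor \<kappa> B C g
  for \<kappa> :: "'s::infinite itself" and A B C :: "('o, 'm) model_data" and f g
begin

sublocale gf: right_quillen_functor \<kappa> A C "comp_functor g f"
  by (rule right_quillen_functor_comp[OF f.right_quillen_functor_axioms g.right_quillen_functor_axioms])

lemmas S = f.A.model_simps f.B.model_simps g.B.model_simps f.g_simps g.g_simps f.Rder_simps g.Rder_simps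
  gf.Rder_simps f.FA_RA_Weq g.FA_RA_Weq gf.FA_RA_Weq f.fibrant_FO f.A.rmap(7) g.FA_rmap_Weq

lemma HoCompH_sides [simp]:
  "STop (HoCompH g f) = Rder (comp_functor g f)" "SBot (HoCompH g f) = comp_functor (Rder g) (Rder f)"
  "SLft (HoCompH g f) = id_functor (HoCat A)" "SRgt (HoCompH g f) = id_functor (HoCat C)"
  by (simp_all add: HoCompH_def Let_def S)

lemma Tr_HoCompH: "x \<in> Obj A \<Longrightarrow> Tr (HoCompH g f) x = fwd C (FA g (rmap B (FO f (RO A x))))"
  by (simp add: HoCompH_def Let_def S g.B.HoClass_single)

lemma is_cell_square_HoCompH: "is_cell_square (HoCompH g f)"
proof -
  have nat: "fwd C (FA g (rmap B (FO f (RO A (Cod A u))))) \<odot>\<^bsub>HoCat C\<^esub> fwd C (FA g (FA f (RA A u))) =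
      fwd C (FA g (RA B (FA f (RA A u)))) \<odot>\<^bsub>HoCat C\<^esub> fwd C (FA g (rmap B (FO f (RO A (Dom A u)))))"
    if "u \<in> Arr A" for u
    using that g.FA_rmap_natural[of "FA f (RA A u)"] by (simp add: S flip: g.B.fwd_Comp)
  have "is_natural (HoCat A) (HoCat C)
      (\<lambda>x. FO (id_functor (HoCat C)) (FO (Rder (comp_functor g f)) x))
      (\<lambda>u. FA (id_functor (HoCat C)) (FA (Rder (comp_functor g f)) u))
      (\<lambda>x. FO (comp_functor (Rder g) (Rder f)) (FO (id_functor (HoCat A)) x))
      (\<lambda>u. FA (comp_functor (Rder g) (Rder f)) (FA (id_functor (HoCat A)) u)) (Tr (HoCompH g f))"
    using is_functor_cellD(1)[OF is_functor_cell_comp, of "Rder f" "Rder g"]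
    by (intro f.A.is_natural_HoCatI is_functor_comp[OF gf.Rder_functor id_cell_functor]
        is_functor_comp[OF id_cell_functor])
      (simp_all add: S Tr_HoCompH f.A.category_HoCat g.B.category_HoCat nat)
  then show ?thesis
    by (simp add: is_cell_square_def is_functor_square_def S is_functor_cell_id is_functor_cell_comp
        f.A.category_HoCat g.B.category_HoCat)
      (simp add: HoCompH_def Let_def f.Src)
qed

lemma inverse_HoCompH: "invertible_arrow (SqV Cat) (HoCompH g f)"
  using h_globular_invertible[OF is_cell_square_HoCompH HoCompH_sides(3,4),
      of "\<lambda>x. bwd C (FA g (rmap B (FO f (RO A x))))"]
  by (auto simp: invertible_arrow_def Tr_HoCompH g.B.fwd_bwd_inverse S)

end

text \<open>Moves the invertible outer maps of \<open>vcomp_bifibrant\<close> to the opposite sides,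
  where they appear as the inverses that make up \<open>HoCompV\<close>.\<close>

lemma (in category) inverse_square:
  assumes "inverse_arrows C a a'" "inverse_arrows C b b'" "a \<odot> x = t \<odot> b" "x \<in> Arr C" "t \<in> Arr C"
    "Cod C x = Dom C a" "Dom C x = Dom C b" "Dom C t = Cod C b" "Cod C t = Cod C a"
  shows "a' \<odot> t = x \<odot> b'"
proof (rule cancel_left[OF assms(1)])
  note I = inverse_arrowsD[OF assms(1)] inverse_arrowsD[OF assms(2)]
  have "a \<odot> (a' \<odot> t) = t" "a \<odot> (x \<odot> b') = (t \<odot> b) \<odot> b'"
    using I assms assoc[of t a' a] assoc[of b' x a] by (simp_all add: Ident_Cod_Comp)
  then show "a \<odot> (a' \<odot> t) = a \<odot> (x \<odot> b')"
    using Comp_inverse[OF assms(2,5,8)] by simp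
qed (use inverse_arrowsD[OF assms(1)] inverse_arrowsD[OF assms(2)] assms in \<open>simp_all add: Comp_Arr\<close>)

lemma is_cell_square_id:
  assumes "is_functor_cell F"
  shows "is_cell_square (square_id_v F)" "is_cell_square (square_id_h F)"
  using functor_square_closure.Sq_cell[OF functor_square_closure_cells]
    functor_square_closure.Sq_id_v[OF functor_square_closure_cells]
    functor_square_closure.Sq_id_h[OF functor_square_closure_cells] assms by blast+

section \<open>Naturality of the composition cells\<close>

lemma (in hcomp_squares) HoSquare_hcomp:
  "square_vcomp (square_hcomp (HoSquare \<alpha>) (HoSquare \<beta>)) (HoCompH f' f) =
   square_vcomp (HoCompH g' g) (HoSquare (square_hcomp \<alpha> \<beta>))"
proof -
  interpret F: right_quillen_pair \<kappa> A C E f f'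
    by (intro right_quillen_pair.intro \<alpha>.f.right_quillen_functor_axioms \<beta>.f.right_quillen_functor_axioms)
  interpret G: right_quillen_pair \<kappa> B D F g g'
    by (intro right_quillen_pair.intro \<alpha>.g.right_quillen_functor_axioms \<beta>.g.right_quillen_functor_axioms)
  note H = \<alpha>.HoSquare_sides \<beta>.HoSquare_sides \<gamma>.HoSquare_sides
  note L = \<alpha>.h.Lder_simps \<beta>.k.Lder_simps \<alpha>.f.Rder_simps \<beta>.f.Rder_simps \<alpha>.g.Rder_simps \<beta>.g.Rder_simps
    \<gamma>.f.Rder_simps \<gamma>.g.Rder_simps
  show ?thesis
  proof (rule \<alpha>.A.square_eq_bifibrant)
    show "is_cell_square (square_vcomp (square_hcomp (HoSquare \<alpha>) (HoSquare \<beta>)) (HoCompH f' f))"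
      by (intro cell_square_vcomp cell_square_hcomp F.is_cell_square_HoCompH \<alpha>.is_cell_square_HoSquare
          \<beta>.is_cell_square_HoSquare) (simp_all add: H)
    show "is_cell_square (square_vcomp (HoCompH g' g) (HoSquare (square_hcomp \<alpha> \<beta>)))"
      by (intro cell_square_vcomp G.is_cell_square_HoCompH \<gamma>.is_cell_square_HoSquare) (simp_all add: H)
    fix y assume "y \<in> Obj A" "cofibrant A y" "fibrant A y"
    then show "Tr (square_vcomp (square_hcomp (HoSquare \<alpha>) (HoSquare \<beta>)) (HoCompH f' f)) y =
        Tr (square_vcomp (HoCompH g' g) (HoSquare (square_hcomp \<alpha> \<beta>))) y"
      using hcomp_bifibrant[of y] by (simp add: Tr_simps H L F.Tr_HoCompH G.Tr_HoCompH SS)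
  qed (simp_all add: H L comp_functor_id_left comp_functor_id_right)
qed

lemma (in vcomp_squares) HoSquare_vcomp:
  "square_hcomp (HoCompV h' h) (HoSquare (square_vcomp \<beta> \<alpha>)) =
   square_hcomp (square_vcomp (HoSquare \<beta>) (HoSquare \<alpha>)) (HoCompV k' k)"
proof -
  interpret H: left_quillen_pair \<kappa> A B E h h'
    by (intro left_quillen_pair.intro \<alpha>.h.left_quillen_functor_axioms \<beta>.h.left_quillen_functor_axioms)
  interpret K: left_quillen_pair \<kappa> C D F k k'
    by (intro left_quillen_pair.intro \<alpha>.k.left_quillen_functor_axioms \<beta>.k.left_quillen_functor_axioms)
  note H = \<alpha>.HoSquare_sides \<beta>.HoSquare_sides \<gamma>.HoSquare_sides
  note L = \<alpha>.h.Lder_simps \<alpha>.k.Lder_simps \<beta>.h.Lder_simps \<beta>.k.Lder_simps \<alpha>.f.Rder_simps \<beta>.g.Rder_simps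
    \<gamma>.h.Lder_simps \<gamma>.k.Lder_simps
  show ?thesis
  proof (rule \<alpha>.A.square_eq_bifibrant)
    show "is_cell_square (square_hcomp (HoCompV h' h) (HoSquare (square_vcomp \<beta> \<alpha>)))"
      by (intro cell_square_hcomp H.is_cell_square_HoCompV \<gamma>.is_cell_square_HoSquare) (simp_all add: H)
    show "is_cell_square (square_hcomp (square_vcomp (HoSquare \<beta>) (HoSquare \<alpha>)) (HoCompV k' k))"
      by (intro cell_square_vcomp cell_square_hcomp K.is_cell_square_HoCompV \<alpha>.is_cell_square_HoSquare
          \<beta>.is_cell_square_HoSquare) (simp_all add: H)
    fix y assume y: "y \<in> Obj A" "cofibrant A y" "fibrant A y"
    \<comment> \<open>Left Quillen images of \<pi> at \<open>hQy\<close> and at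
      \<open>kQfRy\<close>, both cofibrant, hence weak equivalences.\<close>
    have W: "FA h' (qmap B (FO h (QO A y))) \<in> Weq E" "FA k' (qmap D (FO k (QO C (FO f (RO A y))))) \<in> Weq F"
      using y by (simp_all add: SS H.S K.S)
    have "bwd F (\<beta>.gRh (qmap B (FO h (QO A y)))) \<cdot> Tr (HoSquare (square_vcomp \<beta> \<alpha>)) y =
      (Tr (HoSquare \<beta>) (FO h (QO A y)) \<cdot> FA (Lder k') (Tr (HoSquare \<alpha>) y)) \<cdot>
        bwd F (FA k' (qmap D (FO k (QO C (FO f (RO A y))))))"
      by (rule \<beta>.D.Ho.inverse_square[OF \<beta>.D.fwd_bwd_inverse \<beta>.D.fwd_bwd_inverse vcomp_bifibrant[OF y]])
        (use y W in \<open>simp_all add: SS\<close>)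
    then show "Tr (square_hcomp (HoCompV h' h) (HoSquare (square_vcomp \<beta> \<alpha>))) y =
        Tr (square_hcomp (square_vcomp (HoSquare \<beta>) (HoSquare \<alpha>)) (HoCompV k' k)) y"
      using y W by (simp add: Tr_simps H L H.Tr_HoCompV K.Tr_HoCompV SS)
  qed (simp_all add: H L comp_functor_id_left comp_functor_id_right)
qed

section \<open>Associativity axioms\<close>

lemma HoCompV_assoc:
  assumes "left_quillen_functor \<kappa> A B u" "left_quillen_functor \<kappa> B C v" "left_quillen_functor \<kappa> C D w"
  shows "square_hcomp (square_vcomp (square_id_v (Lder w)) (HoCompV v u)) (HoCompV w (comp_functor v u)) =
    square_hcomp (square_vcomp (HoCompV w v) (square_id_v (Lder u))) (HoCompV (comp_functor w v) u)"
proof -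
  interpret u: left_quillen_functor \<kappa> A B u by fact
  interpret v: left_quillen_functor \<kappa> B C v by fact
  interpret w: left_quillen_functor \<kappa> C D w by fact
  interpret vu: left_quillen_pair \<kappa> A B C u v by (intro left_quillen_pair.intro assms)
  interpret wv: left_quillen_pair \<kappa> B C D v w by (intro left_quillen_pair.intro assms)
  interpret w_vu: left_quillen_pair \<kappa> A C D "comp_functor v u" w
    by (intro left_quillen_pair.intro assms vu.gf.left_quillen_functor_axioms)
  interpret wv_u: left_quillen_pair \<kappa> A B D u "comp_functor w v"
    by (intro left_quillen_pair.intro assms wv.gf.left_quillen_functor_axioms)
  note S = vu.S wv.S w_vu.S wv_u.S vu.Tr_HoCompV wv.Tr_HoCompV w_vu.Tr_HoCompV wv_u.Tr_HoCompV
    is_functorD(7)[OF wv.gf.Lder_functor, unfolded u.B.Obj_HoCat]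
  show ?thesis
  proof (rule square_data_eqI)
    fix x
    show "Tr (square_hcomp (square_vcomp (square_id_v (Lder w)) (HoCompV v u)) (HoCompV w (comp_functor v u))) x =
      Tr (square_hcomp (square_vcomp (HoCompV w v) (square_id_v (Lder u))) (HoCompV (comp_functor w v) u)) x"
    proof (cases "x \<in> Obj A")
      case x: True
      let ?p = "qmap B (FO u (QO A x))"
      have W: "FA v ?p \<in> Weq C" "FA w (FA v ?p) \<in> Weq D"
        using x wv.gf.FA_qmap_Weq[of "FO u (QO A x)"] by (simp_all add: S)
      \<comment> \<open>Cofibrancy makes \<open>w\<close> preserve \<pi> at this object, so that it
        may be inverted.\<close>
      have "cofibrant C (FO v (FO u (QO A x)))"
        using x u.cofibrant_FO_QO v.cofibrant_FO by simp
      then have W': "FA w (qmap C (FO v (FO u (QO A x)))) \<in> Weq D" by (simp add: S)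
      \<comment> \<open>The \<open>w\<close>-image of the naturality square of \<pi> at
        \<open>FA v ?p\<close>, with all four sides inverted.\<close>
      have "bwd D (FA w (QA C (FA v ?p))) \<odot>\<^bsub>HoCat D\<^esub> bwd D (FA w (qmap C (FO v (FO u (QO A x))))) =
        bwd D (FA w (qmap C (FO v (QO B (FO u (QO A x)))))) \<odot>\<^bsub>HoCat D\<^esub> bwd D (FA w (FA v ?p))"
        using x W W' w.FA_qmap_natural[of "FA v ?p"] by (simp add: S flip: w.B.bwd_Comp_Weq)
      then show ?thesis using x W by (simp add: Tr_simps S)
    qed (simp add: Tr_simps S)
  qed (simp_all add: S comp_functor_assoc u.cell)
qed

lemma HoCompH_assoc:
  assumes "right_quillen_functor \<kappa> A B f" "right_quillen_functor \<kappa> B C g" "right_quillen_functor \<kappa> C D h"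
  shows "square_vcomp (square_hcomp (HoCompH g f) (square_id_h (Rder h))) (HoCompH h (comp_functor g f)) =
    square_vcomp (square_hcomp (square_id_h (Rder f)) (HoCompH h g)) (HoCompH (comp_functor h g) f)"
proof -
  interpret f: right_quillen_functor \<kappa> A B f by fact
  interpret g: right_quillen_functor \<kappa> B C g by fact
  interpret h: right_quillen_functor \<kappa> C D h by fact
  interpret gf: right_quillen_pair \<kappa> A B C f g by (intro right_quillen_pair.intro assms)
  interpret hg: right_quillen_pair \<kappa> B C D g h by (intro right_quillen_pair.intro assms)
  interpret h_gf: right_quillen_pair \<kappa> A C D "comp_functor g f" h
    by (intro right_quillen_pair.intro assms gf.gf.right_quillen_functor_axioms)
  interpret hg_f: right_quillen_pair \<kappa> A B D f "comp_functor h g"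
    by (intro right_quillen_pair.intro assms hg.gf.right_quillen_functor_axioms)
  note S = gf.S hg.S h_gf.S hg_f.S gf.Tr_HoCompH hg.Tr_HoCompH h_gf.Tr_HoCompH hg_f.Tr_HoCompH
    is_functorD(7)[OF h.Rder_functor, unfolded g.B.Obj_HoCat] is_functorD(7)[OF g.Rder_functor, unfolded f.B.Obj_HoCat]
  show ?thesis
  proof (rule square_data_eqI)
    fix x
    show "Tr (square_vcomp (square_hcomp (HoCompH g f) (square_id_h (Rder h))) (HoCompH h (comp_functor g f))) x =
      Tr (square_vcomp (square_hcomp (square_id_h (Rder f)) (HoCompH h g)) (HoCompH (comp_functor h g) f)) x"
    proof (cases "x \<in> Obj A")
      case x: True
      let ?r = "rmap B (FO f (RO A x))"
      have "fwd D (FA h (RA C (FA g ?r))) \<odot>\<^bsub>HoCat D\<^esub> fwd D (FA h (rmap C (FO g (FO f (RO A x))))) =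
        fwd D (FA h (rmap C (FO g (RO B (FO f (RO A x)))))) \<odot>\<^bsub>HoCat D\<^esub> fwd D (FA h (FA g ?r))"
        using x h.FA_rmap_natural[of "FA g ?r"] by (simp add: S flip: h.B.fwd_Comp)
      then show ?thesis using x by (simp add: Tr_simps S)
    qed (simp add: Tr_simps S)
  qed (simp_all add: S comp_functor_assoc f.cell)
qed

section \<open>Unit axioms and identity square of a vertical 1-cell\<close>

context left_quillen_functor
begin

lemma left_pairs: "left_quillen_pair \<kappa> A B B f (id_functor B)" "left_quillen_pair \<kappa> A A B (id_functor A) f"
  by (intro left_quillen_pair.intro left_quillen_functor_id left_quillen_functor_axioms
      A.model_category_axioms B.model_category_axioms)+

text \<open>The composite is \<pi> at \<open>fQx\<close> after its own formal inverse, which cancels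
  at every object.\<close>

lemma HoUnitV_left:
  "square_hcomp (square_vcomp (HoUnitV B) (square_id_v (Lder f))) (HoCompV (id_functor B) f) = square_id_v (Lder f)"
proof -
  interpret P: left_quillen_pair \<kappa> A B B f "id_functor B" by (rule left_pairs)
  note S = P.S P.Tr_HoCompV B.Tr_HoUnitV B.category_HoCat
    is_functorD(7)[OF P.g.Lder_functor, unfolded B.Obj_HoCat]
  show ?thesis
  proof (rule square_data_eqI)
    fix x
    show "Tr (square_hcomp (square_vcomp (HoUnitV B) (square_id_v (Lder f))) (HoCompV (id_functor B) f)) x =
      Tr (square_id_v (Lder f)) x"
      using B.Ho.inverse_arrowsD(6)[OF B.fwd_bwd_inverse, of "qmap B (FO f (QO A x))"]
      by (simp add: Tr_simps S)
  qed (simp_all add: S comp_functor_id_left is_functor_cell_id cell Tgt A.category_HoCat)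
qed

text \<open>Here \<open>f\<close> is applied to two different maps
  \<open>QQx \<rightarrow> Qx\<close>, namely \<open>Q\<pi>\<close> and \<pi> at \<open>Qx\<close>.
  Naturality of \<pi> at itself makes them agree after composition with \<pi> at \<open>x\<close>,
  whose image under \<open>f\<close> can be cancelled when \<open>x\<close> is cofibrant.\<close>

lemma HoUnitV_right:
  "square_hcomp (square_vcomp (square_id_v (Lder f)) (HoUnitV A)) (HoCompV f (id_functor A)) = square_id_v (Lder f)"
proof -
  interpret P: left_quillen_pair \<kappa> A A B "id_functor A" f by (rule left_pairs)
  note S = P.S P.Tr_HoCompV A.Tr_HoUnitV A.category_HoCat
    is_functorD(7)[OF Lder_functor, unfolded A.Obj_HoCat]
  show ?thesis
  proof (rule A.square_eq_bifibrant)
    show "is_cell_square (square_hcomp (square_vcomp (square_id_v (Lder f)) (HoUnitV A)) (HoCompV f (id_functor A)))"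
      by (intro cell_square_hcomp cell_square_vcomp is_cell_square_id P.is_cell_square_HoCompV
          A.is_cell_square_HoUnitV) (simp_all add: S)
    show "is_cell_square (square_id_v (Lder f))"
      by (intro is_cell_square_id) (simp add: S)
    fix x assume x: "x \<in> Obj A" "cofibrant A x"
    note p = B.fwd_bwd_inverse[OF FA_qmap_Weq[OF x(2)]]
    have "fwd B (FA f (qmap A x)) \<odot>\<^bsub>HoCat B\<^esub> fwd B (FA f (QA A (qmap A x))) =
        fwd B (FA f (qmap A x)) \<odot>\<^bsub>HoCat B\<^esub> fwd B (FA f (qmap A (QO A x)))"
      using x FA_qmap_natural[of "qmap A x"] by (simp add: S flip: B.fwd_Comp)
    then have "fwd B (FA f (QA A (qmap A x))) = fwd B (FA f (qmap A (QO A x)))"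
      by (rule B.Ho.cancel_left[OF p, rotated -1]) (use x in \<open>simp_all add: S\<close>)
    moreover have "fwd B (FA f (qmap A (QO A x))) \<odot>\<^bsub>HoCat B\<^esub> bwd B (FA f (qmap A (QO A x))) =
        Ident (HoCat B) (FO f (QO A x))"
      using x B.Ho.inverse_arrowsD(6)[OF B.fwd_bwd_inverse, of "FA f (qmap A (QO A x))"] A.qmap(7)
      by (simp add: S)
    ultimately show "Tr (square_hcomp (square_vcomp (square_id_v (Lder f)) (HoUnitV A)) (HoCompV f (id_functor A))) x =
      Tr (square_id_v (Lder f)) x"
      using x A.qmap(7)[of x] by (simp add: Tr_simps S)
  qed (simp_all add: S comp_functor_id_right comp_functor_id_left is_functor_cell_id cell Src B.category_HoCat)
qed

lemma quillen_square_id_v: "quillen_square \<kappa> A B A B (id_functor A) (id_functor B) f f (square_id_v f)"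
  using is_cell_square_id(1)[OF cell]
  by (intro quillen_square.intro quillen_square_axioms.intro A.model_category_axioms B.model_category_axioms
      left_quillen_functor_axioms right_quillen_functor_id) (simp_all add: Src Tgt cell_squareD)

text \<open>For this square \<open>hat x\<close> is \<rho> at \<open>fx\<close> after
  \<open>f\<pi>\<close>. Naturality of \<rho> rewrites it as \<open>Rf\<pi>\<close> after \<rho> at
  \<open>fQx\<close>; cancelling \<open>Rf\<pi>\<close> at cofibrant \<open>x\<close> leaves \<rho>
  at \<open>fQx\<close>, which the unit cell of the target inverts.\<close>

lemma HoSquare_id_v:
  "square_vcomp (HoUnitH B) (square_vcomp (HoSquare (square_id_v f)) (inverse_arrow (SqV Cat) (HoUnitH A))) =
   square_id_v (Lder f)"
proof -
  interpret Q: quillen_square \<kappa> A B A B "id_functor A" "id_functor B" f f "square_id_v f"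
    by (rule quillen_square_id_v)
  interpret SqV: category "SqV Cat" by (rule double_category.category_SqV) (rule double_category_Cat)
  let ?I = "\<lparr>STop = id_functor (HoCat A), SLft = id_functor (HoCat A), SRgt = id_functor (HoCat A),
    SBot = Rder (id_functor A), Tr = (\<lambda>x\<in>Obj A. fwd A (rmap A x))\<rparr>"
  have inv: "inverse_arrow (SqV Cat) (HoUnitH A) = ?I"
    by (rule SqV.inverse_arrow_eq) (rule A.inverse_HoUnitH)
  have I: "is_cell_square ?I"
    using SqV.inverse_arrowsD(2)[OF A.inverse_HoUnitH] by (simp add: Sq_Cat)
  note S = Q.S Q.HoSquare_sides Lder_simps Q.f.Rder_simps Q.g.Rder_simps A.Tr_HoUnitH B.Tr_HoUnitH
    A.category_HoCat B.category_HoCat Q.Tr_HoSquare_Arr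
  show ?thesis
    unfolding inv
  proof (rule A.square_eq_bifibrant)
    show "is_cell_square (square_vcomp (HoUnitH B) (square_vcomp (HoSquare (square_id_v f)) ?I))"
      by (intro cell_square_vcomp I Q.is_cell_square_HoSquare B.is_cell_square_HoUnitH) (simp_all add: S)
    show "is_cell_square (square_id_v (Lder f))"
      by (intro is_cell_square_id) (simp add: S)
    fix x assume x: "x \<in> Obj A" "cofibrant A x"
    let ?T = "Tr (HoSquare (square_id_v f)) x"
    have W: "RA B (FA f (qmap A x)) \<in> Weq B" using FA_qmap_Weq[OF x(2)] B.RA_Weq by simp
    have hat: "Q.hat x = RA B (FA f (qmap A x)) \<odot>\<^bsub>B\<^esub> rmap B (FO f (QO A x))"
      using x B.RA(4)[of "FA f (qmap A x)"] by (simp add: Q.hat_def S Tr_simps Src Tgt)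
    have "fwd B (RA B (FA f (qmap A x))) \<odot>\<^bsub>HoCat B\<^esub> (?T \<odot>\<^bsub>HoCat B\<^esub> fwd B (FA f (QA A (rmap A x)))) =
        fwd B (RA B (FA f (qmap A x))) \<odot>\<^bsub>HoCat B\<^esub> fwd B (rmap B (FO f (QO A x)))"
      using Q.Tr_HoSquare_hat[OF x(1)] x by (simp add: hat S B.fwd_Comp)
    then have "?T \<odot>\<^bsub>HoCat B\<^esub> fwd B (FA f (QA A (rmap A x))) = fwd B (rmap B (FO f (QO A x)))"
      by (rule B.Ho.cancel_left[OF B.fwd_bwd_inverse[OF W], rotated -1]) (use x in \<open>simp_all add: S\<close>)
    moreover have "bwd B (rmap B (FO f (QO A x))) \<odot>\<^bsub>HoCat B\<^esub> fwd B (rmap B (FO f (QO A x))) =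
        Ident (HoCat B) (FO f (QO A x))"
      using x B.Ho.inverse_arrowsD(5)[OF B.fwd_bwd_inverse, of "rmap B (FO f (QO A x))"] by (simp add: S)
    ultimately show "Tr (square_vcomp (HoUnitH B) (square_vcomp (HoSquare (square_id_v f)) ?I)) x =
        Tr (square_id_v (Lder f)) x"
      using x by (simp add: Tr_simps S)
  qed (simp_all add: S comp_functor_id_right comp_functor_id_left is_functor_cell_id)
qed

end

section \<open>Unit axioms and identity square of a horizontal 1-cell\<close>

context right_quillen_functor
begin

lemma right_pairs: "right_quillen_pair \<kappa> A B B g (id_functor B)" "right_quillen_pair \<kappa> A A B (id_functor A) g"
  by (intro right_quillen_pair.intro right_quillen_functor_id right_quillen_functor_axioms
      A.model_category_axioms B.model_category_axioms)+

lemma HoUnitH_left: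
  "square_vcomp (square_hcomp (square_id_h (Rder g)) (HoUnitH B)) (HoCompH (id_functor B) g) = square_id_h (Rder g)"
proof -
  interpret P: right_quillen_pair \<kappa> A B B g "id_functor B" by (rule right_pairs)
  note S = P.S P.Tr_HoCompH B.Tr_HoUnitH B.category_HoCat
    is_functorD(7)[OF P.g.Rder_functor, unfolded B.Obj_HoCat]
  show ?thesis
  proof (rule square_data_eqI)
    fix x
    show "Tr (square_vcomp (square_hcomp (square_id_h (Rder g)) (HoUnitH B)) (HoCompH (id_functor B) g)) x =
      Tr (square_id_h (Rder g)) x"
      using B.Ho.inverse_arrowsD(5)[OF B.fwd_bwd_inverse, of "rmap B (FO g (RO A x))"]
      by (simp add: Tr_simps S)
  qed (simp_all add: S comp_functor_id_left is_functor_cell_id cell Tgt A.category_HoCat)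
qed

text \<open>The two maps \<open>Rx \<rightarrow> RRx\<close>, \<open>R\<rho>\<close> and \<rho> at
  \<open>Rx\<close>, agree after precomposition with \<rho> at \<open>x\<close>, and the image of
  the latter under \<open>g\<close> is invertible when \<open>x\<close> is fibrant.\<close>

lemma HoUnitH_right:
  "square_vcomp (square_hcomp (HoUnitH A) (square_id_h (Rder g))) (HoCompH g (id_functor A)) = square_id_h (Rder g)"
proof -
  interpret P: right_quillen_pair \<kappa> A A B "id_functor A" g by (rule right_pairs)
  note S = P.S P.Tr_HoCompH A.Tr_HoUnitH A.category_HoCat
    is_functorD(7)[OF Rder_functor, unfolded A.Obj_HoCat]
  show ?thesis
  proof (rule A.square_eq_bifibrant)
    show "is_cell_square (square_vcomp (square_hcomp (HoUnitH A) (square_id_h (Rder g))) (HoCompH g (id_functor A)))"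
      by (intro cell_square_hcomp cell_square_vcomp is_cell_square_id P.is_cell_square_HoCompH
          A.is_cell_square_HoUnitH) (simp_all add: S)
    show "is_cell_square (square_id_h (Rder g))"
      by (intro is_cell_square_id) (simp add: S)
    fix x assume x: "x \<in> Obj A" "fibrant A x"
    note p = B.fwd_bwd_inverse[OF FA_rmap_Weq[OF x(2)]]
    have "fwd B (FA g (RA A (rmap A x))) \<odot>\<^bsub>HoCat B\<^esub> fwd B (FA g (rmap A x)) =
        fwd B (FA g (rmap A (RO A x))) \<odot>\<^bsub>HoCat B\<^esub> fwd B (FA g (rmap A x))"
      using x FA_rmap_natural[of "rmap A x"] by (simp add: S flip: B.fwd_Comp)
    then have "fwd B (FA g (RA A (rmap A x))) = fwd B (FA g (rmap A (RO A x)))"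
      by (rule B.Ho.cancel_right[OF p, rotated -1]) (use x in \<open>simp_all add: S\<close>)
    moreover have "bwd B (FA g (RA A (rmap A x))) \<odot>\<^bsub>HoCat B\<^esub> fwd B (FA g (RA A (rmap A x))) =
        Ident (HoCat B) (FO g (RO A x))"
      using x B.Ho.inverse_arrowsD(5)[OF B.fwd_bwd_inverse, of "FA g (RA A (rmap A x))"] by (simp add: S)
    ultimately show "Tr (square_vcomp (square_hcomp (HoUnitH A) (square_id_h (Rder g))) (HoCompH g (id_functor A))) x =
      Tr (square_id_h (Rder g)) x"
      using x by (simp add: Tr_simps S)
  qed (simp_all add: S comp_functor_id_right comp_functor_id_left is_functor_cell_id cell Src B.category_HoCat)
qed

lemma quillen_square_id_h: "quillen_square \<kappa> A A B B g g (id_functor A) (id_functor B) (square_id_h g)"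
  using is_cell_square_id(2)[OF cell]
  by (intro quillen_square.intro quillen_square_axioms.intro A.model_category_axioms B.model_category_axioms
      right_quillen_functor_axioms left_quillen_functor_id) (simp_all add: Src Tgt cell_squareD)

text \<open>Now \<open>hat x\<close> is \<open>g\<rho>\<close> after \<pi> at \<open>gx\<close>,
  which equals \<pi> at \<open>gRx\<close> after \<open>Qg\<rho>\<close>; the factor
  \<open>Qg\<rho>\<close> cancels at fibrant \<open>x\<close>.\<close>

lemma HoSquare_id_h:
  "square_hcomp (square_hcomp (HoUnitV A) (HoSquare (square_id_h g))) (inverse_arrow (SqH Cat) (HoUnitV B)) =
   square_id_h (Rder g)"
proof -
  interpret Q: quillen_square \<kappa> A A B B g g "id_functor A" "id_functor B" "square_id_h g"
    by (rule quillen_square_id_h)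
  interpret SqH: category "SqH Cat" by (rule double_category.category_SqH) (rule double_category_Cat)
  let ?I = "\<lparr>STop = id_functor (HoCat B), SLft = Lder (id_functor B), SRgt = id_functor (HoCat B),
    SBot = id_functor (HoCat B), Tr = (\<lambda>x\<in>Obj B. bwd B (qmap B x))\<rparr>"
  have inv: "inverse_arrow (SqH Cat) (HoUnitV B) = ?I"
    by (rule SqH.inverse_arrow_eq) (rule B.inverse_HoUnitV)
  have I: "is_cell_square ?I"
    using SqH.inverse_arrowsD(2)[OF B.inverse_HoUnitV] by (simp add: Sq_Cat Cat_simps(23))
  note S = Q.S Q.HoSquare_sides Rder_simps Q.h.Lder_simps Q.k.Lder_simps A.Tr_HoUnitV B.Tr_HoUnitV
    A.category_HoCat B.category_HoCat Q.Tr_HoSquare_Arr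
  show ?thesis
    unfolding inv
  proof (rule A.square_eq_bifibrant)
    show "is_cell_square (square_hcomp (square_hcomp (HoUnitV A) (HoSquare (square_id_h g))) ?I)"
      by (intro cell_square_hcomp I Q.is_cell_square_HoSquare A.is_cell_square_HoUnitV) (simp_all add: S)
    show "is_cell_square (square_id_h (Rder g))"
      by (intro is_cell_square_id) (simp add: S)
    fix x assume x: "x \<in> Obj A" "fibrant A x"
    let ?T = "Tr (HoSquare (square_id_h g)) x"
    have W: "QA B (FA g (rmap A x)) \<in> Weq B" using FA_rmap_Weq[OF x(2)] B.QA_Weq by simp
    have hat: "Q.hat x = qmap B (FO g (RO A x)) \<odot>\<^bsub>B\<^esub> QA B (FA g (rmap A x))"
      using x B.QA(4)[of "FA g (rmap A x)"] by (simp add: Q.hat_def S Tr_simps Src Tgt)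
    have "(fwd B (FA g (RA A (qmap A x))) \<odot>\<^bsub>HoCat B\<^esub> ?T) \<odot>\<^bsub>HoCat B\<^esub> fwd B (QA B (FA g (rmap A x))) =
        fwd B (qmap B (FO g (RO A x))) \<odot>\<^bsub>HoCat B\<^esub> fwd B (QA B (FA g (rmap A x)))"
      using Q.Tr_HoSquare_hat[OF x(1)] x by (simp add: hat S B.fwd_Comp)
    then have "fwd B (FA g (RA A (qmap A x))) \<odot>\<^bsub>HoCat B\<^esub> ?T = fwd B (qmap B (FO g (RO A x)))"
      by (rule B.Ho.cancel_right[OF B.fwd_bwd_inverse[OF W], rotated -1]) (use x in \<open>simp_all add: S\<close>)
    moreover have "fwd B (qmap B (FO g (RO A x))) \<odot>\<^bsub>HoCat B\<^esub> bwd B (qmap B (FO g (RO A x))) =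
        Ident (HoCat B) (FO g (RO A x))"
      using x B.Ho.inverse_arrowsD(6)[OF B.fwd_bwd_inverse, of "qmap B (FO g (RO A x))"] by (simp add: S)
    ultimately show "Tr (square_hcomp (square_hcomp (HoUnitV A) (HoSquare (square_id_h g))) ?I) x =
        Tr (square_id_h (Rder g)) x"
      using x by (simp add: Tr_simps S)
  qed (simp_all add: S comp_functor_id_right comp_functor_id_left is_functor_cell_id)
qed

end

section \<open>The double pseudofunctor\<close>

lemma Ver_Model: "u \<in> hom (Ver (Model \<kappa>)) a b \<Longrightarrow> left_quillen_functor \<kappa> a b u"
  by (auto simp: hom_def Model_simps left_quillen_functor_def left_quillen_functor_axioms_def)

lemma Hor_Model: "u \<in> hom (Hor (Model \<kappa>)) a b \<Longrightarrow> right_quillen_functor \<kappa> a b u"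
  by (auto simp: hom_def Model_simps right_quillen_functor_def right_quillen_functor_axioms_def)

lemma Sq_Model:
  assumes "\<alpha> \<in> Sq (Model \<kappa>)"
  shows "quillen_square \<kappa> (Src (STop \<alpha>)) (Tgt (SLft \<alpha>)) (Tgt (STop \<alpha>)) (Tgt (SRgt \<alpha>))
    (STop \<alpha>) (SBot \<alpha>) (SLft \<alpha>) (SRgt \<alpha>) \<alpha>"
  using assms is_functor_squareD(1-4)[of \<alpha>]
  by (auto simp: Model_simps left_quillen_functor_def left_quillen_functor_axioms_def
      right_quillen_functor_def right_quillen_functor_axioms_def
      intro!: quillen_square.intro quillen_square_axioms.intro)

lemma has_boundary_Cat:
  "has_boundary Cat \<alpha> t l r b \<longleftrightarrow>
    is_cell_square \<alpha> \<and> STop \<alpha> = t \<and> SLft \<alpha> = l \<and> SRgt \<alpha> = r \<and> SBot \<alpha> = b"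
  by (simp add: has_boundary_def Sq_Cat Cat_simps(1-23))

lemma Ho_simps:
  "MapO Ho = HoCat" "MapV Ho = Lder" "MapH Ho = Rder" "MapS Ho = HoSquare" "UnitH Ho = HoUnitH"
  "UnitV Ho = HoUnitV" "CompV Ho = HoCompV" "CompH Ho = HoCompH"
  by (simp_all add: Ho_def)

theorem theorem7p6:
  shows "double_pseudofunctor
    (Model TYPE('s::infinite) :: ('o, 'm) model_double)
    (Cat :: ('o, ('o, 'm) loc_arrow) cat_double)
    Ho"
proof -
  let ?K = "Model TYPE('s) :: ('o, 'm) model_double" and ?L = "Cat :: ('o, ('o, 'm) loc_arrow) cat_double"
  note S = Cat_simps(1-22) Model_simps(1-23) has_boundary_Cat
  show ?thesis
  proof (intro double_pseudofunctor.intro double_pseudofunctor_axioms.intro double_category_Cat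
      double_category_Model, unfold Ho_simps)
    fix a :: "('o, 'm) model_data" assume "a \<in> Obj (Ver ?K)"
    then interpret a: model_category "TYPE('s)" a by (simp add: Model_simps)
    show "HoCat a \<in> Obj (Ver ?L)" by (simp add: S a.category_HoCat)
    show "has_boundary ?L (HoUnitH a) (Rder (hid ?K a)) (vid ?L (HoCat a)) (vid ?L (HoCat a)) (hid ?L (HoCat a))"
      "has_boundary ?L (HoUnitV a) (hid ?L (HoCat a)) (vid ?L (HoCat a)) (Lder (vid ?K a)) (hid ?L (HoCat a))"
      by (simp_all add: S a.is_cell_square_HoUnitH a.is_cell_square_HoUnitV)
    show "invertible_arrow (SqV ?L) (HoUnitH a)" "invertible_arrow (SqH ?L) (HoUnitV a)"
      using a.inverse_HoUnitH a.inverse_HoUnitV by (auto simp: invertible_arrow_def)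
  next
    fix u a b assume "u \<in> hom (Ver ?K) a b"
    then interpret u: left_quillen_functor "TYPE('s)" a b u by (rule Ver_Model)
    show "Lder u \<in> hom (Ver ?L) (HoCat a) (HoCat b)"
      by (simp add: hom_def S u.Lder_simps)
    show "hcomp ?L (vcomp ?L (HoUnitV b) (sqid_v ?L (Lder u))) (HoCompV (vid ?K b) u) = sqid_v ?L (Lder u)"
      "hcomp ?L (vcomp ?L (sqid_v ?L (Lder u)) (HoUnitV a)) (HoCompV u (vid ?K a)) = sqid_v ?L (Lder u)"
      using u.HoUnitV_left u.HoUnitV_right by (simp_all add: S)
    show "vcomp ?L (HoUnitH b) (vcomp ?L (HoSquare (sqid_v ?K u)) (inverse_arrow (SqV ?L) (HoUnitH a))) =
        sqid_v ?L (Lder u)"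
      using u.HoSquare_id_v by (simp add: S)
  next
    fix f a b assume "f \<in> hom (Hor ?K) a b"
    then interpret f: right_quillen_functor "TYPE('s)" a b f by (rule Hor_Model)
    show "Rder f \<in> hom (Hor ?L) (HoCat a) (HoCat b)"
      by (simp add: hom_def S f.Rder_simps)
    show "vcomp ?L (hcomp ?L (HoUnitH a) (sqid_h ?L (Rder f))) (HoCompH f (hid ?K a)) = sqid_h ?L (Rder f)"
      "vcomp ?L (hcomp ?L (sqid_h ?L (Rder f)) (HoUnitH b)) (HoCompH (hid ?K b) f) = sqid_h ?L (Rder f)"
      using f.HoUnitH_left f.HoUnitH_right by (simp_all add: S)
    show "hcomp ?L (hcomp ?L (HoUnitV a) (HoSquare (sqid_h ?K f))) (inverse_arrow (SqH ?L) (HoUnitV b)) =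
        sqid_h ?L (Rder f)"
      using f.HoSquare_id_h by (simp add: S)
  next
    fix u v a b c assume u: "u \<in> hom (Ver ?K) a b" and v: "v \<in> hom (Ver ?K) b c"
    interpret P: left_quillen_pair "TYPE('s)" a b c u v
      by (intro left_quillen_pair.intro Ver_Model u v)
    show "has_boundary ?L (HoCompV v u) (hid ?L (HoCat a)) (Lder v \<odot>\<^bsub>Ver ?L\<^esub> Lder u)
        (Lder (v \<odot>\<^bsub>Ver ?K\<^esub> u)) (hid ?L (HoCat c))"
      by (simp add: S P.is_cell_square_HoCompV)
    show "invertible_arrow (SqH ?L) (HoCompV v u)" by (rule P.inverse_HoCompV)
  next
    fix f g a b c assume f: "f \<in> hom (Hor ?K) a b" and g: "g \<in> hom (Hor ?K) b c"
    interpret P: right_quillen_pair "TYPE('s)" a b c f g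
      by (intro right_quillen_pair.intro Hor_Model f g)
    show "has_boundary ?L (HoCompH g f) (Rder (g \<odot>\<^bsub>Hor ?K\<^esub> f)) (vid ?L (HoCat a)) (vid ?L (HoCat c))
        (Rder g \<odot>\<^bsub>Hor ?L\<^esub> Rder f)"
      by (simp add: S P.is_cell_square_HoCompH)
    show "invertible_arrow (SqV ?L) (HoCompH g f)" by (rule P.inverse_HoCompH)
  next
    fix u v w a b c d
    assume "u \<in> hom (Ver ?K) a b" "v \<in> hom (Ver ?K) b c" "w \<in> hom (Ver ?K) c d"
    then show "hcomp ?L (vcomp ?L (sqid_v ?L (Lder w)) (HoCompV v u)) (HoCompV w (v \<odot>\<^bsub>Ver ?K\<^esub> u)) =
        hcomp ?L (vcomp ?L (HoCompV w v) (sqid_v ?L (Lder u))) (HoCompV (w \<odot>\<^bsub>Ver ?K\<^esub> v) u)"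
      using HoCompV_assoc[OF Ver_Model Ver_Model Ver_Model] by (simp add: S)
  next
    fix f g h a b c d
    assume "f \<in> hom (Hor ?K) a b" "g \<in> hom (Hor ?K) b c" "h \<in> hom (Hor ?K) c d"
    then show "vcomp ?L (hcomp ?L (HoCompH g f) (sqid_h ?L (Rder h))) (HoCompH h (g \<odot>\<^bsub>Hor ?K\<^esub> f)) =
        vcomp ?L (hcomp ?L (sqid_h ?L (Rder f)) (HoCompH h g)) (HoCompH (h \<odot>\<^bsub>Hor ?K\<^esub> g) f)"
      using HoCompH_assoc[OF Hor_Model Hor_Model Hor_Model] by (simp add: S)
  next
    fix \<alpha> f u v g assume *: "has_boundary ?K \<alpha> f u v g"
    then interpret Q: quillen_square "TYPE('s)" "Src (STop \<alpha>)" "Tgt (SLft \<alpha>)" "Tgt (STop \<alpha>)" "Tgt (SRgt \<alpha>)"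
      "STop \<alpha>" "SBot \<alpha>" "SLft \<alpha>" "SRgt \<alpha>" \<alpha>
      by (auto simp: has_boundary_def intro!: Sq_Model)
    show "has_boundary ?L (HoSquare \<alpha>) (Rder f) (Lder u) (Lder v) (Rder g)"
      using * by (simp add: has_boundary_def[of ?K] S Q.is_cell_square_HoSquare Q.HoSquare_sides)
  next
    fix \<alpha> \<beta> assume \<alpha>: "\<alpha> \<in> Sq ?K" and \<beta>: "\<beta> \<in> Sq ?K" and eq: "Lft ?K \<beta> = Rgt ?K \<alpha>"
    \<comment> \<open>Identifies the left corners of \<beta> with the right corners of \<alpha>, as
      \<open>hcomp_squares\<close> takes \<open>C\<close>, \<open>D\<close> and \<open>k\<close> to
      be common to both squares.\<close>
    have eq': "SLft \<beta> = SRgt \<alpha>" "Src (STop \<beta>) = Tgt (STop \<alpha>)"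
      using \<alpha> \<beta> eq is_functor_squareD(1,2) by (metis (mono_tags, lifting) Model_simps(19,20,24) mem_Collect_eq)+
    have "hcomp_squares TYPE('s) (Src (STop \<alpha>)) (Tgt (SLft \<alpha>)) (Tgt (STop \<alpha>)) (Tgt (SRgt \<alpha>))
        (Tgt (STop \<beta>)) (Tgt (SRgt \<beta>)) (STop \<alpha>) (SBot \<alpha>) (SLft \<alpha>) (SRgt \<alpha>) (STop \<beta>) (SBot \<beta>) (SRgt \<beta>) \<alpha> \<beta>"
      using Sq_Model[OF \<alpha>] Sq_Model[OF \<beta>] by (simp add: hcomp_squares_def eq')
    from hcomp_squares.HoSquare_hcomp[OF this]
    show "vcomp ?L (hcomp ?L (HoSquare \<alpha>) (HoSquare \<beta>)) (HoCompH (Top ?K \<beta>) (Top ?K \<alpha>)) =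
        vcomp ?L (HoCompH (Bot ?K \<beta>) (Bot ?K \<alpha>)) (HoSquare (hcomp ?K \<alpha> \<beta>))"
      by (simp add: S)
  next
    fix \<alpha> \<beta> assume \<alpha>: "\<alpha> \<in> Sq ?K" and \<beta>: "\<beta> \<in> Sq ?K" and eq: "Top ?K \<beta> = Bot ?K \<alpha>"
    have eq': "STop \<beta> = SBot \<alpha>" "Src (SBot \<alpha>) = Tgt (SLft \<alpha>)" "Tgt (SBot \<alpha>) = Tgt (SRgt \<alpha>)"
      using \<alpha> eq is_functor_squareD(3,4)[of \<alpha>] by (auto simp: Model_simps)
    have "vcomp_squares TYPE('s) (Src (STop \<alpha>)) (Tgt (SLft \<alpha>)) (Tgt (STop \<alpha>)) (Tgt (SRgt \<alpha>))
        (Tgt (SLft \<beta>)) (Tgt (SRgt \<beta>)) (STop \<alpha>) (SBot \<alpha>) (SLft \<alpha>) (SRgt \<alpha>) (SBot \<beta>) (SLft \<beta>) (SRgt \<beta>) \<alpha> \<beta>"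
      using Sq_Model[OF \<alpha>] Sq_Model[OF \<beta>] by (simp add: vcomp_squares_def eq')
    from vcomp_squares.HoSquare_vcomp[OF this]
    show "hcomp ?L (HoCompV (Lft ?K \<beta>) (Lft ?K \<alpha>)) (HoSquare (vcomp ?K \<beta> \<alpha>)) =
        hcomp ?L (vcomp ?L (HoSquare \<beta>) (HoSquare \<alpha>)) (HoCompV (Rgt ?K \<beta>) (Rgt ?K \<alpha>))"
      by (simp add: S)
  qed
qed

end
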